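(* Given a homogeneous semilattice $Y$ and a pair of finite homogeneous groups $I$ and $K^*$ of coprime orders, the Clifford semigroup $(Y\times I)\bowtie [Y;K^*]$ is a HIS. Conversely, every HIS with finite maximal subgroups is isomorphic to an inverse semigroup constructed in this way.
   Context: All structures are countable. An inverse semigroup $S$ is a HIS if every isomorphism between finitely generated inverse subsemigroups of $S$ extends to an automorphism of $S$. A group (semilattice) is homogeneous if every isomorphism between finitely generated subgroups (subsemilattices) extends to an automorphism. Two groups are of coprime orders if no element of one has the same order as an element of the other, except order $1$. The maximal subgroups of an inverse semigroup are the $\mathcal H$-classes $H_e$ of its idempotents $e$, where $a\,\mathcal H\,b$ iff $aa^{-1}=bb^{-1}$ and $a^{-1}a=b^{-1}b$. $Y\times I$ is the direct product of the semilattice $Y$ and the group $I$. $[Y;K]$ denotes the semigroup on $Y\times K$ with $(\alpha,g)*(\beta,h)$ equal to $(\alpha,gh)$ if $\alpha=\beta$, $(\beta,h)$ if $\alpha>\beta$, $(\alpha,g)$ if $\alpha<\beta$, and $(\alpha\beta,1)$ if $\alpha,\beta$ are incomparable (natural order: $\alpha\le\beta\iff\alpha\beta=\alpha$). The spined product $(Y\times I)\bowtie[Y;K]$ is the subsemigroup of $(Y\times I)\times[Y;K]$ consisting of the pairs $((\alpha,g),(\alpha,k))$ with equal first coordinate $\alpha\in Y$. *)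

theory Defs
  imports "HOL-Algebra.Algebra" "HOL-Library.Countable_Set"
begin

text \<open>
  Semigroups are represented by the record type \<^typ>\<open>'a monoid\<close>, so that \<^const>\<open>iso\<close>,
  \<^const>\<open>DirProd\<close> and the multiplication syntax of the library apply to semigroups and to
  groups alike. The field \<^const>\<open>one\<close> carries no meaning for a semigroup: none of the
  notions below, nor \<^const>\<open>iso\<close>, refers to it, except where the structure is a group.
\<close>

subsection \<open>Semigroups, inverse semigroups, semilattices\<close>

locale alg_semigroup =
  fixes S :: "('a, 'm) monoid_scheme" (structure)
  assumes carrier_nonempty: "carrier S \<noteq> {}"
    and mult_closed: "\<lbrakk>x \<in> carrier S; y \<in> carrier S\<rbrakk> \<Longrightarrow> x \<otimes> y \<in> carrier S"
    and mult_assoc: "\<lbrakk>x \<in> carrier S; y \<in> carrier S; z \<in> carrier S\<rbrakk>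
      \<Longrightarrow> (x \<otimes> y) \<otimes> z = x \<otimes> (y \<otimes> z)"

definition is_sinv :: "('a, 'm) monoid_scheme \<Rightarrow> 'a \<Rightarrow> 'a \<Rightarrow> bool" where
  "is_sinv S a b \<longleftrightarrow> b \<in> carrier S \<and> a \<otimes>\<^bsub>S\<^esub> b \<otimes>\<^bsub>S\<^esub> a = a \<and> b \<otimes>\<^bsub>S\<^esub> a \<otimes>\<^bsub>S\<^esub> b = b"

locale inverse_semigroup = alg_semigroup S for S (structure) +
  assumes unique_inverse: "a \<in> carrier S \<Longrightarrow> \<exists>!b. is_sinv S a b"

text \<open>The semigroup inverse; \<^const>\<open>m_inv\<close> is unsuitable since it refers to an identity.\<close>

definition sinv :: "('a, 'm) monoid_scheme \<Rightarrow> 'a \<Rightarrow> 'a" where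
  "sinv S a = (THE b. is_sinv S a b)"

definition idempotents :: "('a, 'm) monoid_scheme \<Rightarrow> 'a set" where
  "idempotents S = {e \<in> carrier S. e \<otimes>\<^bsub>S\<^esub> e = e}"

locale clifford_semigroup = inverse_semigroup S for S (structure) +
  assumes idempotents_central:
    "\<lbrakk>e \<in> idempotents S; x \<in> carrier S\<rbrakk> \<Longrightarrow> e \<otimes> x = x \<otimes> e"

locale alg_semilattice = alg_semigroup Y for Y (structure) +
  assumes mult_comm: "\<lbrakk>x \<in> carrier Y; y \<in> carrier Y\<rbrakk> \<Longrightarrow> x \<otimes> y = y \<otimes> x"
    and mult_idem: "x \<in> carrier Y \<Longrightarrow> x \<otimes> x = x"

definition sl_less :: "('a, 'm) monoid_scheme \<Rightarrow> 'a \<Rightarrow> 'a \<Rightarrow> bool" where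
  "sl_less Y \<alpha> \<beta> \<longleftrightarrow> \<alpha> \<otimes>\<^bsub>Y\<^esub> \<beta> = \<alpha> \<and> \<alpha> \<noteq> \<beta>"

definition H_class :: "('a, 'm) monoid_scheme \<Rightarrow> 'a \<Rightarrow> 'a set" where
  "H_class S e = {a \<in> carrier S. a \<otimes>\<^bsub>S\<^esub> sinv S a = e \<otimes>\<^bsub>S\<^esub> sinv S e
                              \<and> sinv S a \<otimes>\<^bsub>S\<^esub> a = sinv S e \<otimes>\<^bsub>S\<^esub> e}"

definition finite_maximal_subgroups :: "('a, 'm) monoid_scheme \<Rightarrow> bool" where
  "finite_maximal_subgroups S \<longleftrightarrow> (\<forall>e \<in> idempotents S. finite (H_class S e))"

subsection \<open>Homogeneity\<close>

inductive_set sl_generate :: "('a, 'm) monoid_scheme \<Rightarrow> 'a set \<Rightarrow> 'a set"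
  for S and A where
  incl: "a \<in> A \<Longrightarrow> a \<in> sl_generate S A"
| mult: "\<lbrakk>a \<in> sl_generate S A; b \<in> sl_generate S A\<rbrakk> \<Longrightarrow> a \<otimes>\<^bsub>S\<^esub> b \<in> sl_generate S A"

inductive_set inv_generate :: "('a, 'm) monoid_scheme \<Rightarrow> 'a set \<Rightarrow> 'a set"
  for S and A where
  incl: "a \<in> A \<Longrightarrow> a \<in> inv_generate S A"
| mult: "\<lbrakk>a \<in> inv_generate S A; b \<in> inv_generate S A\<rbrakk> \<Longrightarrow> a \<otimes>\<^bsub>S\<^esub> b \<in> inv_generate S A"
| inv: "a \<in> inv_generate S A \<Longrightarrow> sinv S a \<in> inv_generate S A"

definition isos_extend :: "('a, 'm) monoid_scheme \<Rightarrow> 'a set \<Rightarrow> 'a set \<Rightarrow> bool" where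
  "isos_extend S T U \<longleftrightarrow>
     (\<forall>\<phi> \<in> iso (S\<lparr>carrier := T\<rparr>) (S\<lparr>carrier := U\<rparr>).
        \<exists>\<theta> \<in> iso S S. \<forall>x \<in> T. \<theta> x = \<phi> x)"

text \<open>
  In the next three definitions the generating sets may be empty. For semigroups this only
  adds the empty map, which the identity automorphism extends.
\<close>

definition HIS :: "('a, 'm) monoid_scheme \<Rightarrow> bool" where
  "HIS S \<longleftrightarrow> inverse_semigroup S \<and>
     (\<forall>A B. finite A \<and> A \<subseteq> carrier S \<and> finite B \<and> B \<subseteq> carrier S
        \<longrightarrow> isos_extend S (inv_generate S A) (inv_generate S B))"

definition homogeneous_semilattice :: "('a, 'm) monoid_scheme \<Rightarrow> bool" where
  "homogeneous_semilattice Y \<longleftrightarrow> alg_semilattice Y \<and>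
     (\<forall>A B. finite A \<and> A \<subseteq> carrier Y \<and> finite B \<and> B \<subseteq> carrier Y
        \<longrightarrow> isos_extend Y (sl_generate Y A) (sl_generate Y B))"

definition homogeneous_group :: "('a, 'm) monoid_scheme \<Rightarrow> bool" where
  "homogeneous_group G \<longleftrightarrow> group G \<and>
     (\<forall>A B. finite A \<and> A \<subseteq> carrier G \<and> finite B \<and> B \<subseteq> carrier G
        \<longrightarrow> isos_extend G (generate G A) (generate G B))"

text \<open>\<^const>\<open>group.ord\<close> is 0 on elements of infinite order.\<close>

definition coprime_orders :: "('a, 'm) monoid_scheme \<Rightarrow> ('b, 'n) monoid_scheme \<Rightarrow> bool" where
  "coprime_orders G H \<longleftrightarrow>
     (\<forall>x \<in> carrier G. \<forall>y \<in> carrier H. group.ord G x = group.ord H y \<longrightarrow> group.ord G x = 1)"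

subsection \<open>The construction\<close>

text \<open>The semigroup $[Y;K]$.\<close>

definition sl_group :: "('a, 'm) monoid_scheme \<Rightarrow> ('b, 'n) monoid_scheme \<Rightarrow> ('a \<times> 'b) monoid" where
  "sl_group Y K =
     \<lparr>carrier = carrier Y \<times> carrier K,
      monoid.mult = (\<lambda>(\<alpha>, g) (\<beta>, h).
        if \<alpha> = \<beta> then (\<alpha>, g \<otimes>\<^bsub>K\<^esub> h)
        else if sl_less Y \<beta> \<alpha> then (\<beta>, h)
        else if sl_less Y \<alpha> \<beta> then (\<alpha>, g)
        else (\<alpha> \<otimes>\<^bsub>Y\<^esub> \<beta>, \<one>\<^bsub>K\<^esub>)),
      one = undefined\<rparr>"

definition spined_product ::
  "('y \<times> 'a, 'm) monoid_scheme \<Rightarrow> ('y \<times> 'b, 'n) monoid_scheme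
     \<Rightarrow> (('y \<times> 'a) \<times> ('y \<times> 'b)) monoid" where
  "spined_product P Q =
     (P \<times>\<times> Q)\<lparr>carrier := {(p, q). p \<in> carrier P \<and> q \<in> carrier Q \<and> fst p = fst q}\<rparr>"

end

theory Submission
  imports Defs
begin

text \<open>
  Automorphisms preserve Green's relations, and the idempotents form a homogeneous semilattice.
  If the maximal subgroups are finite, this forces \<open>a\<^sup>-\<^sup>1 a = a a\<^sup>-\<^sup>1\<close> for all \<open>a\<close>, so the semigroup
  is a semilattice of groups \<open>G e\<close> with connecting homomorphisms \<open>x \<mapsto> x f\<close> from \<open>G e\<close> to \<open>G f\<close>
  for \<open>f < e\<close>. Counting shows that their kernels \<open>K e\<close> do not depend on \<open>f\<close>. Elements of
  \<open>G f\<close> of the same order are conjugate under automorphisms that fix any given \<open>e \<ge> f\<close>; hence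
  \<open>K f\<close> and the image \<open>J f\<close> of \<open>G e\<close> are determined by the orders of their elements, the image does
  not depend on \<open>e\<close>, and \<open>G f = J f \<times> K f\<close> with coprime orders. The groups \<open>J e\<close> are identified by
  the connecting isomorphisms, and the groups \<open>K e\<close> by arbitrary automorphisms.

  Conversely, an isomorphism between finitely generated inverse subsemigroups of the spined product
  commutes with the projections to the three factors, because they are given by taking powers.
  It thus splits into isomorphisms of subsemilattices of \<open>Y\<close>, of subgroups of \<open>I\<close>, and, for each
  idempotent, of subgroups of \<open>K\<close>, all of which extend.
\<close>

section \<open>Inverse semigroups\<close>

text \<open>Finiteness enters in two ways: injections between finite sets of equal size are onto,
  and an infinite strictly decreasing sequence cannot take only finitely many values. An element of
  given order, together with a fixed idempotent above it, generates an inverse subsemigroup that is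
  determined by the order up to isomorphism; homogeneity then moves it to any other element of that
  order in the same group. So a subgroup preserved by such automorphisms is a union of order
  classes. This yields coprimality: an image element with the order of a kernel element lies in the
  kernel, and the two subgroups meet trivially, because a lift to a larger idempotent lies in the
  kernel towards every smaller idempotent at once. The two factors behave differently. In the
  converse, coprimality supplies an exponent that is 1 modulo all orders in one group and 0 modulo
  all orders in the other.\<close>

context inverse_semigroup begin

declare mult_closed [simp, intro]

lemma sinv_is_sinv: "a \<in> carrier S \<Longrightarrow> is_sinv S a (sinv S a)"
  unfolding sinv_def using unique_inverse by (rule theI')

lemma sinv_closed [simp, intro]: "a \<in> carrier S \<Longrightarrow> sinv S a \<in> carrier S"
  and mult_sinv_mult: "a \<in> carrier S \<Longrightarrow> a \<otimes> sinv S a \<otimes> a = a"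
  and sinv_mult_sinv: "a \<in> carrier S \<Longrightarrow> sinv S a \<otimes> a \<otimes> sinv S a = sinv S a"
  using sinv_is_sinv[of a] unfolding is_sinv_def by auto

lemma sinv_unique:
  "\<lbrakk>a \<in> carrier S; b \<in> carrier S; a \<otimes> b \<otimes> a = a; b \<otimes> a \<otimes> b = b\<rbrakk> \<Longrightarrow> sinv S a = b"
  using unique_inverse[of a] sinv_is_sinv[of a] unfolding is_sinv_def by blast

lemma sinv_sinv [simp]: "a \<in> carrier S \<Longrightarrow> sinv S (sinv S a) = a"
  by (rule sinv_unique) (auto simp: mult_sinv_mult sinv_mult_sinv)

lemma mult_left_eqI: "\<lbrakk>a \<otimes> b = c; a \<in> carrier S; b \<in> carrier S; x \<in> carrier S\<rbrakk> \<Longrightarrow> a \<otimes> (b \<otimes> x) = c \<otimes> x"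
  using mult_assoc by metis

lemma idempotents_closed: "e \<in> idempotents S \<Longrightarrow> e \<in> carrier S"
  and idempotents_idem: "e \<in> idempotents S \<Longrightarrow> e \<otimes> e = e"
  by (auto simp: idempotents_def)

lemma sinv_idempotent: "e \<in> idempotents S \<Longrightarrow> sinv S e = e"
  by (rule sinv_unique) (auto simp: idempotents_def)

text \<open>With \<open>x\<close> the inverse of \<open>e \<otimes> f\<close>, the element
  \<open>f \<otimes> x \<otimes> e\<close> is another inverse of it. Uniqueness gives
  \<open>x = f \<otimes> x \<otimes> e\<close>, whence \<open>x\<close> is idempotent; an idempotent
  is its own inverse, so \<open>e \<otimes> f = x\<close>.\<close>

lemma idempotents_mult_closed:
  assumes "e \<in> idempotents S" "f \<in> idempotents S"
  shows "e \<otimes> f \<in> idempotents S"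
proof -
  have c: "e \<in> carrier S" "f \<in> carrier S" and i: "e \<otimes> e = e" "f \<otimes> f = f"
    using assms by (auto simp: idempotents_def)
  note i' = mult_left_eqI[OF i(1) c(1) c(1)] mult_left_eqI[OF i(2) c(2) c(2)]
  define x where "x = sinv S (e \<otimes> f)"
  have x: "x \<in> carrier S" "e \<otimes> (f \<otimes> (x \<otimes> (e \<otimes> f))) = e \<otimes> f"
    "x \<otimes> (e \<otimes> (f \<otimes> x)) = x"
    using c mult_sinv_mult[of "e \<otimes> f"] sinv_mult_sinv[of "e \<otimes> f"]
    by (auto simp: x_def mult_assoc)
  have x': "x \<otimes> (e \<otimes> (f \<otimes> (x \<otimes> y))) = x \<otimes> y" if "y \<in> carrier S" for y
    using x c that mult_assoc by (metis mult_closed)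
  have "x = f \<otimes> x \<otimes> e"
    unfolding x_def by (rule sinv_unique) (use c x x' i i' in \<open>simp_all add: mult_assoc flip: x_def\<close>)
  then have "x \<otimes> x = x"
    using x x' c i i' by (metis mult_assoc mult_closed)
  then have "x \<in> idempotents S"
    using x by (simp add: idempotents_def)
  then have "e \<otimes> f = x"
    using c sinv_idempotent[of x] by (simp add: x_def)
  with \<open>x \<in> idempotents S\<close> show ?thesis by simp
qed

text \<open>Both \<open>e \<otimes> f\<close> and \<open>f \<otimes> e\<close> are idempotent, which
  makes \<open>f \<otimes> e\<close> an inverse of \<open>e \<otimes> f\<close>; but an idempotent
  is its own inverse.\<close>

lemma idempotents_commute:
  assumes "e \<in> idempotents S" "f \<in> idempotents S"
  shows "e \<otimes> f = f \<otimes> e"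
proof -
  have c: "e \<in> carrier S" "f \<in> carrier S" and i: "e \<otimes> e = e" "f \<otimes> f = f"
    using assms by (auto simp: idempotents_def)
  note i' = mult_left_eqI[OF i(1) c(1) c(1)] mult_left_eqI[OF i(2) c(2) c(2)]
  have ef: "e \<otimes> f \<in> idempotents S" "f \<otimes> e \<in> idempotents S"
    using assms by (auto intro: idempotents_mult_closed)
  have "sinv S (e \<otimes> f) = f \<otimes> e"
    by (rule sinv_unique)
      (use c i' ef in \<open>auto simp: mult_assoc idempotents_def\<close>)
  then show ?thesis
    using sinv_idempotent[OF ef(1)] by simp
qed

lemma mult_sinv_idempotent: "a \<in> carrier S \<Longrightarrow> a \<otimes> sinv S a \<in> idempotents S"
  and sinv_mult_idempotent: "a \<in> carrier S \<Longrightarrow> sinv S a \<otimes> a \<in> idempotents S"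
  using mult_sinv_mult[of a] sinv_mult_sinv[of a]
  by (auto simp: idempotents_def mult_assoc)

text \<open>The idempotents \<open>sinv S a \<otimes> a\<close> and
  \<open>b \<otimes> sinv S b\<close> meet in the middle of both products; swapping them lets each
  be absorbed.\<close>

lemma sinv_mult:
  assumes a: "a \<in> carrier S" and b: "b \<in> carrier S"
  shows "sinv S (a \<otimes> b) = sinv S b \<otimes> sinv S a"
proof -
  let ?e = "sinv S a \<otimes> a" and ?f = "b \<otimes> sinv S b"
  have ef: "?e \<otimes> ?f = ?f \<otimes> ?e" using a b
    by (intro idempotents_commute mult_sinv_idempotent sinv_mult_idempotent)
  have "a \<otimes> b \<otimes> (sinv S b \<otimes> sinv S a) \<otimes> (a \<otimes> b) = a \<otimes> (?f \<otimes> ?e) \<otimes> b"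
    using a b by (simp add: mult_assoc)
  also have "\<dots> = (a \<otimes> sinv S a \<otimes> a) \<otimes> (b \<otimes> sinv S b \<otimes> b)"
    using a b by (subst ef[symmetric]) (simp add: mult_assoc)
  also have "\<dots> = a \<otimes> b" using a b by (simp add: mult_sinv_mult)
  finally have 1: "a \<otimes> b \<otimes> (sinv S b \<otimes> sinv S a) \<otimes> (a \<otimes> b) = a \<otimes> b" .
  have "sinv S b \<otimes> sinv S a \<otimes> (a \<otimes> b) \<otimes> (sinv S b \<otimes> sinv S a) = sinv S b \<otimes> (?e \<otimes> ?f) \<otimes> sinv S a"
    using a b by (simp add: mult_assoc)
  also have "\<dots> = (sinv S b \<otimes> b \<otimes> sinv S b) \<otimes> (sinv S a \<otimes> a \<otimes> sinv S a)"
    using a b by (subst ef) (simp add: mult_assoc)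
  also have "\<dots> = sinv S b \<otimes> sinv S a" using a b by (simp add: sinv_mult_sinv)
  finally have 2: "sinv S b \<otimes> sinv S a \<otimes> (a \<otimes> b) \<otimes> (sinv S b \<otimes> sinv S a) = sinv S b \<otimes> sinv S a" .
  from 1 2 show ?thesis using a b by (intro sinv_unique) auto
qed

lemma H_class_eq:
  "e \<in> idempotents S \<Longrightarrow> H_class S e = {a \<in> carrier S. a \<otimes> sinv S a = e \<and> sinv S a \<otimes> a = e}"
  by (simp add: H_class_def sinv_idempotent idempotents_idem)

lemma idempotents_alg_semilattice: "alg_semilattice (S\<lparr>carrier := idempotents S\<rparr>)"
proof unfold_locales
  show "carrier (S\<lparr>carrier := idempotents S\<rparr>) \<noteq> {}"
    using carrier_nonempty mult_sinv_idempotent by fastforce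
qed (auto simp: idempotents_mult_closed idempotents_idem mult_assoc idempotents_closed
    intro: idempotents_commute)

lemma sl_less_trans:
  assumes "e \<in> idempotents S" "f \<in> idempotents S" "g \<in> idempotents S" "sl_less S e f" "sl_less S f g"
  shows "sl_less S e g"
  using assms idempotents_commute[of f g] idempotents_commute[of e f]
  by (metis idempotents_closed mult_assoc sl_less_def)

lemma inv_generate_incl_carrier:
  assumes "A \<subseteq> carrier S" "x \<in> inv_generate S A"
  shows "x \<in> carrier S"
  using assms(2) by induct (use assms(1) in auto)

end

lemma isoD:
  assumes "\<theta> \<in> iso S T"
  shows "x \<in> carrier S \<Longrightarrow> \<theta> x \<in> carrier T"
    and "\<lbrakk>x \<in> carrier S; y \<in> carrier S\<rbrakk> \<Longrightarrow> \<theta> (x \<otimes>\<^bsub>S\<^esub> y) = \<theta> x \<otimes>\<^bsub>T\<^esub> \<theta> y"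
    and "inj_on \<theta> (carrier S)" and "\<theta> ` carrier S = carrier T"
  using assms by (auto simp: iso_def hom_def bij_betw_def)

lemma isoI:
  assumes "\<And>x. x \<in> carrier S \<Longrightarrow> \<theta> x \<in> carrier T"
    and "\<And>x y. \<lbrakk>x \<in> carrier S; y \<in> carrier S\<rbrakk> \<Longrightarrow> \<theta> (x \<otimes>\<^bsub>S\<^esub> y) = \<theta> x \<otimes>\<^bsub>T\<^esub> \<theta> y"
    and "inj_on \<theta> (carrier S)" and "carrier T \<subseteq> \<theta> ` carrier S"
  shows "\<theta> \<in> iso S T"
  using assms by (auto simp: iso_def hom_def bij_betw_def)

lemma iso_carrierI:
  assumes "\<And>x. x \<in> T \<Longrightarrow> \<phi> x \<in> U"
    and "\<And>x y. \<lbrakk>x \<in> T; y \<in> T\<rbrakk> \<Longrightarrow> \<phi> (x \<otimes>\<^bsub>S\<^esub> y) = \<phi> x \<otimes>\<^bsub>S\<^esub> \<phi> y"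
    and "inj_on \<phi> T" and "U \<subseteq> \<phi> ` T"
  shows "\<phi> \<in> iso (S\<lparr>carrier := T\<rparr>) (S\<lparr>carrier := U\<rparr>)"
  by (rule isoI) (simp_all add: assms)

lemma (in alg_semigroup) iso_set_inv:
  assumes "\<theta> \<in> iso S T"
  shows "inv_into (carrier S) \<theta> \<in> iso T S"
proof (rule isoI)
  note * = isoD[OF assms]
  fix x y assume xy: "x \<in> carrier T" "y \<in> carrier T"
  show "inv_into (carrier S) \<theta> x \<in> carrier S"
    using xy * by (metis inv_into_into)
  obtain a b where ab: "a \<in> carrier S" "b \<in> carrier S" "x = \<theta> a" "y = \<theta> b"
    using xy *(4) by blast
  then show "inv_into (carrier S) \<theta> (x \<otimes>\<^bsub>T\<^esub> y) = inv_into (carrier S) \<theta> x \<otimes> inv_into (carrier S) \<theta> y"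
    using * by (simp add: mult_closed flip: *(2))
next
  note * = isoD[OF assms]
  show "inj_on (inv_into (carrier S) \<theta>) (carrier T)"
    using *(4) by (metis inj_on_inv_into subset_refl)
  show "carrier S \<subseteq> inv_into (carrier S) \<theta> ` carrier T"
  proof
    fix x assume "x \<in> carrier S"
    then have "x = inv_into (carrier S) \<theta> (\<theta> x)" "\<theta> x \<in> carrier T" using * by auto
    then show "x \<in> inv_into (carrier S) \<theta> ` carrier T" by (rule image_eqI)
  qed
qed

context inverse_semigroup begin

lemma aut_sinv:
  assumes "\<theta> \<in> iso S S" "x \<in> carrier S"
  shows "\<theta> (sinv S x) = sinv S (\<theta> x)"
proof -
  note * = isoD[OF assms(1)]
  have "\<theta> x \<otimes> \<theta> (sinv S x) \<otimes> \<theta> x = \<theta> (x \<otimes> sinv S x \<otimes> x)"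
    "\<theta> (sinv S x) \<otimes> \<theta> x \<otimes> \<theta> (sinv S x) = \<theta> (sinv S x \<otimes> x \<otimes> sinv S x)"
    using assms * by auto
  then show ?thesis
    using assms *(1) by (intro sinv_unique[symmetric]) (auto simp: mult_sinv_mult sinv_mult_sinv)
qed

lemma aut_idempotent:
  "\<lbrakk>\<theta> \<in> iso S S; e \<in> idempotents S\<rbrakk> \<Longrightarrow> \<theta> e \<in> idempotents S"
  using isoD[of \<theta> S S] unfolding idempotents_def by (metis (mono_tags, lifting) mem_Collect_eq)

lemma aut_sl_less:
  assumes "\<theta> \<in> iso S S" "e \<in> idempotents S" "f \<in> idempotents S" "sl_less S e f"
  shows "sl_less S (\<theta> e) (\<theta> f)"
proof -
  have "\<theta> e \<otimes> \<theta> f = \<theta> e"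
    using assms isoD(2)[OF assms(1), of e f] by (simp add: sl_less_def idempotents_closed)
  moreover have "\<theta> e \<noteq> \<theta> f"
    using assms isoD(3)[OF assms(1)] by (auto simp: sl_less_def inj_on_def idempotents_closed)
  ultimately show ?thesis by (simp add: sl_less_def)
qed

end

section \<open>Homogeneous inverse semigroups are Clifford semigroups\<close>

locale finite_HIS = inverse_semigroup +
  assumes HIS: "HIS S"
    and finite_H_class: "e \<in> idempotents S \<Longrightarrow> finite (H_class S e)"
begin

section \<open>Extension of isomorphisms between small subsemilattices\<close>

lemma extend_iso:
  assumes "finite A" "A \<subseteq> carrier S" "finite B" "B \<subseteq> carrier S"
    and "inv_generate S A = T" "inv_generate S B = U"
    and "\<phi> \<in> iso (S\<lparr>carrier := T\<rparr>) (S\<lparr>carrier := U\<rparr>)"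
  obtains \<theta> where "\<theta> \<in> iso S S" "\<And>x. x \<in> T \<Longrightarrow> \<theta> x = \<phi> x"
proof -
  have "isos_extend S (inv_generate S A) (inv_generate S B)"
    using assms(1-4) HIS unfolding HIS_def by simp
  then have "\<exists>\<theta> \<in> iso S S. \<forall>x \<in> T. \<theta> x = \<phi> x"
    using assms(7) unfolding isos_extend_def assms(5,6) by simp
  then show thesis using that by (elim bexE) simp
qed

lemma inv_generate_subsemilattice:
  assumes "A \<subseteq> idempotents S" "\<And>x y. \<lbrakk>x \<in> A; y \<in> A\<rbrakk> \<Longrightarrow> x \<otimes> y \<in> A"
  shows "inv_generate S A = A"
proof
  show "inv_generate S A \<subseteq> A"
  proof
    fix x assume "x \<in> inv_generate S A"
    then show "x \<in> A"
      by induct (use assms in \<open>auto simp: sinv_idempotent subset_iff\<close>)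
  qed
qed (auto intro: inv_generate.incl)

text \<open>A finite set of idempotents closed under products is the inverse subsemigroup it
  generates, so homogeneity covers every multiplicative injection of it into the idempotents. The
  results for chains and incomparable pairs are instances.\<close>

lemma extend_semilattice_iso:
  assumes "finite A" "A \<subseteq> idempotents S"
    and A: "\<And>x y. \<lbrakk>x \<in> A; y \<in> A\<rbrakk> \<Longrightarrow> x \<otimes> y \<in> A \<and> \<phi> (x \<otimes> y) = \<phi> x \<otimes> \<phi> y"
    and "inj_on \<phi> A" "\<phi> ` A \<subseteq> idempotents S"
  obtains \<theta> where "\<theta> \<in> iso S S" "\<And>x. x \<in> A \<Longrightarrow> \<theta> x = \<phi> x"
proof (rule extend_iso[of A "\<phi> ` A"])
  show "inv_generate S A = A"
    using assms(2) A by (intro inv_generate_subsemilattice) auto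
  have "x \<otimes> y \<in> \<phi> ` A" if xy: "x \<in> \<phi> ` A" "y \<in> \<phi> ` A" for x y
  proof -
    obtain a b where ab: "a \<in> A" "b \<in> A" "x = \<phi> a" "y = \<phi> b"
      using xy by blast
    then have "x \<otimes> y = \<phi> (a \<otimes> b)" "a \<otimes> b \<in> A" using A by simp_all
    then show ?thesis by blast
  qed
  then show "inv_generate S (\<phi> ` A) = \<phi> ` A"
    using assms(5) by (intro inv_generate_subsemilattice) auto
  show "\<phi> \<in> iso (S\<lparr>carrier := A\<rparr>) (S\<lparr>carrier := \<phi> ` A\<rparr>)"
    by (rule isoI) (use assms in auto)
qed (use assms idempotents_closed in auto)

lemma extend_idempotent:
  assumes "e \<in> idempotents S" "e' \<in> idempotents S"
  obtains \<theta> where "\<theta> \<in> iso S S" "\<theta> e = e'"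
  by (rule extend_semilattice_iso[of "{e}" "\<lambda>_. e'"])
    (use assms that in \<open>simp_all add: idempotents_idem\<close>)

lemma extend_chain2:
  assumes "{e, f, e', f'} \<subseteq> idempotents S" "sl_less S f e" "sl_less S f' e'"
  obtains \<theta> where "\<theta> \<in> iso S S" "\<theta> e = e'" "\<theta> f = f'"
proof (rule extend_semilattice_iso[of "{e, f}" "\<lambda>x. if x = e then e' else f'"])
  fix x y assume "x \<in> {e, f}" "y \<in> {e, f}"
  then show "x \<otimes> y \<in> {e, f} \<and> (if x \<otimes> y = e then e' else f')
      = (if x = e then e' else f') \<otimes> (if y = e then e' else f')"
    using assms idempotents_commute[of e f] idempotents_commute[of e' f']
    by (auto simp: sl_less_def idempotents_idem)
qed (use assms that in \<open>auto simp: sl_less_def\<close>)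

lemma extend_chain3:
  assumes "{e, f, g, e', f', g'} \<subseteq> idempotents S"
    and "sl_less S f e" "sl_less S g f" "sl_less S f' e'" "sl_less S g' f'"
  obtains \<theta> where "\<theta> \<in> iso S S" "\<theta> e = e'" "\<theta> f = f'" "\<theta> g = g'"
proof -
  have eg: "sl_less S g e" "sl_less S g' e'"
    using assms sl_less_trans by auto
  let ?\<phi> = "\<lambda>x. if x = e then e' else if x = f then f' else g'"
  show thesis
  proof (rule extend_semilattice_iso[of "{e, f, g}" ?\<phi>])
    fix x y assume "x \<in> {e, f, g}" "y \<in> {e, f, g}"
    then show "x \<otimes> y \<in> {e, f, g} \<and> ?\<phi> (x \<otimes> y) = ?\<phi> x \<otimes> ?\<phi> y"
      using assms eg idempotents_commute[of e f] idempotents_commute[of e' f']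
        idempotents_commute[of e g] idempotents_commute[of e' g']
        idempotents_commute[of f g] idempotents_commute[of f' g']
      by (auto simp: sl_less_def idempotents_idem)
  qed (use assms eg that in \<open>auto simp: sl_less_def\<close>)
qed

definition incomparable :: "'a \<Rightarrow> 'a \<Rightarrow> bool" where
  "incomparable e f \<longleftrightarrow> e \<otimes> f \<noteq> e \<and> e \<otimes> f \<noteq> f"

text \<open>An incomparable pair generates the three-element semilattice \<open>e\<close>,
  \<open>f\<close>, \<open>e \<otimes> f\<close>, always with the same table, so incomparable pairs
  form a single orbit under automorphisms.\<close>

lemma extend_incomparable:
  assumes ids: "{e, f, e', f'} \<subseteq> idempotents S" and "incomparable e f" "incomparable e' f'"
  obtains \<theta> where "\<theta> \<in> iso S S" "\<theta> e = e'" "\<theta> f = f'"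
proof -
  note ext = that
  let ?\<phi> = "\<lambda>x. if x = e then e' else if x = f then f' else e' \<otimes> f'"
  have *: "f \<otimes> e = e \<otimes> f \<and> e \<otimes> (e \<otimes> f) = e \<otimes> f \<and> f \<otimes> (e \<otimes> f) = e \<otimes> f
      \<and> (e \<otimes> f) \<otimes> e = e \<otimes> f \<and> (e \<otimes> f) \<otimes> f = e \<otimes> f \<and> (e \<otimes> f) \<otimes> (e \<otimes> f) = e \<otimes> f"
    if "e \<in> idempotents S" "f \<in> idempotents S" for e f
    using that idempotents_commute[of e f] idempotents_closed idempotents_idem
      idempotents_mult_closed
    by (metis mult_assoc)
  show thesis
  proof (rule extend_semilattice_iso[of "{e, f, e \<otimes> f}" ?\<phi>])
    fix x y assume xy: "x \<in> {e, f, e \<otimes> f}" "y \<in> {e, f, e \<otimes> f}"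
    show "x \<otimes> y \<in> {e, f, e \<otimes> f} \<and> ?\<phi> (x \<otimes> y) = ?\<phi> x \<otimes> ?\<phi> y"
      using xy assms *[of e f] *[of e' f'] idempotents_idem
      unfolding incomparable_def by (elim insertE emptyE) auto
  next
    have "e \<noteq> f" "e' \<noteq> f'"
      using assms idempotents_idem by (auto simp: incomparable_def)
    then show "inj_on ?\<phi> {e, f, e \<otimes> f}"
      using assms(2,3) by (auto simp: incomparable_def)
    show thesis
      if \<theta>: "\<theta> \<in> iso S S" "\<And>x. x \<in> {e, f, e \<otimes> f} \<Longrightarrow> \<theta> x = ?\<phi> x" for \<theta>
      using \<theta>(2)[of e] \<theta>(2)[of f] \<open>e \<noteq> f\<close> by (intro ext[OF \<theta>(1)]) simp_all
  qed (use ids idempotents_mult_closed in auto)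
qed

text \<open>Conjugation by \<open>a\<close> is multiplicative on idempotents, since
  \<open>a \<otimes> sinv S a\<close> can be moved past \<open>k\<close> and absorbed by
  \<open>a\<close>. Iterating it produces the decreasing sequence used next.\<close>

lemma conj_idempotents:
  assumes "a \<in> carrier S" "h \<in> idempotents S" "k \<in> idempotents S"
  shows "sinv S a \<otimes> h \<otimes> a \<in> idempotents S"
    and "(sinv S a \<otimes> h \<otimes> a) \<otimes> (sinv S a \<otimes> k \<otimes> a) = sinv S a \<otimes> (h \<otimes> k) \<otimes> a"
proof -
  have main: "(sinv S a \<otimes> h \<otimes> a) \<otimes> (sinv S a \<otimes> k \<otimes> a) = sinv S a \<otimes> (h \<otimes> k) \<otimes> a"
    if "h \<in> idempotents S" "k \<in> idempotents S" for h k
  proof -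
    note c = assms(1) idempotents_closed[OF that(1)] idempotents_closed[OF that(2)]
    have "(sinv S a \<otimes> h \<otimes> a) \<otimes> (sinv S a \<otimes> k \<otimes> a) = sinv S a \<otimes> h \<otimes> ((a \<otimes> sinv S a) \<otimes> k) \<otimes> a"
      using c by (simp add: mult_assoc)
    also have "\<dots> = sinv S a \<otimes> h \<otimes> (k \<otimes> (a \<otimes> sinv S a)) \<otimes> a"
      using idempotents_commute[OF mult_sinv_idempotent[OF c(1)] that(2)] by simp
    also have "\<dots> = sinv S a \<otimes> h \<otimes> k \<otimes> (a \<otimes> sinv S a \<otimes> a)"
      using c by (simp add: mult_assoc)
    finally show ?thesis using c by (simp add: mult_sinv_mult) (simp add: mult_assoc)
  qed
  then show "(sinv S a \<otimes> h \<otimes> a) \<otimes> (sinv S a \<otimes> k \<otimes> a) = sinv S a \<otimes> (h \<otimes> k) \<otimes> a"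
    using assms by simp
  show "sinv S a \<otimes> h \<otimes> a \<in> idempotents S"
    using main[of h h] assms by (auto simp: idempotents_def)
qed

text \<open>Otherwise the idempotents \<open>g n = a\<^sup>-\<^sup>n a\<^sup>n\<close> form a strictly decreasing sequence.
  For each \<open>k \<ge> 2\<close> an automorphism fixes \<open>g 0\<close> and \<open>g 1\<close> and maps \<open>g 2\<close> to \<open>g k\<close>. Since it
  maps \<open>a\<close> to some \<open>h \<otimes> a\<close> with \<open>h\<close> in the finite group of \<open>g 0\<close>, only finitely many values
  \<open>g k\<close> are possible.\<close>

lemma not_sinv_mult_less:
  assumes a: "a \<in> carrier S"
  shows "\<not> sl_less S (sinv S a \<otimes> a) (a \<otimes> sinv S a)"
proof
  let ?e = "a \<otimes> sinv S a" and ?f = "sinv S a \<otimes> a"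
  assume less: "sl_less S ?f ?e"
  have e: "?e \<in> idempotents S" and f: "?f \<in> idempotents S"
    using a by (auto intro: mult_sinv_idempotent sinv_mult_idempotent)
  define c where "c h = sinv S a \<otimes> h \<otimes> a" for h
  define g where "g n = (c ^^ n) ?e" for n
  have g_Suc: "g (Suc n) = c (g n)" and g_0: "g 0 = ?e" for n
    by (simp_all add: g_def)
  \<comment> \<open>On idempotents below \<open>?e\<close> conjugation is undone by
    \<open>h \<mapsto> a \<otimes> h \<otimes> sinv S a\<close>; this keeps the sequence
    strict.\<close>
  have c_inj: "h = k" if "h \<in> idempotents S" "k \<in> idempotents S" "h \<otimes> ?e = h" "k \<otimes> ?e = k" "c h = c k"
    for h k
  proof -
    have "h = a \<otimes> c h \<otimes> sinv S a" if "h \<in> idempotents S" "h \<otimes> ?e = h" for h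
    proof -
      have "a \<otimes> c h \<otimes> sinv S a = ?e \<otimes> (h \<otimes> ?e)"
        using a that idempotents_closed by (simp add: c_def mult_assoc)
      also have "\<dots> = h"
        using that idempotents_commute[OF that(1) e] by simp
      finally show ?thesis by simp
    qed
    from this[OF that(1,3)] this[OF that(2,4)] that(5) show ?thesis by simp
  qed
  have g1: "g 1 = ?f"
    using a mult_sinv_mult[OF a] by (simp add: g_Suc g_0 c_def mult_assoc)
  have g_idem: "g n \<in> idempotents S" for n
    by (induct n) (use a e conj_idempotents(1) in \<open>auto simp: g_0 g_Suc c_def\<close>)
  have g_less: "sl_less S (g (Suc n)) (g n) \<and> g n \<otimes> ?e = g n" for n
  proof (induct n)
    case 0
    then show ?case using less g1 e by (simp add: g_0 idempotents_idem)
  next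
    case (Suc n)
    have "g (Suc n) \<otimes> ?e = g (Suc n) \<otimes> (g n \<otimes> ?e)"
      using Suc g_idem e idempotents_closed mult_assoc unfolding sl_less_def by metis
    then have *: "g (Suc n) \<otimes> ?e = g (Suc n)"
      using Suc by (simp add: sl_less_def)
    have "c (g (Suc n)) \<otimes> c (g n) = c (g (Suc n))"
      using conj_idempotents(2)[OF a g_idem g_idem, of "Suc n" n] Suc by (simp add: c_def sl_less_def)
    moreover have "c (g (Suc n)) \<noteq> c (g n)"
      using c_inj[OF g_idem g_idem, of "Suc n" n] Suc * by (auto simp: sl_less_def)
    ultimately show ?case using * by (simp add: g_Suc sl_less_def)
  qed
  have g_less': "sl_less S (g n) (g m)" if "m < n" for m n
    using that
  proof (induct n)
    case (Suc n)
    then show ?case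
      using g_less[of n] sl_less_trans[OF g_idem g_idem g_idem, of "Suc n" n m] by (cases "m = n") auto
  qed simp
  then have inj: "inj g"
    by (metis injI linorder_neqE_nat sl_less_def)
  \<comment> \<open>The index starts at 2 because the strict chain \<open>g 0\<close>,
    \<open>g 1\<close>, \<open>g 2\<close> can only be carried to a strict chain \<open>g 0\<close>,
    \<open>g 1\<close>, \<open>g (Suc (Suc n))\<close>.\<close>
  have g_eq: "g (Suc (Suc n)) \<in> (\<lambda>h. sinv S (h \<otimes> a) \<otimes> ?f \<otimes> (h \<otimes> a)) ` H_class S ?e" for n
  proof -
    obtain \<theta> where \<theta>: "\<theta> \<in> iso S S" "\<theta> ?e = ?e" "\<theta> ?f = ?f" "\<theta> (g 2) = g (Suc (Suc n))"
      by (rule extend_chain3[of ?e ?f "g 2" ?e ?f "g (Suc (Suc n))"])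
        (use e f g_idem less g_less'[of 1 2] g_less'[of 1 "Suc (Suc n)"] g1 in auto)
    note [simp] = isoD(1)[OF \<theta>(1)]
    \<comment> \<open>\<open>\<theta>\<close> fixes both idempotents of \<open>a\<close>, so
      \<open>\<theta> a\<close> and \<open>a\<close> are H-related and differ by a left factor from
      the group of \<open>?e\<close>.\<close>
    let ?h = "\<theta> a \<otimes> sinv S a"
    have sh: "sinv S ?h = a \<otimes> \<theta> (sinv S a)"
      using a \<theta> by (simp add: sinv_mult aut_sinv)
    have "?h \<otimes> sinv S ?h = \<theta> a \<otimes> \<theta> ?f \<otimes> \<theta> (sinv S a)"
      using a by (simp add: sh \<theta>(3)) (simp add: mult_assoc)
    also have "\<dots> = \<theta> (a \<otimes> ?f \<otimes> sinv S a)"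
      using a isoD(2)[OF \<theta>(1)] by simp
    also have "a \<otimes> ?f \<otimes> sinv S a = ?e"
      using a mult_sinv_mult[OF a] by (simp flip: mult_assoc)
    finally have h1: "?h \<otimes> sinv S ?h = ?e" using \<theta> by simp
    have "sinv S ?h \<otimes> ?h = a \<otimes> (\<theta> (sinv S a) \<otimes> \<theta> a) \<otimes> sinv S a"
      using a by (simp add: sh mult_assoc)
    also have "\<theta> (sinv S a) \<otimes> \<theta> a = ?f"
      using a \<theta>(3) isoD(2)[OF \<theta>(1), of "sinv S a" a] by simp
    also have "a \<otimes> ?f \<otimes> sinv S a = ?e"
      using a mult_sinv_mult[OF a] by (simp flip: mult_assoc)
    finally have h: "?h \<in> H_class S ?e"
      using h1 a e by (simp add: H_class_eq)
    have "?h \<otimes> a = \<theta> a \<otimes> \<theta> ?f"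
      using a by (simp add: mult_assoc \<theta>(3))
    also have "\<dots> = \<theta> a"
      using a isoD(2)[OF \<theta>(1), of a ?f] mult_sinv_mult[OF a] by (simp add: mult_assoc)
    finally have ha: "?h \<otimes> a = \<theta> a" .
    have "g (Suc (Suc n)) = \<theta> (sinv S a \<otimes> ?f \<otimes> a)"
      using \<theta>(4) g1 by (simp add: numeral_2_eq_2 g_Suc c_def)
    also have "\<dots> = sinv S (\<theta> a) \<otimes> ?f \<otimes> \<theta> a"
      using a \<theta>(3) isoD(2)[OF \<theta>(1)] by (simp add: aut_sinv[OF \<theta>(1)])
    finally show ?thesis using h ha by (intro image_eqI[of _ _ ?h]) auto
  qed
  then have "range (\<lambda>n. g (Suc (Suc n))) \<subseteq> (\<lambda>h. sinv S (h \<otimes> a) \<otimes> ?f \<otimes> (h \<otimes> a)) ` H_class S ?e"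
    by blast
  moreover have "finite (H_class S ?e)" using e by (rule finite_H_class)
  ultimately have "finite (range (\<lambda>n. g (Suc (Suc n))))"
    by (meson finite_imageI finite_subset)
  moreover have "inj (\<lambda>n. g (Suc (Suc n)))"
    using inj by (auto intro!: injI dest: injD)
  ultimately show False
    using finite_imageD infinite_UNIV_nat by blast
qed

text \<open>Green's relation D, restricted to idempotents. Showing that it is equality amounts to
  showing that every element commutes with its inverse.\<close>

definition D_rel :: "'a \<Rightarrow> 'a \<Rightarrow> bool" where
  "D_rel e f \<longleftrightarrow> (\<exists>a \<in> carrier S. a \<otimes> sinv S a = e \<and> sinv S a \<otimes> a = f)"

lemma D_rel_sym: "D_rel e f \<Longrightarrow> D_rel f e"
  unfolding D_rel_def by (metis sinv_closed sinv_sinv)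

lemma D_rel_trans:
  assumes "D_rel e f" "D_rel f g"
  shows "D_rel e g"
proof -
  obtain a b where a: "a \<in> carrier S" "a \<otimes> sinv S a = e" "sinv S a \<otimes> a = f"
    and b: "b \<in> carrier S" "b \<otimes> sinv S b = f" "sinv S b \<otimes> b = g"
    using assms unfolding D_rel_def by blast
  have "(a \<otimes> b) \<otimes> sinv S (a \<otimes> b) = a \<otimes> (b \<otimes> sinv S b) \<otimes> sinv S a"
    using a(1) b(1) by (simp add: sinv_mult mult_assoc)
  also have "\<dots> = (a \<otimes> sinv S a \<otimes> a) \<otimes> sinv S a"
    using a(1) b(1) by (simp add: b(2) flip: a(3)) (simp add: mult_assoc)
  finally have 1: "(a \<otimes> b) \<otimes> sinv S (a \<otimes> b) = e"
    using a mult_sinv_mult[OF a(1)] by simp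
  have "sinv S (a \<otimes> b) \<otimes> (a \<otimes> b) = sinv S b \<otimes> (sinv S a \<otimes> a) \<otimes> b"
    using a(1) b(1) by (simp add: sinv_mult mult_assoc)
  also have "\<dots> = sinv S b \<otimes> (b \<otimes> sinv S b \<otimes> b)"
    using a(1) b(1) by (simp add: a(3) flip: b(2)) (simp add: mult_assoc)
  finally have 2: "sinv S (a \<otimes> b) \<otimes> (a \<otimes> b) = g"
    using b mult_sinv_mult[OF b(1)] by (simp add: mult_assoc)
  from 1 2 a(1) b(1) show ?thesis unfolding D_rel_def by blast
qed

lemma D_rel_not_less: "D_rel e f \<Longrightarrow> \<not> sl_less S f e"
  using not_sinv_mult_less unfolding D_rel_def by blast

lemma D_rel_aut:
  assumes "\<theta> \<in> iso S S" "D_rel e f"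
  shows "D_rel (\<theta> e) (\<theta> f)"
proof -
  obtain a where a: "a \<in> carrier S" "a \<otimes> sinv S a = e" "sinv S a \<otimes> a = f"
    using assms(2) unfolding D_rel_def by blast
  have "\<theta> a \<otimes> sinv S (\<theta> a) = \<theta> (a \<otimes> sinv S a)" "sinv S (\<theta> a) \<otimes> \<theta> a = \<theta> (sinv S a \<otimes> a)"
    using a(1) by (simp_all add: isoD(2)[OF assms(1)] aut_sinv[OF assms(1)])
  moreover have "\<theta> a \<in> carrier S" using isoD(1)[OF assms(1) a(1)] .
  ultimately show ?thesis
    unfolding D_rel_def a(2,3) by blast
qed

text \<open>Distinct D-related idempotents are incomparable, and then all incomparable pairs are
  D-related, since they form one orbit. Moving \<open>e\<close> down to
  \<open>?g = e \<otimes> f\<close> moves \<open>f\<close> to some \<open>w\<close> incomparable to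
  \<open>?g\<close>. Any \<open>v\<close> strictly above \<open>?g\<close> lies above
  \<open>w\<close>: otherwise \<open>v\<close> is below \<open>w\<close>, which puts
  \<open>?g\<close> below \<open>w\<close>, or \<open>v\<close> is D-related to \<open>w\<close> and
  hence to the smaller \<open>?g\<close>. For \<open>v = e\<close> and \<open>v = f\<close> this
  puts \<open>w\<close> below \<open>?g\<close>, a contradiction.\<close>

lemma D_rel_eq:
  assumes "D_rel e f"
  shows "e = f"
proof (rule ccontr)
  assume "e \<noteq> f"
  have e: "e \<in> idempotents S" and f: "f \<in> idempotents S"
    using assms mult_sinv_idempotent sinv_mult_idempotent unfolding D_rel_def by auto
  note comm = idempotents_commute
  have inc: "incomparable e f"
    using D_rel_not_less[OF assms] D_rel_not_less[OF D_rel_sym[OF assms]] \<open>e \<noteq> f\<close> comm[OF e f]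
    unfolding incomparable_def sl_less_def by metis
  have inc_D: "D_rel u v" if uv: "u \<in> idempotents S" "v \<in> idempotents S" "incomparable u v" for u v
  proof -
    obtain \<theta> where "\<theta> \<in> iso S S" "\<theta> e = u" "\<theta> f = v"
      by (rule extend_incomparable[of e f u v]) (use e f uv inc in simp_all)
    then show ?thesis using D_rel_aut[OF _ assms] by blast
  qed
  let ?g = "e \<otimes> f"
  have g: "?g \<in> idempotents S" using e f by (rule idempotents_mult_closed)
  have ge: "sl_less S ?g e" "sl_less S ?g f"
  proof -
    note c = idempotents_closed[OF e] idempotents_closed[OF f]
    have "?g \<otimes> f = ?g"
      using c by (simp add: mult_assoc idempotents_idem[OF f])
    moreover have "?g \<otimes> e = e \<otimes> (e \<otimes> f)"
      using c by (simp add: mult_assoc comm[OF f e])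
    then have "?g \<otimes> e = ?g"
      using c idempotents_idem[OF e] by (simp flip: mult_assoc)
    ultimately show "sl_less S ?g e" "sl_less S ?g f"
      using inc by (auto simp: incomparable_def sl_less_def)
  qed
  obtain \<theta> where \<theta>: "\<theta> \<in> iso S S" "\<theta> e = ?g" using extend_idempotent e g by blast
  define w where "w = \<theta> f"
  have w: "w \<in> idempotents S" using \<theta> f by (simp add: w_def aut_idempotent)
  have inc_w: "incomparable ?g w"
  proof -
    note c = idempotents_closed[OF e] idempotents_closed[OF f]
    have "?g \<otimes> w = \<theta> ?g" using isoD(2)[OF \<theta>(1)] c \<theta>(2) by (simp add: w_def)
    moreover have "\<theta> ?g \<noteq> \<theta> e" "\<theta> ?g \<noteq> \<theta> f"
      using inc isoD(3)[OF \<theta>(1)] c by (auto simp: incomparable_def inj_on_def)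
    ultimately show ?thesis using \<theta>(2) by (simp add: incomparable_def w_def)
  qed
  have below: "w \<otimes> v = w" if v: "v \<in> idempotents S" "sl_less S ?g v" for v
  proof (rule ccontr)
    assume ne: "w \<otimes> v \<noteq> w"
    show False
    proof (cases "w \<otimes> v = v")
      case True
      then have "?g \<otimes> w = ?g \<otimes> (w \<otimes> v) "
        using v w g comm[OF v(1) w] idempotents_closed unfolding sl_less_def by (metis mult_assoc)
      then show False
        using True v inc_w unfolding incomparable_def sl_less_def by simp
    next
      case False
      then have "D_rel w v" using ne v(1) w by (intro inc_D) (auto simp: incomparable_def)
      then have "D_rel v ?g" using D_rel_trans D_rel_sym inc_D[OF g w inc_w] by blast
      then show False using D_rel_not_less v(2) by blast
    qed
  qed
  have "w \<otimes> ?g = (w \<otimes> e) \<otimes> f"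
    using e f w by (simp add: mult_assoc idempotents_closed)
  then have "?g \<otimes> w = w"
    using below[OF e ge(1)] below[OF f ge(2)] comm[OF g w] by simp
  then show False using inc_w by (simp add: incomparable_def)
qed

lemma sinv_comm: "a \<in> carrier S \<Longrightarrow> sinv S a \<otimes> a = a \<otimes> sinv S a"
  by (rule D_rel_eq[symmetric]) (auto simp: D_rel_def)

text \<open>Since \<open>e \<otimes> a\<close> commutes with its inverse,
  \<open>sinv S a \<otimes> e \<otimes> a = e \<otimes> u\<close>; multiplying by \<open>a\<close>
  from the left moves \<open>e\<close> across \<open>a\<close>.\<close>

lemma idempotent_central:
  assumes e: "e \<in> idempotents S" and a: "a \<in> carrier S"
  shows "e \<otimes> a = a \<otimes> e"
proof -
  define u where "u = a \<otimes> sinv S a"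
  have u: "u \<in> idempotents S" "sinv S a \<otimes> a = u" "u \<otimes> a = a"
    using a by (simp_all add: u_def mult_sinv_idempotent sinv_comm mult_sinv_mult)
  have eu: "e \<otimes> u = u \<otimes> e" using e u(1) by (rule idempotents_commute)
  note c = idempotents_closed[OF e] a idempotents_closed[OF u(1)] sinv_closed[OF a]
  have au: "a \<otimes> u = a" using a mult_sinv_mult[OF a] by (simp add: mult_assoc flip: u(2))
  have "sinv S a \<otimes> e \<otimes> a = sinv S a \<otimes> (e \<otimes> e) \<otimes> a"
    using idempotents_idem[OF e] by simp
  also have "\<dots> = sinv S (e \<otimes> a) \<otimes> (e \<otimes> a)"
    using c by (simp add: sinv_mult sinv_idempotent[OF e] mult_assoc)
  also have "\<dots> = (e \<otimes> a) \<otimes> sinv S (e \<otimes> a)"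
    using c by (intro sinv_comm) simp
  also have "\<dots> = e \<otimes> (u \<otimes> e)"
    using c by (simp add: sinv_mult sinv_idempotent[OF e] mult_assoc u_def)
  also have "\<dots> = (e \<otimes> e) \<otimes> u"
    using c by (simp add: mult_assoc flip: eu)
  finally have *: "sinv S a \<otimes> e \<otimes> a = e \<otimes> u"
    using idempotents_idem[OF e] by simp
  have "e \<otimes> a = (e \<otimes> u) \<otimes> a"
    using c u(3) by (simp add: mult_assoc)
  also have "\<dots> = a \<otimes> (sinv S a \<otimes> e \<otimes> a)"
    unfolding eu unfolding u_def using c by (simp add: mult_assoc)
  also have "\<dots> = (a \<otimes> u) \<otimes> e"
    unfolding * eu using c by (simp add: mult_assoc)
  finally show ?thesis by (simp add: au)
qed

lemma clifford: "clifford_semigroup S"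
  by unfold_locales (rule idempotent_central)

end

section \<open>Clifford semigroups\<close>

text \<open>The exponent is \<open>n + 1\<close>, as a semigroup has no identity to serve as power
  0. Hence a product of the powers with indices \<open>m\<close> and \<open>n\<close> has index
  \<open>Suc (m + n)\<close>.\<close>

primrec spow :: "('a, 'm) monoid_scheme \<Rightarrow> 'a \<Rightarrow> nat \<Rightarrow> 'a" where
  "spow S a 0 = a"
| "spow S a (Suc n) = spow S a n \<otimes>\<^bsub>S\<^esub> a"

lemma (in alg_semigroup) spow_closed: "a \<in> carrier S \<Longrightarrow> spow S a n \<in> carrier S"
  by (induct n) (auto simp: mult_closed)

lemma (in alg_semigroup) spow_add:
  "a \<in> carrier S \<Longrightarrow> spow S a m \<otimes> spow S a n = spow S a (Suc (m + n))"
  by (induct n) (auto simp: spow_closed simp flip: mult_assoc)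

lemma (in monoid) spow_eq_pow: "a \<in> carrier G \<Longrightarrow> spow G a n = a [^] Suc n"
  by (induct n) auto

lemma spow_mem:
  "\<lbrakk>a \<in> T; \<And>x y. \<lbrakk>x \<in> T; y \<in> T\<rbrakk> \<Longrightarrow> x \<otimes>\<^bsub>S\<^esub> y \<in> T\<rbrakk> \<Longrightarrow> spow S a n \<in> T"
  by (induct n) auto

lemma spow_hom:
  assumes "\<phi> \<in> iso (S\<lparr>carrier := T\<rparr>) (S\<lparr>carrier := U\<rparr>)" "a \<in> T"
    and "\<And>x y. \<lbrakk>x \<in> T; y \<in> T\<rbrakk> \<Longrightarrow> x \<otimes>\<^bsub>S\<^esub> y \<in> T"
  shows "\<phi> (spow S a n) = spow S (\<phi> a) n"
proof (induct n)
  case (Suc n)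
  then show ?case
    using isoD(2)[OF assms(1), of "spow S a n" a] spow_mem[OF assms(2,3), where n = n] assms(2)
    by simp
qed simp

text \<open>Within a finite group this says that \<open>x\<close> and \<open>y\<close> have the same order.\<close>

definition same_order :: "('a, 'm) monoid_scheme \<Rightarrow> 'a \<Rightarrow> 'a \<Rightarrow> bool" where
  "same_order S x y \<longleftrightarrow> (\<forall>m n. spow S x m = spow S x n \<longleftrightarrow> spow S y m = spow S y n)"

lemma same_order_sym: "same_order S x y \<Longrightarrow> same_order S y x"
  by (simp add: same_order_def)

text \<open>Powers with exponents \<open>m + 1\<close> and \<open>n + 1\<close> agree exactly if the
  order divides the difference, so coincidences between powers depend on the order alone; this
  includes infinite order, coded as 0. The last two assumptions let the powers be computed in
  \<open>S\<close>.\<close>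

lemma same_order_of_ord:
  assumes "group G" "group G'" "x \<in> carrier G" "y \<in> carrier G'"
    and "group.ord G x = group.ord G' y"
    and "\<And>n. spow G x n = spow S x n" "\<And>n. spow G' y n = spow S y n"
  shows "same_order S x y"
proof -
  have "spow H z m = spow H z n \<longleftrightarrow> int (group.ord H z) dvd int (Suc n) - int (Suc m)"
    if "group H" "z \<in> carrier H" for H :: "('x, 'y) monoid_scheme" and z m n
  proof -
    interpret group H by fact
    have "spow H z m = spow H z n \<longleftrightarrow> z [^]\<^bsub>H\<^esub> int (Suc m) = z [^]\<^bsub>H\<^esub> int (Suc n)"
      using that by (simp only: spow_eq_pow int_pow_int)
    then show ?thesis using int_pow_eq that by simp
  qed
  from this[OF assms(1,3)] this[OF assms(2,4)] show ?thesis
    by (simp add: same_order_def assms(5) flip: assms(6,7))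
qed

context clifford_semigroup begin

text \<open>The identity of the maximal subgroup containing \<open>x\<close>. The maximal subgroups
  are the fibres of this map, which is a homomorphism onto the idempotents.\<close>

definition unit_of :: "'a \<Rightarrow> 'a" where
  "unit_of x = x \<otimes> sinv S x"

lemma central: "\<lbrakk>x \<in> carrier S; e \<in> idempotents S\<rbrakk> \<Longrightarrow> x \<otimes> e = e \<otimes> x"
  by (rule idempotents_central[symmetric])

lemma unit_of_idempotent: "x \<in> carrier S \<Longrightarrow> unit_of x \<in> idempotents S"
  by (simp add: unit_of_def mult_sinv_idempotent)

lemma unit_of_closed [simp]: "x \<in> carrier S \<Longrightarrow> unit_of x \<in> carrier S"
  by (simp add: unit_of_def)

text \<open>Centrality rewrites \<open>sinv S x \<otimes> x\<close> as the product of both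
  idempotents of \<open>x\<close>, and that product as \<open>x \<otimes> sinv S x\<close>.\<close>

lemma sinv_mult_eq_unit_of:
  assumes "x \<in> carrier S" shows "sinv S x \<otimes> x = unit_of x"
proof -
  have "sinv S x \<otimes> x = sinv S x \<otimes> (x \<otimes> sinv S x) \<otimes> x"
    using assms sinv_mult_sinv[OF assms] by (simp flip: mult_assoc)
  also have "\<dots> = (x \<otimes> sinv S x) \<otimes> (sinv S x \<otimes> x)"
    using assms central[OF _ mult_sinv_idempotent, of "sinv S x" x] by (simp add: mult_assoc)
  also have "\<dots> = x \<otimes> (sinv S x \<otimes> (sinv S x \<otimes> x))"
    using assms by (simp add: mult_assoc)
  also have "\<dots> = x \<otimes> ((sinv S x \<otimes> x) \<otimes> sinv S x)"
    using assms central[OF _ sinv_mult_idempotent, of "sinv S x" x] by simp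
  also have "\<dots> = unit_of x"
    using assms sinv_mult_sinv[OF assms] by (simp add: unit_of_def)
  finally show ?thesis .
qed

lemma unit_of_mult_left: "x \<in> carrier S \<Longrightarrow> unit_of x \<otimes> x = x"
  by (simp add: unit_of_def mult_sinv_mult)

lemma unit_of_mult_right: "x \<in> carrier S \<Longrightarrow> x \<otimes> unit_of x = x"
  using central[of x "unit_of x"] unit_of_idempotent[of x] unit_of_mult_left[of x] by simp

lemma unit_of_idem: "e \<in> idempotents S \<Longrightarrow> unit_of e = e"
  by (simp add: unit_of_def sinv_idempotent idempotents_idem)

lemma unit_of_sinv: "x \<in> carrier S \<Longrightarrow> unit_of (sinv S x) = unit_of x"
  using sinv_mult_eq_unit_of[of x] by (simp add: unit_of_def)

lemma unit_of_mult:
  assumes "x \<in> carrier S" "y \<in> carrier S"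
  shows "unit_of (x \<otimes> y) = unit_of x \<otimes> unit_of y"
proof -
  have "unit_of (x \<otimes> y) = x \<otimes> unit_of y \<otimes> sinv S x"
    using assms by (simp add: unit_of_def sinv_mult mult_assoc)
  also have "\<dots> = x \<otimes> (sinv S x \<otimes> unit_of y)"
    using assms central[of "sinv S x" "unit_of y"] unit_of_idempotent by (simp add: mult_assoc)
  finally show ?thesis using assms by (simp add: unit_of_def mult_assoc)
qed

lemma H_class_iff: "e \<in> idempotents S \<Longrightarrow> x \<in> H_class S e \<longleftrightarrow> x \<in> carrier S \<and> unit_of x = e"
  using sinv_mult_eq_unit_of[of x] by (auto simp: H_class_eq unit_of_def)

text \<open>Together with \<open>restrict_mult\<close> this makes
  \<open>x \<mapsto> x \<otimes> e\<close> the connecting homomorphism from the group of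
  \<open>d\<close> to the group of \<open>d \<otimes> e\<close>.\<close>

lemma H_class_restrict:
  "\<lbrakk>d \<in> idempotents S; e \<in> idempotents S; x \<in> H_class S d\<rbrakk> \<Longrightarrow> x \<otimes> e \<in> H_class S (d \<otimes> e)"
  by (simp add: H_class_iff idempotents_mult_closed unit_of_mult unit_of_idem idempotents_closed)

lemma restrict_mult:
  assumes "e \<in> idempotents S" "x \<in> carrier S" "y \<in> carrier S"
  shows "(x \<otimes> e) \<otimes> (y \<otimes> e) = (x \<otimes> y) \<otimes> e"
proof -
  note c = assms(2,3) idempotents_closed[OF assms(1)]
  have "(x \<otimes> e) \<otimes> (y \<otimes> e) = x \<otimes> (e \<otimes> y) \<otimes> e" using c by (simp add: mult_assoc)
  also have "\<dots> = (x \<otimes> y) \<otimes> (e \<otimes> e)"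
    using c by (simp add: mult_assoc flip: central[OF assms(3,1)])
  finally show ?thesis by (simp add: idempotents_idem[OF assms(1)])
qed

lemma restrict_sinv:
  assumes "e \<in> idempotents S" "x \<in> carrier S"
  shows "sinv S (x \<otimes> e) = sinv S x \<otimes> e"
  using assms central[of "sinv S x" e] by (simp add: sinv_mult sinv_idempotent idempotents_closed)

definition local_subgroup :: "'a \<Rightarrow> 'a set \<Rightarrow> bool" where
  "local_subgroup e Q \<longleftrightarrow> e \<in> idempotents S \<and> Q \<subseteq> H_class S e \<and> e \<in> Q
     \<and> (\<forall>x \<in> Q. \<forall>y \<in> Q. x \<otimes> y \<in> Q) \<and> (\<forall>x \<in> Q. sinv S x \<in> Q)"

abbreviation group_on :: "'a \<Rightarrow> 'a set \<Rightarrow> 'a monoid" where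
  "group_on e Q \<equiv> \<lparr>carrier = Q, monoid.mult = monoid.mult S, one = e\<rparr>"

lemma H_class_local_subgroup: "e \<in> idempotents S \<Longrightarrow> local_subgroup e (H_class S e)"
  by (simp add: local_subgroup_def H_class_iff unit_of_mult unit_of_idem unit_of_sinv
      idempotents_idem idempotents_closed)

lemma local_subgroupD:
  assumes "local_subgroup e Q"
  shows "e \<in> idempotents S" "e \<in> Q" "x \<in> Q \<Longrightarrow> x \<in> H_class S e" "x \<in> Q \<Longrightarrow> x \<in> carrier S"
    "\<lbrakk>x \<in> Q; y \<in> Q\<rbrakk> \<Longrightarrow> x \<otimes> y \<in> Q" "x \<in> Q \<Longrightarrow> sinv S x \<in> Q"
    "x \<in> Q \<Longrightarrow> e \<otimes> x = x" "x \<in> Q \<Longrightarrow> x \<otimes> e = x"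
    "x \<in> Q \<Longrightarrow> sinv S x \<otimes> x = e" "x \<in> Q \<Longrightarrow> x \<otimes> sinv S x = e"
  using assms unit_of_mult_left[of x] unit_of_mult_right[of x] sinv_mult_eq_unit_of[of x] H_class_iff[of e x]
  by (auto simp: local_subgroup_def unit_of_def)

lemma group_group_on:
  assumes "local_subgroup e Q"
  shows "group (group_on e Q)"
proof (rule groupI)
  note * = local_subgroupD[OF assms]
  show "\<exists>y \<in> carrier (group_on e Q). y \<otimes>\<^bsub>group_on e Q\<^esub> x = \<one>\<^bsub>group_on e Q\<^esub>"
    if "x \<in> carrier (group_on e Q)" for x
    using that *(6,9) by auto
qed (use local_subgroupD[OF assms] in \<open>auto simp: mult_assoc\<close>)

lemma inv_group_on:
  assumes "local_subgroup e Q" "x \<in> Q"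
  shows "inv\<^bsub>group_on e Q\<^esub> x = sinv S x"
proof -
  interpret group "group_on e Q" using assms(1) by (rule group_group_on)
  show ?thesis
    by (rule inv_equality) (use local_subgroupD[OF assms(1)] assms(2) in auto)
qed

text \<open>The idempotent \<open>e\<close> is adjoined because a subgroup contains the identity
  even when \<open>A\<close> is empty, whereas the empty set generates the empty inverse
  subsemigroup.\<close>

lemma generate_group_on:
  assumes "local_subgroup e Q" "A \<subseteq> Q"
  shows "generate (group_on e Q) A = inv_generate S (insert e A)" "inv_generate S (insert e A) \<subseteq> Q"
proof -
  interpret G: group "group_on e Q" using assms(1) by (rule group_group_on)
  note * = local_subgroupD[OF assms(1)]
  have sub: "x \<in> Q" if "x \<in> inv_generate S (insert e A)" for x
    using that by induct (use *(2,5,6) assms(2) in auto)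
  then show "inv_generate S (insert e A) \<subseteq> Q" by blast
  show "generate (group_on e Q) A = inv_generate S (insert e A)"
  proof
    show "generate (group_on e Q) A \<subseteq> inv_generate S (insert e A)"
    proof
      fix x assume "x \<in> generate (group_on e Q) A"
      then show "x \<in> inv_generate S (insert e A)"
      proof induct
        case (inv h)
        then show ?case
          using assms inv_group_on[OF assms(1), of h] inv_generate.inv[OF inv_generate.incl, of h "insert e A" S]
          by auto
      qed (auto intro: inv_generate.intros)
    qed
    show "inv_generate S (insert e A) \<subseteq> generate (group_on e Q) A"
    proof
      fix x assume "x \<in> inv_generate S (insert e A)"
      then show "x \<in> generate (group_on e Q) A"
      proof induct
        case (incl a)
        then show ?case
          using generate.one[of "group_on e Q" A] generate.incl[of a A "group_on e Q"] by auto
      next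
        case (mult a b)
        then show ?case using generate.eng[of a "group_on e Q" A b] by simp
      next
        case (inv a)
        then have "inv\<^bsub>group_on e Q\<^esub> a \<in> generate (group_on e Q) A"
          using G.generate_m_inv_closed[of A a] assms(2) by simp
        then show ?case using inv sub inv_group_on[OF assms(1), of a] by simp
      qed
    qed
  qed
qed

lemma spow_group_on: "spow (group_on e Q) x n = spow S x n"
  by (induct n) auto

lemma finite_group_spow:
  assumes "local_subgroup e Q" "finite Q" "x \<in> Q"
  obtains m n where "spow S x m = e" "spow S x n = sinv S x"
proof -
  interpret G: group "group_on e Q" using assms(1) by (rule group_group_on)
  let ?k = "G.ord x"
  have x: "x \<in> carrier (group_on e Q)" using assms by simp
  have k: "?k \<ge> 1" using G.ord_ge_1 assms by simp
  have pw: "spow S x n = x [^]\<^bsub>group_on e Q\<^esub> Suc n" for n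
    using G.spow_eq_pow[OF x] by (simp add: spow_group_on)
  have "spow S x (?k - 1) = e"
    using pw[of "?k - 1"] k G.pow_ord_eq_1[OF x] by simp
  \<comment> \<open>The inverse is taken as the power with exponent \<open>2 * ?k - 1\<close> and
    not \<open>?k - 1\<close>: for \<open>?k = 1\<close> the latter is 0, which \<open>spow\<close>
    cannot express.\<close>
  moreover have "spow S x (2 * ?k - 2) = sinv S x"
  proof -
    have "x [^]\<^bsub>group_on e Q\<^esub> (2 * ?k - 1) \<otimes>\<^bsub>group_on e Q\<^esub> x = x [^]\<^bsub>group_on e Q\<^esub> (?k + ?k)"
      using k G.nat_pow_Suc[of x "2 * ?k - 1"] by (simp add: mult_2)
    also have "\<dots> = e"
      using G.nat_pow_mult[OF x, of ?k ?k] G.pow_ord_eq_1[OF x]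
        local_subgroupD(7)[OF assms(1) local_subgroupD(2)[OF assms(1)]] by simp
    finally have "inv\<^bsub>group_on e Q\<^esub> x = x [^]\<^bsub>group_on e Q\<^esub> (2 * ?k - 1)"
      using x G.nat_pow_closed[OF x, of "2 * ?k - 1"] by (intro G.inv_equality) simp_all
    moreover have "Suc (2 * ?k - 2) = 2 * ?k - 1" using k by simp
    ultimately show ?thesis
      using inv_group_on[OF assms(1,3)] by (simp only: pw)
  qed
  ultimately show thesis using that by blast
qed

end

section \<open>Kernels and images of the connecting homomorphisms\<close>

sublocale finite_HIS \<subseteq> clifford_semigroup
  by (rule clifford)

context finite_HIS begin

lemma H_classD:
  assumes "e \<in> idempotents S"
  shows "e \<in> H_class S e" "x \<in> H_class S e \<Longrightarrow> x \<in> carrier S"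
    "\<lbrakk>x \<in> H_class S e; y \<in> H_class S e\<rbrakk> \<Longrightarrow> x \<otimes> y \<in> H_class S e"
    "x \<in> H_class S e \<Longrightarrow> sinv S x \<in> H_class S e"
    "x \<in> H_class S e \<Longrightarrow> e \<otimes> x = x" "x \<in> H_class S e \<Longrightarrow> x \<otimes> e = x"
    "x \<in> H_class S e \<Longrightarrow> sinv S x \<otimes> x = e" "x \<in> H_class S e \<Longrightarrow> x \<otimes> sinv S x = e"
  by (simp_all add: local_subgroupD(2,4-)[OF H_class_local_subgroup[OF assms]])

lemma H_class_unique:
  "\<lbrakk>x \<in> H_class S e; x \<in> H_class S f; e \<in> idempotents S; f \<in> idempotents S\<rbrakk> \<Longrightarrow> e = f"
  by (simp add: H_class_iff)

lemma H_class_idempotent: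
  "\<lbrakk>e \<in> idempotents S; x \<in> H_class S e; x \<in> idempotents S\<rbrakk> \<Longrightarrow> x = e"
  by (simp add: H_class_iff unit_of_idem)

section \<open>Elements of equal order under automorphisms\<close>

lemma spow_H_class:
  "\<lbrakk>f \<in> idempotents S; x \<in> H_class S f\<rbrakk> \<Longrightarrow> spow S x n \<in> H_class S f"
  by (rule spow_mem) (simp_all add: H_classD)

lemma sinv_spow:
  assumes "x \<in> carrier S"
  shows "sinv S (spow S x n) = spow S (sinv S x) n"
proof (induct n)
  case (Suc n)
  have "sinv S (spow S x (Suc n)) = spow S (sinv S x) 0 \<otimes> spow S (sinv S x) n"
    using assms Suc by (simp add: sinv_mult spow_closed)
  also have "\<dots> = spow S (sinv S x) (Suc n)"
    using spow_add[of "sinv S x" 0 n] assms by simp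
  finally show ?case .
qed simp

text \<open>In a finite group inverses are positive powers, and \<open>d\<close> acts as an identity
  on the group of \<open>f\<close>; so nothing beyond \<open>d\<close> and the powers of
  \<open>x\<close> arises.\<close>

lemma inv_generate_pair:
  assumes d: "d \<in> idempotents S" and f: "f \<in> idempotents S" and df: "d \<otimes> f = f"
    and x: "x \<in> H_class S f"
  shows "inv_generate S {x, d} = insert d (range (spow S x))"
proof
  have xc: "x \<in> carrier S" using H_classD(2)[OF f x] .
  have mult: "u \<otimes> v \<in> range (spow S x)" if uv: "u \<in> range (spow S x)" "v \<in> range (spow S x)" for u v
    using uv by (elim imageE) (simp add: spow_add[OF xc] del: spow.simps)
  have dw: "d \<otimes> w = w" "w \<otimes> d = w" if w: "w \<in> range (spow S x)" for w
  proof -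
    have wH: "w \<in> H_class S f" using w spow_H_class[OF f x] by (elim imageE) simp
    have "d \<otimes> w = d \<otimes> (f \<otimes> w)" using H_classD(5)[OF f wH] by simp
    also have "\<dots> = (d \<otimes> f) \<otimes> w"
      using H_classD(2)[OF f wH] d f idempotents_closed by (simp add: mult_assoc)
    finally show "d \<otimes> w = w" using H_classD(5)[OF f wH] df by simp
    then show "w \<otimes> d = w" using central[OF H_classD(2)[OF f wH] d] by simp
  qed
  obtain m where m: "spow S x m = sinv S x"
    by (rule finite_group_spow[OF H_class_local_subgroup[OF f] finite_H_class[OF f] x]) simp
  have inv: "sinv S u \<in> range (spow S x)" if u: "u \<in> range (spow S x)" for u
  proof -
    obtain n where "u = spow S x n" using u by blast
    then have "sinv S u = spow S (spow S x m) n" using sinv_spow[OF xc] m by simp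
    also have "\<dots> \<in> range (spow S x)" by (rule spow_mem) (simp_all add: mult)
    finally show ?thesis .
  qed
  show "inv_generate S {x, d} \<subseteq> insert d (range (spow S x))"
  proof
    fix z assume "z \<in> inv_generate S {x, d}"
    then show "z \<in> insert d (range (spow S x))"
    proof induct
      case (incl a)
      moreover have "x \<in> range (spow S x)" by (rule range_eqI[of _ _ 0]) simp
      ultimately show ?case by blast
    next
      case (mult a b)
      then show ?case using \<open>\<And>u v. _ \<Longrightarrow> _ \<Longrightarrow> u \<otimes> v \<in> range (spow S x)\<close>[of a b] dw idempotents_idem[OF d]
        by (elim insertE) simp_all
    next
      case (inv a)
      then show ?case using \<open>\<And>u. _ \<Longrightarrow> sinv S u \<in> range (spow S x)\<close>[of a] sinv_idempotent[OF d]
        by (elim insertE) simp_all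
    qed
  qed
  have "spow S x n \<in> inv_generate S {x, d}" for n
    by (rule spow_mem) (auto intro: inv_generate.intros)
  then show "insert d (range (spow S x)) \<subseteq> inv_generate S {x, d}"
    by (auto intro: inv_generate.incl)
qed

text \<open>Equal order makes \<open>spow S x n \<mapsto> spow S y n\<close>, together with
  \<open>d \<mapsto> d\<close>, a well-defined isomorphism of the generated inverse subsemigroups.
  Keeping \<open>d\<close> fixed serves to control the source of a connecting homomorphism.\<close>

lemma extend_pair:
  assumes d: "d \<in> idempotents S" and f: "f \<in> idempotents S" and df: "d \<otimes> f = f"
    and x: "x \<in> H_class S f" and y: "y \<in> H_class S f" and xy: "same_order S x y"
  obtains \<theta> where "\<theta> \<in> iso S S" "\<theta> d = d" "\<theta> x = y"
proof -
  note c = H_classD(2)[OF f x] H_classD(2)[OF f y]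
  define \<phi> where "\<phi> z = (if z \<in> range (spow S x) then spow S y (SOME n. z = spow S x n) else d)" for z
  have \<phi>_spow: "\<phi> (spow S x n) = spow S y n" for n
  proof -
    have "spow S x n = spow S x (SOME m. spow S x n = spow S x m)"
      by (rule someI[of "\<lambda>m. spow S x n = spow S x m" n]) simp
    then have "spow S y n = spow S y (SOME m. spow S x n = spow S x m)"
      using xy by (simp add: same_order_def)
    then show ?thesis by (simp add: \<phi>_def)
  qed
  \<comment> \<open>Being idempotent is a coincidence between the powers with indices
    \<open>n\<close> and \<open>Suc (n + n)\<close>, and so carries over from \<open>x\<close> to
    \<open>y\<close>.\<close>
  have idem: "spow S y n = f" if n: "spow S x n = f" for n
  proof -
    have "spow S x (Suc (n + n)) = spow S x n"
      using spow_add[OF c(1), of n n] n idempotents_idem[OF f] by simp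
    then have "spow S y (Suc (n + n)) = spow S y n" using xy by (simp only: same_order_def)
    then have "spow S y n \<otimes> spow S y n = spow S y n"
      using spow_add[OF c(2), of n n] by simp
    then have "spow S y n \<in> idempotents S"
      using spow_closed[OF c(2)] by (simp add: idempotents_def)
    then show ?thesis using H_class_idempotent[OF f spow_H_class[OF f y]] by simp
  qed
  \<comment> \<open>The idempotent \<open>d\<close> may itself be a power of \<open>x\<close>,
    namely when \<open>d = f\<close>; then both clauses of \<open>\<phi>\<close> have to
    agree.\<close>
  have \<phi>_d: "\<phi> d = d"
  proof (cases "d \<in> range (spow S x)")
    case True
    then obtain n where n: "d = spow S x n" by blast
    then have "d = f" using H_class_idempotent[OF f spow_H_class[OF f x]] d by simp
    then show ?thesis using n \<phi>_spow[of n] idem[of n] by simp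
  qed (simp add: \<phi>_def)
  have dpow: "d \<otimes> spow S z n = spow S z n" "spow S z n \<otimes> d = spow S z n"
    if z: "z \<in> H_class S f" for z n
  proof -
    have w: "spow S z n \<in> H_class S f" using f z by (rule spow_H_class)
    have "d \<otimes> spow S z n = (d \<otimes> f) \<otimes> spow S z n"
      using H_classD(2,5)[OF f w] d f idempotents_closed by (simp add: mult_assoc)
    then show "d \<otimes> spow S z n = spow S z n" using H_classD(5)[OF f w] df by simp
    then show "spow S z n \<otimes> d = spow S z n" using central[OF H_classD(2)[OF f w] d] by simp
  qed
  have iso: "\<phi> \<in> iso (S\<lparr>carrier := insert d (range (spow S x))\<rparr>) (S\<lparr>carrier := insert d (range (spow S y))\<rparr>)"
  proof (rule iso_carrierI)
    fix u assume u: "u \<in> insert d (range (spow S x))"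
    then show "\<phi> u \<in> insert d (range (spow S y))" using \<phi>_d \<phi>_spow by auto
    fix v assume v: "v \<in> insert d (range (spow S x))"
    show "\<phi> (u \<otimes> v) = \<phi> u \<otimes> \<phi> v"
      using u v by (elim insertE imageE)
        (simp_all add: \<phi>_d \<phi>_spow dpow[OF x] dpow[OF y] spow_add[OF c(1)] spow_add[OF c(2)]
          idempotents_idem[OF d] del: spow.simps)
  next
    have *: "spow S y n = d \<longleftrightarrow> spow S x n = d" for n
    proof
      assume n: "spow S y n = d"
      then have "d = f" using H_class_idempotent[OF f spow_H_class[OF f y]] d by metis
      obtain m where m: "spow S x m = f"
        by (rule finite_group_spow[OF H_class_local_subgroup[OF f] finite_H_class[OF f] x]) simp
      then have "spow S y m = spow S y n" using idem[OF m] n \<open>d = f\<close> by simp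
      then show "spow S x n = d" using xy m \<open>d = f\<close> unfolding same_order_def by metis
    next
      assume n: "spow S x n = d"
      then have "d = f" using H_class_idempotent[OF f spow_H_class[OF f x]] d by metis
      then show "spow S y n = d" using idem n by simp
    qed
    show "inj_on \<phi> (insert d (range (spow S x)))"
    proof (rule inj_onI)
      fix u v assume uv: "u \<in> insert d (range (spow S x))" "v \<in> insert d (range (spow S x))" "\<phi> u = \<phi> v"
      have xy': "spow S y m = spow S y n \<longleftrightarrow> spow S x m = spow S x n" for m n
        using xy by (simp add: same_order_def)
      have d_iff: "\<phi> w = d \<longleftrightarrow> w = d" if w: "w \<in> insert d (range (spow S x))" for w
        using w by (elim insertE imageE) (simp_all add: \<phi>_d \<phi>_spow *)
      show "u = v"
      proof (cases "\<phi> u = d")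
        case True
        then show ?thesis using d_iff[OF uv(1)] d_iff[OF uv(2)] uv(3) by simp
      next
        case False
        then have "u \<in> range (spow S x)" "v \<in> range (spow S x)"
          using uv \<phi>_d by auto
        then show ?thesis using uv(3) by (elim imageE) (simp add: \<phi>_spow xy')
      qed
    qed
    show "insert d (range (spow S y)) \<subseteq> \<phi> ` insert d (range (spow S x))"
    proof
      fix w assume "w \<in> insert d (range (spow S y))"
      then show "w \<in> \<phi> ` insert d (range (spow S x))"
      proof (elim insertE imageE)
        assume "w = d" then show ?thesis using \<phi>_d by (intro image_eqI[of _ _ d]) simp_all
      next
        fix n assume "w = spow S y n"
        then show ?thesis using \<phi>_spow[of n] by (intro image_eqI[of _ _ "spow S x n"]) simp_all
      qed
    qed
  qed
  show thesis
  proof (rule extend_iso[OF _ _ _ _ inv_generate_pair[OF d f df x] inv_generate_pair[OF d f df y] iso])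
    fix \<theta> assume \<theta>: "\<theta> \<in> iso S S" "\<And>z. z \<in> insert d (range (spow S x)) \<Longrightarrow> \<theta> z = \<phi> z"
    have "x \<in> range (spow S x)" by (rule range_eqI[of _ _ 0]) simp
    then have "\<theta> x = y" using \<theta>(2)[of x] \<phi>_spow[of 0] by simp
    moreover have "\<theta> d = d" using \<theta>(2)[of d] \<phi>_d by simp
    ultimately show thesis using \<theta>(1) that by simp
  qed (use c d idempotents_closed in auto)
qed

lemma aut_H_class:
  assumes "\<theta> \<in> iso S S" "e \<in> idempotents S" "x \<in> H_class S e"
  shows "\<theta> x \<in> H_class S (\<theta> e)"
proof -
  have x: "x \<in> carrier S" "unit_of x = e" using assms by (simp_all add: H_class_iff)
  have "unit_of (\<theta> x) = \<theta> (unit_of x)"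
    using x(1) by (simp add: unit_of_def isoD(2)[OF assms(1)] aut_sinv[OF assms(1)])
  then show ?thesis
    using x isoD(1)[OF assms(1)] aut_idempotent[OF assms(1,2)] by (simp add: H_class_iff)
qed

lemma same_order_aut:
  assumes "\<theta> \<in> iso S S" "x \<in> carrier S"
  shows "same_order S x (\<theta> x)"
proof -
  have "spow S (\<theta> x) n = \<theta> (spow S x n)" for n
    by (induct n) (simp_all add: assms isoD(2)[OF assms(1)] spow_closed)
  then show ?thesis
    using isoD(3)[OF assms(1)] spow_closed[OF assms(2)] by (simp add: same_order_def inj_on_eq_iff)
qed

text \<open>Conjugation by \<open>g\<close> commutes with powers and is injective on the group.
  Hence subgroups described by the orders of their elements are normal.\<close>

lemma same_order_conj:
  assumes f: "f \<in> idempotents S" and x: "x \<in> H_class S f" and g: "g \<in> H_class S f"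
  shows "same_order S x (g \<otimes> x \<otimes> sinv S g)"
proof -
  note c = H_classD(2)[OF f x] H_classD(2)[OF f g]
  have g': "sinv S g \<in> H_class S f" using H_classD(4)[OF f g] .
  have sp: "spow S (g \<otimes> x \<otimes> sinv S g) n = g \<otimes> spow S x n \<otimes> sinv S g" for n
  proof (induct n)
    case (Suc n)
    have "spow S (g \<otimes> x \<otimes> sinv S g) (Suc n) = g \<otimes> spow S x n \<otimes> (sinv S g \<otimes> g) \<otimes> x \<otimes> sinv S g"
      using Suc c by (simp add: mult_assoc spow_closed)
    also have "\<dots> = g \<otimes> (spow S x n \<otimes> f) \<otimes> x \<otimes> sinv S g"
      using H_classD(7)[OF f g] c f by (simp add: mult_assoc spow_closed idempotents_closed)
    also have "\<dots> = g \<otimes> spow S x (Suc n) \<otimes> sinv S g"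
      using H_classD(6)[OF f spow_H_class[OF f x]] c by (simp add: mult_assoc spow_closed)
    finally show ?case .
  qed simp
  have cancel: "u = v"
    if uv: "u \<in> H_class S f" "v \<in> H_class S f" "g \<otimes> u \<otimes> sinv S g = g \<otimes> v \<otimes> sinv S g" for u v
  proof -
    have "sinv S g \<otimes> (g \<otimes> w \<otimes> sinv S g) \<otimes> g = w" if w: "w \<in> H_class S f" for w
    proof -
      have "sinv S g \<otimes> (g \<otimes> w \<otimes> sinv S g) \<otimes> g = (sinv S g \<otimes> g) \<otimes> w \<otimes> (sinv S g \<otimes> g)"
        using c H_classD(2)[OF f w] by (simp add: mult_assoc)
      then show ?thesis using H_classD(5,6)[OF f w] H_classD(7)[OF f g] by simp
    qed
    from this[OF uv(1), unfolded uv(3)] this[OF uv(2)] show ?thesis by (rule trans[OF sym])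
  qed
  show ?thesis
    unfolding same_order_def sp using cancel spow_H_class[OF f x] by metis
qed

section \<open>Kernels do not depend on the target, images not on the source\<close>

definition connecting_kernel :: "'a \<Rightarrow> 'a \<Rightarrow> 'a set" where
  "connecting_kernel e f = {x \<in> H_class S e. x \<otimes> f = f}"

definition connecting_image :: "'a \<Rightarrow> 'a \<Rightarrow> 'a set" where
  "connecting_image e f = (\<lambda>x. x \<otimes> f) ` H_class S e"

lemma aut_connecting_kernel:
  assumes "\<theta> \<in> iso S S" "e \<in> idempotents S" "f \<in> idempotents S" "x \<in> connecting_kernel e f"
  shows "\<theta> x \<in> connecting_kernel (\<theta> e) (\<theta> f)"
proof -
  have x: "x \<in> H_class S e" "x \<otimes> f = f" using assms(4) by (simp_all add: connecting_kernel_def)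
  have "\<theta> x \<otimes> \<theta> f = \<theta> f"
    using isoD(2)[OF assms(1), of x f] x(2) H_classD(2)[OF assms(2) x(1)] idempotents_closed[OF assms(3)]
    by simp
  then show ?thesis using aut_H_class[OF assms(1,2) x(1)] by (simp add: connecting_kernel_def)
qed

lemma aut_connecting_image:
  assumes "\<theta> \<in> iso S S" "e \<in> idempotents S" "f \<in> idempotents S" "x \<in> connecting_image e f"
  shows "\<theta> x \<in> connecting_image (\<theta> e) (\<theta> f)"
proof -
  obtain y where y: "y \<in> H_class S e" "x = y \<otimes> f" using assms(4) by (auto simp: connecting_image_def)
  have "\<theta> x = \<theta> y \<otimes> \<theta> f"
    using isoD(2)[OF assms(1), of y f] y(2) H_classD(2)[OF assms(2) y(1)] idempotents_closed[OF assms(3)]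
    by simp
  then show ?thesis using aut_H_class[OF assms(1,2) y(1)] by (simp add: connecting_image_def)
qed

lemma aut_card_le:
  assumes "\<theta> \<in> iso S S" "\<theta> ` A \<subseteq> B" "A \<subseteq> carrier S" "finite B"
  shows "card A \<le> card B"
  using assms isoD(3)[OF assms(1)] by (meson card_inj_on_le inj_on_subset)

lemma connecting_kernel_mono:
  assumes "e \<in> idempotents S" "f \<in> idempotents S" "g \<in> idempotents S" "g \<otimes> f = g"
  shows "connecting_kernel e f \<subseteq> connecting_kernel e g"
proof
  fix x assume "x \<in> connecting_kernel e f"
  then have x: "x \<in> H_class S e" "x \<otimes> f = f" by (simp_all add: connecting_kernel_def)
  have fg: "f \<otimes> g = g" using idempotents_commute[OF assms(2,3)] assms(4) by simp
  have "x \<otimes> g = (x \<otimes> f) \<otimes> g"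
    using H_classD(2)[OF assms(1) x(1)] assms idempotents_closed by (simp add: mult_assoc fg)
  then have "x \<otimes> g = g" using x(2) fg by simp
  then show "x \<in> connecting_kernel e g" using x(1) by (simp add: connecting_kernel_def)
qed

text \<open>The smaller target has the larger kernel; an automorphism fixing \<open>e\<close> and
  taking \<open>g\<close> to \<open>f\<close> maps that kernel injectively into the other one, so
  finiteness forces equality.\<close>

lemma connecting_kernel_eq_of_le:
  assumes e: "e \<in> idempotents S" and f: "f \<in> idempotents S" and g: "g \<in> idempotents S"
    and less: "sl_less S f e" "sl_less S g e" "g \<otimes> f = g"
  shows "connecting_kernel e f = connecting_kernel e g"
proof (rule card_seteq)
  have sub: "connecting_kernel e f \<subseteq> H_class S e" for f by (auto simp: connecting_kernel_def)
  then show "finite (connecting_kernel e g)" using finite_H_class[OF e] finite_subset by blast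
  show "connecting_kernel e f \<subseteq> connecting_kernel e g"
    using e f g less(3) by (rule connecting_kernel_mono)
  obtain \<theta> where \<theta>: "\<theta> \<in> iso S S" "\<theta> e = e" "\<theta> g = f"
    by (rule extend_chain2[of e g e f]) (use e f g less in simp_all)
  show "card (connecting_kernel e g) \<le> card (connecting_kernel e f)"
  proof (rule aut_card_le[OF \<theta>(1)])
    show "\<theta> ` connecting_kernel e g \<subseteq> connecting_kernel e f"
      using aut_connecting_kernel[OF \<theta>(1) e g] \<theta>(2,3) by auto
    show "connecting_kernel e g \<subseteq> carrier S" using sub H_classD(2)[OF e] by blast
    show "finite (connecting_kernel e f)" using sub finite_H_class[OF e] finite_subset by blast
  qed
qed

text \<open>Both targets are compared with their product \<open>f \<otimes> g\<close>, which is
  again strictly below \<open>e\<close>.\<close>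

lemma connecting_kernel_eq:
  assumes e: "e \<in> idempotents S" and f: "f \<in> idempotents S" and g: "g \<in> idempotents S"
    and less: "sl_less S f e" "sl_less S g e"
  shows "connecting_kernel e f = connecting_kernel e g"
proof -
  have fg: "f \<otimes> g \<in> idempotents S" using f g by (rule idempotents_mult_closed)
  note c = idempotents_closed[OF e] idempotents_closed[OF f] idempotents_closed[OF g]
  have le: "(f \<otimes> g) \<otimes> g = f \<otimes> g" "(f \<otimes> g) \<otimes> f = f \<otimes> g"
    using c by (simp_all add: mult_assoc idempotents_idem[OF g])
      (simp add: idempotents_commute[OF g f] idempotents_idem[OF f] flip: mult_assoc)
  have "(f \<otimes> g) \<otimes> e = f \<otimes> g"
    using c less(2) by (simp add: mult_assoc sl_less_def)
  moreover have "f \<otimes> g \<noteq> e"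
    using le less c by (metis idempotents_commute[OF e g] sl_less_def)
  ultimately have "sl_less S (f \<otimes> g) e" by (simp add: sl_less_def)
  then show ?thesis
    using connecting_kernel_eq_of_le[OF e f fg less(1) _ le(2)]
      connecting_kernel_eq_of_le[OF e g fg less(2) _ le(1)] by simp
qed

lemma connecting_image_subset:
  assumes "e \<in> idempotents S" "f \<in> idempotents S" "e \<otimes> f = f"
  shows "connecting_image e f \<subseteq> H_class S f"
  using H_class_restrict[OF assms(1,2)] assms(3) by (auto simp: connecting_image_def)

text \<open>The automorphism that fixes \<open>e\<close> and sends \<open>x\<close> to
  \<open>y\<close> also fixes \<open>f\<close>, the unit of both elements, and so preserves the
  image.\<close>

lemma connecting_image_same_order:
  assumes e: "e \<in> idempotents S" and f: "f \<in> idempotents S" and ef: "e \<otimes> f = f"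
    and x: "x \<in> connecting_image e f" and y: "y \<in> H_class S f" and xy: "same_order S x y"
  shows "y \<in> connecting_image e f"
proof -
  have xf: "x \<in> H_class S f" using connecting_image_subset[OF e f ef] x by blast
  obtain \<theta> where \<theta>: "\<theta> \<in> iso S S" "\<theta> e = e" "\<theta> x = y"
    using extend_pair[OF e f ef xf y xy] by metis
  have "\<theta> f = f"
    using aut_H_class[OF \<theta>(1) f xf] \<theta>(3) H_class_unique[of y "\<theta> f" f] y aut_idempotent[OF \<theta>(1) f] f by simp
  then show ?thesis using aut_connecting_image[OF \<theta>(1) e f x] \<theta>(2,3) by simp
qed

lemma sl_less_left:
  assumes "e \<in> idempotents S" "f \<in> idempotents S" "sl_less S f e"
  shows "e \<otimes> f = f" "f \<otimes> e = f"
  using assms idempotents_commute[OF assms(1,2)] by (simp_all add: sl_less_def)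

text \<open>An automorphism taking \<open>d\<close> to \<open>e\<close> and fixing \<open>f\<close>
  sends \<open>x\<close> to an element of the same order in the other image;
  \<open>connecting_image_same_order\<close> then leads back to \<open>x\<close> itself.\<close>

lemma connecting_image_eq:
  assumes d: "d \<in> idempotents S" and e: "e \<in> idempotents S" and f: "f \<in> idempotents S"
    and less: "sl_less S f d" "sl_less S f e"
  shows "connecting_image d f = connecting_image e f"
proof -
  have "connecting_image d f \<subseteq> connecting_image e f"
    if d: "d \<in> idempotents S" and e: "e \<in> idempotents S" and less: "sl_less S f d" "sl_less S f e" for d e
  proof
    fix x assume x: "x \<in> connecting_image d f"
    have xf: "x \<in> H_class S f"
      using connecting_image_subset[OF d f] sl_less_left[OF d f less(1)] x by auto
    obtain \<theta> where \<theta>: "\<theta> \<in> iso S S" "\<theta> d = e" "\<theta> f = f"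
      by (rule extend_chain2[of d f e f]) (use d e f less in simp_all)
    have "\<theta> x \<in> connecting_image e f"
      using aut_connecting_image[OF \<theta>(1) d f x] \<theta>(2,3) by simp
    then show "x \<in> connecting_image e f"
      by (rule connecting_image_same_order[OF e f sl_less_left(1)[OF e f less(2)] _ xf
            same_order_sym[OF same_order_aut[OF \<theta>(1) H_classD(2)[OF f xf]]]])
  qed
  from this[OF d e less] this[OF e d less(2,1)] show ?thesis by blast
qed

section \<open>The decomposition of a maximal subgroup into image part and kernel part\<close>

lemma exists_less:
  assumes "e \<in> idempotents S" "f \<in> idempotents S" "sl_less S f e" "e' \<in> idempotents S"
  obtains f' where "f' \<in> idempotents S" "sl_less S f' e'"
proof -
  obtain \<theta> where \<theta>: "\<theta> \<in> iso S S" "\<theta> e = e'" using extend_idempotent assms(1,4) by metis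
  show thesis
    using that[OF aut_idempotent[OF \<theta>(1) assms(2)]] aut_sl_less[OF \<theta>(1) assms(2,1,3)] \<theta>(2) by simp
qed

text \<open>Automorphisms are transitive on the idempotents, so as soon as one pair is strictly
  comparable, every idempotent has others above and below it.\<close>

lemma exists_greater:
  assumes "e \<in> idempotents S" "f \<in> idempotents S" "sl_less S f e" "f' \<in> idempotents S"
  obtains e' where "e' \<in> idempotents S" "sl_less S f' e'"
proof -
  obtain \<theta> where \<theta>: "\<theta> \<in> iso S S" "\<theta> f = f'" using extend_idempotent assms(2,4) by metis
  show thesis
    using that[OF aut_idempotent[OF \<theta>(1) assms(1)]] aut_sl_less[OF \<theta>(1) assms(2,1,3)] \<theta>(2) by simp
qed

text \<open>By the independence results above, \<open>e\<close> may be compared with any smaller or larger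
  idempotent. If \<open>e\<close> is the only idempotent, the kernel part is trivial and the image part is
  the whole group.\<close>

definition kernel_part :: "'a \<Rightarrow> 'a set" where
  "kernel_part e = {x \<in> H_class S e. x = e \<or> (\<exists>f \<in> idempotents S. sl_less S f e \<and> x \<otimes> f = f)}"

definition image_part :: "'a \<Rightarrow> 'a set" where
  "image_part e = {x \<in> H_class S e. \<forall>d \<in> idempotents S. sl_less S e d \<longrightarrow> x \<in> connecting_image d e}"

lemma kernel_part_subset: "kernel_part e \<subseteq> H_class S e"
  and image_part_subset: "image_part e \<subseteq> H_class S e"
  by (auto simp: kernel_part_def image_part_def)

lemma kernel_part_eq:
  assumes "e \<in> idempotents S" "f \<in> idempotents S" "sl_less S f e"
  shows "kernel_part e = connecting_kernel e f"
proof -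
  have "e \<in> connecting_kernel e f"
    using assms sl_less_left[OF assms] by (simp add: connecting_kernel_def H_classD)
  moreover have "x \<in> connecting_kernel e f"
    if g: "x \<in> H_class S e" "g \<in> idempotents S" "sl_less S g e" "x \<otimes> g = g" for x g
    using connecting_kernel_eq[OF assms(1,2) g(2) assms(3) g(3)] g(1,4)
    by (simp add: connecting_kernel_def)
  ultimately show ?thesis
    using assms(2,3) by (auto simp: kernel_part_def connecting_kernel_def)
qed

lemma image_part_eq:
  assumes "e \<in> idempotents S" "d \<in> idempotents S" "sl_less S e d"
  shows "image_part e = connecting_image d e"
proof -
  have "x \<in> connecting_image d' e"
    if d': "x \<in> connecting_image d e" "d' \<in> idempotents S" "sl_less S e d'" for x d'
    using connecting_image_eq[OF assms(2) d'(2) assms(1,3) d'(3)] d'(1) by simp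
  then show ?thesis
    using assms connecting_image_subset[OF assms(2,1)] sl_less_left[OF assms(2,1,3)]
    by (auto simp: image_part_def)
qed

lemma aut_kernel_part:
  assumes "\<theta> \<in> iso S S" "e \<in> idempotents S" "x \<in> kernel_part e"
  shows "\<theta> x \<in> kernel_part (\<theta> e)"
proof (cases "x = e")
  case True
  then show ?thesis using H_classD(1)[OF aut_idempotent[OF assms(1,2)]] by (simp add: kernel_part_def)
next
  case False
  then obtain f where f: "f \<in> idempotents S" "sl_less S f e" "x \<in> connecting_kernel e f"
    using assms(3) by (auto simp: kernel_part_def connecting_kernel_def)
  show ?thesis
    using kernel_part_eq[OF aut_idempotent[OF assms(1,2)] aut_idempotent[OF assms(1) f(1)]
        aut_sl_less[OF assms(1) f(1) assms(2) f(2)]] aut_connecting_kernel[OF assms(1,2) f(1,3)]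
    by simp
qed

lemma aut_image_part:
  assumes "\<theta> \<in> iso S S" "e \<in> idempotents S" "x \<in> image_part e"
  shows "\<theta> x \<in> image_part (\<theta> e)"
proof (cases "\<exists>d \<in> idempotents S. sl_less S e d")
  case True
  then obtain d where d: "d \<in> idempotents S" "sl_less S e d" by blast
  have "x \<in> connecting_image d e" using image_part_eq[OF assms(2) d] assms(3) by simp
  then show ?thesis
    using image_part_eq[OF aut_idempotent[OF assms(1,2)] aut_idempotent[OF assms(1) d(1)]
        aut_sl_less[OF assms(1,2) d]] aut_connecting_image[OF assms(1) d(1) assms(2)]
    by simp
next
  case False
  have "\<not> sl_less S (\<theta> e) d" if d: "d \<in> idempotents S" for d
  proof
    assume "sl_less S (\<theta> e) d"
    then obtain d' where "d' \<in> idempotents S" "sl_less S e d'"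
      using exists_greater[OF d aut_idempotent[OF assms(1,2)] _ assms(2)] by metis
    then show False using False by blast
  qed
  then show ?thesis
    using aut_H_class[OF assms(1,2)] assms(3) by (auto simp: image_part_def)
qed

text \<open>\<open>extend_pair\<close> with both idempotents equal to \<open>e\<close> yields an
  automorphism fixing \<open>e\<close>, and such automorphisms preserve the kernel part. Coprimality
  and normality rest on this.\<close>

lemma kernel_part_same_order:
  assumes e: "e \<in> idempotents S" and x: "x \<in> kernel_part e" and y: "y \<in> H_class S e"
    and xy: "same_order S x y"
  shows "y \<in> kernel_part e"
proof -
  have "x \<in> H_class S e" using x kernel_part_subset by blast
  then obtain \<theta> where "\<theta> \<in> iso S S" "\<theta> e = e" "\<theta> x = y"
    using extend_pair[OF e e idempotents_idem[OF e] _ y xy] by metis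
  then show ?thesis using aut_kernel_part[OF _ e x, of \<theta>] by simp
qed

lemma image_part_same_order:
  assumes e: "e \<in> idempotents S" and x: "x \<in> image_part e" and y: "y \<in> H_class S e"
    and xy: "same_order S x y"
  shows "y \<in> image_part e"
proof -
  have "x \<in> H_class S e" using x image_part_subset by blast
  then obtain \<theta> where "\<theta> \<in> iso S S" "\<theta> e = e" "\<theta> x = y"
    using extend_pair[OF e e idempotents_idem[OF e] _ y xy] by metis
  then show ?thesis using aut_image_part[OF _ e x, of \<theta>] by simp
qed

lemma trivial_local_subgroup: "e \<in> idempotents S \<Longrightarrow> local_subgroup e {e}"
  by (simp add: local_subgroup_def H_classD(1) idempotents_idem sinv_idempotent)

lemma kernel_part_local_subgroup:
  assumes e: "e \<in> idempotents S"
  shows "local_subgroup e (kernel_part e)"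
proof (cases "\<exists>f \<in> idempotents S. sl_less S f e")
  case True
  then obtain f where f: "f \<in> idempotents S" "sl_less S f e" by blast
  note ef = sl_less_left(1)[OF e f]
  show ?thesis
    unfolding kernel_part_eq[OF e f] local_subgroup_def
  proof (intro conjI ballI)
    fix x assume "x \<in> connecting_kernel e f"
    then have x: "x \<in> H_class S e" "x \<otimes> f = f" by (simp_all add: connecting_kernel_def)
    note xc = H_classD(2)[OF e x(1)] idempotents_closed[OF f(1)]
    have "sinv S x \<otimes> f = sinv S (x \<otimes> f)"
      using restrict_sinv[OF f(1) xc(1)] by simp
    then have "sinv S x \<otimes> f = f" using x(2) sinv_idempotent[OF f(1)] by simp
    then show "sinv S x \<in> connecting_kernel e f"
      using H_classD(4)[OF e x(1)] by (simp add: connecting_kernel_def)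
    fix y assume "y \<in> connecting_kernel e f"
    then have y: "y \<in> H_class S e" "y \<otimes> f = f" by (simp_all add: connecting_kernel_def)
    have "(x \<otimes> y) \<otimes> f = f"
      using xc H_classD(2)[OF e y(1)] x(2) y(2) by (simp add: mult_assoc)
    then show "x \<otimes> y \<in> connecting_kernel e f"
      using H_classD(3)[OF e x(1) y(1)] by (simp add: connecting_kernel_def)
  qed (use e ef H_classD(1)[OF e] in \<open>auto simp: connecting_kernel_def\<close>)
next
  case False
  then have "kernel_part e = {e}" using H_classD(1)[OF e] by (auto simp: kernel_part_def)
  then show ?thesis using trivial_local_subgroup[OF e] by simp
qed

lemma image_part_local_subgroup:
  assumes e: "e \<in> idempotents S"
  shows "local_subgroup e (image_part e)"
proof (cases "\<exists>d \<in> idempotents S. sl_less S e d")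
  case True
  then obtain d where d: "d \<in> idempotents S" "sl_less S e d" by blast
  note de = sl_less_left(1)[OF d(1) e d(2)]
  show ?thesis
    unfolding image_part_eq[OF e d] local_subgroup_def
  proof (intro conjI ballI)
    show "connecting_image d e \<subseteq> H_class S e" by (rule connecting_image_subset[OF d(1) e de])
    show "e \<in> connecting_image d e"
      using H_classD(1)[OF d(1)] de unfolding connecting_image_def by (intro image_eqI[of _ _ d]) simp_all
    fix x assume "x \<in> connecting_image d e"
    then obtain u where u: "u \<in> H_class S d" "x = u \<otimes> e" by (auto simp: connecting_image_def)
    note uc = H_classD(2)[OF d(1) u(1)]
    show "sinv S x \<in> connecting_image d e"
      using u restrict_sinv[OF e uc] H_classD(4)[OF d(1) u(1)] by (simp add: connecting_image_def)
    fix y assume "y \<in> connecting_image d e"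
    then obtain v where v: "v \<in> H_class S d" "y = v \<otimes> e" by (auto simp: connecting_image_def)
    show "x \<otimes> y \<in> connecting_image d e"
      using u v restrict_mult[OF e uc H_classD(2)[OF d(1) v(1)]] H_classD(3)[OF d(1) u(1) v(1)]
      by (simp add: connecting_image_def)
  qed (rule e)
next
  case False
  then have "image_part e = H_class S e" by (auto simp: image_part_def)
  then show ?thesis using H_class_local_subgroup[OF e] by simp
qed

lemma kernel_part_restrict:
  assumes "e \<in> idempotents S" "f \<in> idempotents S" "sl_less S f e" "x \<in> kernel_part e"
  shows "x \<otimes> f = f"
  using assms kernel_part_eq[OF assms(1-3)] by (simp add: connecting_kernel_def)

lemma image_part_restrict:
  assumes e: "e \<in> idempotents S" and f: "f \<in> idempotents S" and less: "sl_less S f e"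
    and x: "x \<in> H_class S e"
  shows "x \<otimes> f \<in> image_part f"
  using image_part_eq[OF f e less] x by (simp add: connecting_image_def)

text \<open>A nontrivial such \<open>x\<close> restricts trivially to some \<open>f\<close> below
  \<open>e\<close> and lifts to some \<open>y\<close> in a group above \<open>e\<close>. Then
  \<open>y\<close> lies in the kernel towards \<open>f\<close>, which is also the kernel towards
  \<open>e\<close>, so \<open>x = y \<otimes> e = e\<close>.\<close>

lemma image_kernel_trivial:
  assumes e: "e \<in> idempotents S" and x: "x \<in> image_part e" "x \<in> kernel_part e"
  shows "x = e"
proof (rule ccontr)
  assume "x \<noteq> e"
  then obtain f where f: "f \<in> idempotents S" "sl_less S f e" "x \<otimes> f = f"
    using x(2) by (auto simp: kernel_part_def)
  obtain d where d: "d \<in> idempotents S" "sl_less S e d"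
    using exists_greater[OF e f(1,2) e] by metis
  then obtain y where y: "y \<in> H_class S d" "x = y \<otimes> e"
    using x(1) image_part_eq[OF e d] by (auto simp: connecting_image_def)
  have fd: "sl_less S f d" using sl_less_trans[OF f(1) e d(1) f(2) d(2)] .
  have "y \<otimes> f = y \<otimes> (e \<otimes> f)" using sl_less_left[OF e f(1,2)] by simp
  also have "\<dots> = f"
    using f(3) H_classD(2)[OF d(1) y(1)] idempotents_closed[OF e] idempotents_closed[OF f(1)]
    by (simp add: y(2) mult_assoc)
  finally have "y \<in> connecting_kernel d f" using y(1) by (simp add: connecting_kernel_def)
  then have "y \<in> connecting_kernel d e"
    using connecting_kernel_eq[OF d(1) f(1) e fd d(2)] by simp
  then show False using y(2) \<open>x \<noteq> e\<close> by (simp add: connecting_kernel_def)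
qed

text \<open>Two elements with equal restriction to a smaller idempotent differ by a factor that lies
  in both the image part and the kernel part.\<close>

lemma image_part_restrict_inj:
  assumes e: "e \<in> idempotents S" and f: "f \<in> idempotents S" and fe: "f \<otimes> e = f"
  shows "inj_on (\<lambda>x. x \<otimes> f) (image_part e)"
proof (rule inj_onI)
  fix x y assume x: "x \<in> image_part e" and y: "y \<in> image_part e" and eq: "x \<otimes> f = y \<otimes> f"
  note sg = image_part_local_subgroup[OF e]
  note xc = local_subgroupD(4)[OF sg x] local_subgroupD(4)[OF sg y]
  show "x = y"
  proof (cases "f = e")
    case True
    then show ?thesis using eq local_subgroupD(8)[OF sg x] local_subgroupD(8)[OF sg y] by simp
  next
    case False
    then have less: "sl_less S f e" using fe by (simp add: sl_less_def)
    have z: "sinv S y \<otimes> x \<in> image_part e"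
      using local_subgroupD(5)[OF sg local_subgroupD(6)[OF sg y] x] .
    have "(sinv S y \<otimes> x) \<otimes> f = sinv S y \<otimes> (y \<otimes> f)"
      using xc idempotents_closed[OF f] eq by (simp add: mult_assoc)
    also have "\<dots> = e \<otimes> f"
      using xc idempotents_closed[OF f] local_subgroupD(9)[OF sg y] by (simp flip: mult_assoc)
    finally have "(sinv S y \<otimes> x) \<otimes> f = f" using sl_less_left[OF e f less] by simp
    then have "sinv S y \<otimes> x \<in> kernel_part e"
      using kernel_part_eq[OF e f less] local_subgroupD(3)[OF sg z] by (simp add: connecting_kernel_def)
    then have "sinv S y \<otimes> x = e" using image_kernel_trivial[OF e z] by simp
    then have "y \<otimes> (sinv S y \<otimes> x) = y" using local_subgroupD(8)[OF sg y] by simp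
    then have "(y \<otimes> sinv S y) \<otimes> x = y" using xc by (simp add: mult_assoc)
    then show ?thesis using local_subgroupD(10)[OF sg y] local_subgroupD(7)[OF sg x] by simp
  qed
qed

lemma finite_parts: "e \<in> idempotents S \<Longrightarrow> finite (image_part e)" "e \<in> idempotents S \<Longrightarrow> finite (kernel_part e)"
  using finite_H_class[of e] finite_subset[OF image_part_subset] finite_subset[OF kernel_part_subset] by simp_all

lemma parts_closed:
  assumes "e \<in> idempotents S"
  shows "image_part e \<subseteq> carrier S" "kernel_part e \<subseteq> carrier S"
  using image_part_subset[of e] kernel_part_subset[of e] H_classD(2)[OF assms] by blast+

text \<open>Used in both directions, this gives equal sizes at all idempotents, which turns
  injections between parts into bijections.\<close>

lemma card_image_part_le:
  assumes "e \<in> idempotents S" "f \<in> idempotents S"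
  shows "card (image_part e) \<le> card (image_part f)" "card (kernel_part e) \<le> card (kernel_part f)"
proof -
  obtain \<theta> where \<theta>: "\<theta> \<in> iso S S" "\<theta> e = f" using extend_idempotent assms by metis
  show "card (image_part e) \<le> card (image_part f)"
    using aut_image_part[OF \<theta>(1) assms(1)] \<theta>(2) finite_parts[OF assms(2)] parts_closed[OF assms(1)]
    by (intro aut_card_le[OF \<theta>(1)]) auto
  show "card (kernel_part e) \<le> card (kernel_part f)"
    using aut_kernel_part[OF \<theta>(1) assms(1)] \<theta>(2) finite_parts[OF assms(2)] parts_closed[OF assms(1)]
    by (intro aut_card_le[OF \<theta>(1)]) auto
qed

lemma image_part_restrict_surj:
  assumes e: "e \<in> idempotents S" and f: "f \<in> idempotents S" and fe: "f \<otimes> e = f"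
  shows "(\<lambda>x. x \<otimes> f) ` image_part e = image_part f"
proof (cases "f = e")
  case True
  then show ?thesis
    using local_subgroupD(8)[OF image_part_local_subgroup[OF e]] by (simp cong: image_cong)
next
  case False
  then have less: "sl_less S f e" using fe by (simp add: sl_less_def)
  show ?thesis
  proof (rule card_seteq)
    show "finite (image_part f)" using finite_parts f by simp
    show "(\<lambda>x. x \<otimes> f) ` image_part e \<subseteq> image_part f"
      using image_part_restrict[OF e f less] image_part_subset by blast
    show "card (image_part f) \<le> card ((\<lambda>x. x \<otimes> f) ` image_part e)"
      using card_image[OF image_part_restrict_inj[OF e f fe]] card_image_part_le(1)[OF f e] by simp
  qed
qed

text \<open>Some \<open>j\<close> in the image part has the same restriction to a smaller idempotent
  as \<open>x\<close>, and \<open>sinv S j \<otimes> x\<close> then lies in the kernel.\<close>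

lemma image_kernel_factor:
  assumes e: "e \<in> idempotents S" and x: "x \<in> H_class S e"
  obtains j k where "j \<in> image_part e" "k \<in> kernel_part e" "x = j \<otimes> k"
proof (cases "\<exists>f \<in> idempotents S. sl_less S f e")
  case True
  then obtain f where f: "f \<in> idempotents S" "sl_less S f e" by blast
  have "x \<otimes> f \<in> (\<lambda>x. x \<otimes> f) ` image_part e"
    using image_part_restrict_surj[OF e f(1) sl_less_left(2)[OF e f]] image_part_restrict[OF e f x] by simp
  then obtain j where j: "j \<in> image_part e" "x \<otimes> f = j \<otimes> f" by blast
  have jH: "j \<in> H_class S e" using j(1) image_part_subset by blast
  note c = H_classD(2)[OF e x] H_classD(2)[OF e jH] idempotents_closed[OF f(1)]
  have "(sinv S j \<otimes> x) \<otimes> f = (sinv S j \<otimes> j) \<otimes> f"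
    using c j(2) by (simp add: mult_assoc)
  then have "(sinv S j \<otimes> x) \<otimes> f = f"
    using H_classD(7)[OF e jH] sl_less_left[OF e f] by simp
  then have "sinv S j \<otimes> x \<in> kernel_part e"
    using kernel_part_eq[OF e f] H_classD(3)[OF e H_classD(4)[OF e jH] x]
    by (simp add: connecting_kernel_def)
  moreover have "x = j \<otimes> (sinv S j \<otimes> x)"
    using c H_classD(8)[OF e jH] H_classD(5)[OF e x] by (simp flip: mult_assoc)
  ultimately show thesis using that j(1) by metis
next
  case False
  \<comment> \<open>Without smaller idempotents there are no larger ones either, by transitivity, so
    the image part is the whole group.\<close>
  have "\<not> sl_less S e d" if d: "d \<in> idempotents S" for d
  proof
    assume "sl_less S e d"
    then obtain f where "f \<in> idempotents S" "sl_less S f e" using exists_less[OF d e _ e] by metis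
    then show False using False by blast
  qed
  then have "x \<in> image_part e" using x by (auto simp: image_part_def)
  moreover have "e \<in> kernel_part e" using local_subgroupD(2)[OF kernel_part_local_subgroup[OF e]] .
  ultimately show thesis using that[of x e] H_classD(6)[OF e x] by simp
qed

text \<open>The commutator is a conjugate of \<open>k\<close> times an inverse of \<open>k\<close>,
  and also \<open>j\<close> times a conjugate of its inverse. Conjugates keep their order and hence
  their part, so the commutator lies in both parts.\<close>

lemma image_kernel_commute:
  assumes e: "e \<in> idempotents S" and j: "j \<in> image_part e" and k: "k \<in> kernel_part e"
  shows "j \<otimes> k = k \<otimes> j"
proof -
  note J = local_subgroupD[OF image_part_local_subgroup[OF e]]
  note K = local_subgroupD[OF kernel_part_local_subgroup[OF e]]
  have jH: "j \<in> H_class S e" and kH: "k \<in> H_class S e" using J(3)[OF j] K(3)[OF k] by simp_all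
  note c = J(4)[OF j] K(4)[OF k]
  have "j \<otimes> k \<otimes> sinv S j \<in> H_class S e"
    using H_classD(3,4)[OF e] jH kH by simp
  then have "j \<otimes> k \<otimes> sinv S j \<in> kernel_part e"
    using kernel_part_same_order[OF e k _ same_order_conj[OF e kH jH]] by simp
  then have ck: "(j \<otimes> k \<otimes> sinv S j) \<otimes> sinv S k \<in> kernel_part e"
    using K(5,6) k by simp
  have "k \<otimes> sinv S j \<otimes> sinv S k \<in> H_class S e"
    using H_classD(3,4)[OF e] jH kH by simp
  then have "k \<otimes> sinv S j \<otimes> sinv S k \<in> image_part e"
    using image_part_same_order[OF e J(6)[OF j] _ same_order_conj[OF e H_classD(4)[OF e jH] kH]] by simp
  then have "j \<otimes> (k \<otimes> sinv S j \<otimes> sinv S k) \<in> image_part e"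
    using J(5)[OF j] by simp
  then have "(j \<otimes> k \<otimes> sinv S j) \<otimes> sinv S k \<in> image_part e"
    using c by (simp add: mult_assoc)
  then have comm: "(j \<otimes> k \<otimes> sinv S j) \<otimes> sinv S k = e"
    using image_kernel_trivial[OF e _ ck] by simp
  have "j \<otimes> k = j \<otimes> (k \<otimes> e)" using H_classD(6)[OF e kH] by simp
  also have "\<dots> = (j \<otimes> k) \<otimes> (sinv S j \<otimes> (sinv S k \<otimes> k) \<otimes> j)"
  proof -
    have "sinv S j \<otimes> (sinv S k \<otimes> k) \<otimes> j = e"
      using H_classD(7)[OF e jH] H_classD(7)[OF e kH] H_classD(5)[OF e jH] c idempotents_closed[OF e]
      by (simp add: mult_assoc)
    then show ?thesis using c idempotents_closed[OF e] by (simp add: mult_assoc)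
  qed
  also have "\<dots> = ((j \<otimes> k \<otimes> sinv S j) \<otimes> sinv S k) \<otimes> (k \<otimes> j)"
    using c by (simp add: mult_assoc)
  also have "\<dots> = k \<otimes> j"
    using comm H_classD(5)[OF e H_classD(3)[OF e kH jH]] by simp
  finally show ?thesis .
qed

text \<open>The element \<open>sinv S j' \<otimes> j = k' \<otimes> sinv S k\<close> lies in both
  parts.\<close>

lemma image_kernel_unique:
  assumes e: "e \<in> idempotents S" and j: "j \<in> image_part e" "j' \<in> image_part e"
    and k: "k \<in> kernel_part e" "k' \<in> kernel_part e" and eq: "j \<otimes> k = j' \<otimes> k'"
  shows "j = j'" "k = k'"
proof -
  note J = local_subgroupD[OF image_part_local_subgroup[OF e]]
  note K = local_subgroupD[OF kernel_part_local_subgroup[OF e]]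
  note c = J(4)[OF j(1)] J(4)[OF j(2)] K(4)[OF k(1)] K(4)[OF k(2)]
  have "sinv S j' \<otimes> (j \<otimes> k) \<otimes> sinv S k = sinv S j' \<otimes> j"
    using c K(10)[OF k(1)] J(8)[OF j(1)] by (simp add: mult_assoc)
  moreover have "sinv S j' \<otimes> (j' \<otimes> k') \<otimes> sinv S k = (sinv S j' \<otimes> j') \<otimes> (k' \<otimes> sinv S k)"
    using c by (simp add: mult_assoc)
  moreover have kk: "k' \<otimes> sinv S k \<in> kernel_part e" using K(5)[OF k(2) K(6)[OF k(1)]] .
  ultimately have *: "sinv S j' \<otimes> j = k' \<otimes> sinv S k"
    using J(9)[OF j(2)] K(7)[OF kk] eq by simp
  have "sinv S j' \<otimes> j \<in> image_part e" using J(5)[OF J(6)[OF j(2)] j(1)] .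
  then have 1: "sinv S j' \<otimes> j = e" using image_kernel_trivial[OF e] kk * by simp
  then have "j' \<otimes> (sinv S j' \<otimes> j) = j'" using J(8)[OF j(2)] by simp
  then have "(j' \<otimes> sinv S j') \<otimes> j = j'" using c by (simp add: mult_assoc)
  then show "j = j'" using J(7)[OF j(1)] J(10)[OF j(2)] by simp
  have "(k' \<otimes> sinv S k) \<otimes> k = k" using 1 * K(7)[OF k(1)] by simp
  then have "k' \<otimes> (sinv S k \<otimes> k) = k" using c by (simp add: mult_assoc)
  then show "k = k'" using K(9)[OF k(1)] K(8)[OF k(2)] by simp
qed

end

section \<open>The spined product\<close>

lemma carrier_spined:
  "carrier (spined_product (Y \<times>\<times> I) (sl_group Y K))
    = {((a, i), (a, k)) | a i k. a \<in> carrier Y \<and> i \<in> carrier I \<and> k \<in> carrier K}"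
  by (auto simp: spined_product_def sl_group_def)

text \<open>The four cases of \<open>[Y;K]\<close> merge into one rule: a \<open>K\<close>-component
  survives exactly if its index is the meet of \<open>a\<close> and \<open>b\<close>, and becomes
  the identity otherwise.\<close>

lemma mult_spined:
  assumes "alg_semilattice Y" "monoid K"
    and "a \<in> carrier Y" "b \<in> carrier Y" "k \<in> carrier K" "l \<in> carrier K"
  shows "((a, i), (a, k)) \<otimes>\<^bsub>spined_product (Y \<times>\<times> I) (sl_group Y K)\<^esub> ((b, j), (b, l))
    = ((a \<otimes>\<^bsub>Y\<^esub> b, i \<otimes>\<^bsub>I\<^esub> j), (a \<otimes>\<^bsub>Y\<^esub> b,
        (if a \<otimes>\<^bsub>Y\<^esub> b = a then k else \<one>\<^bsub>K\<^esub>) \<otimes>\<^bsub>K\<^esub> (if a \<otimes>\<^bsub>Y\<^esub> b = b then l else \<one>\<^bsub>K\<^esub>)))"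
proof -
  interpret Y: alg_semilattice Y by fact
  interpret K: monoid K by fact
  show ?thesis
    using assms(3-) Y.mult_comm[of a b] Y.mult_idem
    by (auto simp: spined_product_def sl_group_def sl_less_def)
qed

locale spined_factors = Y: alg_semilattice Y + I: group I + K: group K
  for Y :: "('y, 'm) monoid_scheme" and I :: "('i, 'n) monoid_scheme" and K :: "('k, 'o) monoid_scheme"
begin

abbreviation P where "P \<equiv> spined_product (Y \<times>\<times> I) (sl_group Y K)"

lemma carrier_P: "x \<in> carrier P \<longleftrightarrow> (\<exists>a \<in> carrier Y. \<exists>i \<in> carrier I. \<exists>k \<in> carrier K. x = ((a, i), (a, k)))"
  by (auto simp: carrier_spined)

lemmas mult_P = mult_spined[OF Y.alg_semilattice_axioms K.monoid_axioms, where I = I]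

text \<open>A \<open>K\<close>-component survives a triple product exactly if its index is the
  triple meet; these equivalences express that through the pairwise products of either
  bracketing.\<close>

lemma absorb:
  assumes "a \<in> carrier Y" "b \<in> carrier Y" "c \<in> carrier Y"
  shows "(a \<otimes>\<^bsub>Y\<^esub> b) \<otimes>\<^bsub>Y\<^esub> c = a \<longleftrightarrow> a \<otimes>\<^bsub>Y\<^esub> b = a \<and> (a \<otimes>\<^bsub>Y\<^esub> b) \<otimes>\<^bsub>Y\<^esub> c = a \<otimes>\<^bsub>Y\<^esub> b"
    and "a \<otimes>\<^bsub>Y\<^esub> (b \<otimes>\<^bsub>Y\<^esub> c) = c \<longleftrightarrow> b \<otimes>\<^bsub>Y\<^esub> c = c \<and> a \<otimes>\<^bsub>Y\<^esub> (b \<otimes>\<^bsub>Y\<^esub> c) = b \<otimes>\<^bsub>Y\<^esub> c"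
    and "a \<otimes>\<^bsub>Y\<^esub> (b \<otimes>\<^bsub>Y\<^esub> c) = b \<longleftrightarrow> a \<otimes>\<^bsub>Y\<^esub> b = b \<and> b \<otimes>\<^bsub>Y\<^esub> c = b"
proof -
  have *: "x \<otimes>\<^bsub>Y\<^esub> y = x" if x: "x \<in> carrier Y" "y \<in> carrier Y" "z \<in> carrier Y" "(x \<otimes>\<^bsub>Y\<^esub> y) \<otimes>\<^bsub>Y\<^esub> z = x" for x y z
  proof -
    have "x = (x \<otimes>\<^bsub>Y\<^esub> z) \<otimes>\<^bsub>Y\<^esub> y"
      using x Y.mult_assoc Y.mult_comm by metis
    then have "x \<otimes>\<^bsub>Y\<^esub> y = (x \<otimes>\<^bsub>Y\<^esub> z) \<otimes>\<^bsub>Y\<^esub> (y \<otimes>\<^bsub>Y\<^esub> y)"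
      using x Y.mult_assoc Y.mult_closed by metis
    then show ?thesis using \<open>x = (x \<otimes>\<^bsub>Y\<^esub> z) \<otimes>\<^bsub>Y\<^esub> y\<close> Y.mult_idem[OF x(2)] by simp
  qed
  show "(a \<otimes>\<^bsub>Y\<^esub> b) \<otimes>\<^bsub>Y\<^esub> c = a \<longleftrightarrow> a \<otimes>\<^bsub>Y\<^esub> b = a \<and> (a \<otimes>\<^bsub>Y\<^esub> b) \<otimes>\<^bsub>Y\<^esub> c = a \<otimes>\<^bsub>Y\<^esub> b"
    using *[OF assms] by auto
  have "(c \<otimes>\<^bsub>Y\<^esub> b) \<otimes>\<^bsub>Y\<^esub> a = a \<otimes>\<^bsub>Y\<^esub> (b \<otimes>\<^bsub>Y\<^esub> c)" "c \<otimes>\<^bsub>Y\<^esub> b = b \<otimes>\<^bsub>Y\<^esub> c"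
    using assms Y.mult_comm Y.mult_closed by metis+
  then show "a \<otimes>\<^bsub>Y\<^esub> (b \<otimes>\<^bsub>Y\<^esub> c) = c \<longleftrightarrow> b \<otimes>\<^bsub>Y\<^esub> c = c \<and> a \<otimes>\<^bsub>Y\<^esub> (b \<otimes>\<^bsub>Y\<^esub> c) = b \<otimes>\<^bsub>Y\<^esub> c"
    using *[OF assms(3,2,1)] by auto
  have "(b \<otimes>\<^bsub>Y\<^esub> a) \<otimes>\<^bsub>Y\<^esub> c = a \<otimes>\<^bsub>Y\<^esub> (b \<otimes>\<^bsub>Y\<^esub> c)" "(b \<otimes>\<^bsub>Y\<^esub> c) \<otimes>\<^bsub>Y\<^esub> a = a \<otimes>\<^bsub>Y\<^esub> (b \<otimes>\<^bsub>Y\<^esub> c)"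
    "a \<otimes>\<^bsub>Y\<^esub> b = b \<otimes>\<^bsub>Y\<^esub> a"
    using assms Y.mult_comm Y.mult_closed Y.mult_assoc by metis+
  then show "a \<otimes>\<^bsub>Y\<^esub> (b \<otimes>\<^bsub>Y\<^esub> c) = b \<longleftrightarrow> a \<otimes>\<^bsub>Y\<^esub> b = b \<and> b \<otimes>\<^bsub>Y\<^esub> c = b"
    using *[OF assms(2,1,3)] *[OF assms(2,3,1)] by auto
qed

text \<open>For either bracketing, the \<open>K\<close>-component is the ordered product of those of
  \<open>k\<close>, \<open>l\<close>, \<open>m\<close> whose index is the triple meet.\<close>

lemma alg_semigroup_P: "alg_semigroup P"
proof
  show "carrier P \<noteq> {}"
    using Y.carrier_nonempty I.one_closed K.one_closed by (auto simp: carrier_spined)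
next
  fix x y assume "x \<in> carrier P" "y \<in> carrier P"
  then show "x \<otimes>\<^bsub>P\<^esub> y \<in> carrier P"
    by (auto simp: carrier_P mult_P Y.mult_closed)
next
  fix x y z assume "x \<in> carrier P" "y \<in> carrier P" "z \<in> carrier P"
  then obtain a i k b j l c h m where
    x: "a \<in> carrier Y" "i \<in> carrier I" "k \<in> carrier K" "x = ((a, i), (a, k))" and
    y: "b \<in> carrier Y" "j \<in> carrier I" "l \<in> carrier K" "y = ((b, j), (b, l))" and
    z: "c \<in> carrier Y" "h \<in> carrier I" "m \<in> carrier K" "z = ((c, h), (c, m))"
    unfolding carrier_P by blast
  let ?s = "a \<otimes>\<^bsub>Y\<^esub> b \<otimes>\<^bsub>Y\<^esub> c"
  have s: "a \<otimes>\<^bsub>Y\<^esub> (b \<otimes>\<^bsub>Y\<^esub> c) = ?s" using x y z by (simp add: Y.mult_assoc)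
  have eqs: "?s = a \<longleftrightarrow> a \<otimes>\<^bsub>Y\<^esub> b = a \<and> ?s = a \<otimes>\<^bsub>Y\<^esub> b"
    "?s = c \<longleftrightarrow> b \<otimes>\<^bsub>Y\<^esub> c = c \<and> ?s = b \<otimes>\<^bsub>Y\<^esub> c"
    "?s = b \<longleftrightarrow> a \<otimes>\<^bsub>Y\<^esub> b = b \<and> b \<otimes>\<^bsub>Y\<^esub> c = b"
    using absorb[OF x(1) y(1) z(1)] unfolding s by blast+
  let ?k = "if ?s = a then k else \<one>\<^bsub>K\<^esub>" and ?l = "if ?s = b then l else \<one>\<^bsub>K\<^esub>"
    and ?m = "if ?s = c then m else \<one>\<^bsub>K\<^esub>"
  let ?u = "(if a \<otimes>\<^bsub>Y\<^esub> b = a then k else \<one>\<^bsub>K\<^esub>) \<otimes>\<^bsub>K\<^esub> (if a \<otimes>\<^bsub>Y\<^esub> b = b then l else \<one>\<^bsub>K\<^esub>)"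
    and ?v = "(if b \<otimes>\<^bsub>Y\<^esub> c = b then l else \<one>\<^bsub>K\<^esub>) \<otimes>\<^bsub>K\<^esub> (if b \<otimes>\<^bsub>Y\<^esub> c = c then m else \<one>\<^bsub>K\<^esub>)"
  have c: "?k \<in> carrier K" "?l \<in> carrier K" "?m \<in> carrier K" "?u \<in> carrier K" "?v \<in> carrier K"
    "a \<otimes>\<^bsub>Y\<^esub> b \<in> carrier Y" "b \<otimes>\<^bsub>Y\<^esub> c \<in> carrier Y"
    using x y z by (simp_all add: Y.mult_closed)
  \<comment> \<open>If the triple meet is not the meet of \<open>a\<close> and \<open>b\<close>, it
    is neither \<open>a\<close> nor \<open>b\<close>, so both sides are trivial.\<close>
  have u: "(if ?s = a \<otimes>\<^bsub>Y\<^esub> b then ?u else \<one>\<^bsub>K\<^esub>) = ?k \<otimes>\<^bsub>K\<^esub> ?l"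
  proof (cases "?s = a \<otimes>\<^bsub>Y\<^esub> b")
    case False
    then have "?s \<noteq> a" "?s \<noteq> b" using eqs(1,3) by auto
    then show ?thesis using False by simp
  qed simp
  have v: "(if ?s = b \<otimes>\<^bsub>Y\<^esub> c then ?v else \<one>\<^bsub>K\<^esub>) = ?l \<otimes>\<^bsub>K\<^esub> ?m"
  proof (cases "?s = b \<otimes>\<^bsub>Y\<^esub> c")
    case False
    then have "?s \<noteq> b" "?s \<noteq> c" using eqs(2,3) by auto
    then show ?thesis using False by simp
  qed simp
  have "(x \<otimes>\<^bsub>P\<^esub> y) \<otimes>\<^bsub>P\<^esub> z = ((?s, i \<otimes>\<^bsub>I\<^esub> j \<otimes>\<^bsub>I\<^esub> h), (?s, (if ?s = a \<otimes>\<^bsub>Y\<^esub> b then ?u else \<one>\<^bsub>K\<^esub>) \<otimes>\<^bsub>K\<^esub> ?m))"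
    unfolding x(4) y(4) z(4) mult_P[OF x(1) y(1) x(3) y(3)] mult_P[OF c(6) z(1) c(4) z(3)] ..
  then have "(x \<otimes>\<^bsub>P\<^esub> y) \<otimes>\<^bsub>P\<^esub> z = ((?s, i \<otimes>\<^bsub>I\<^esub> j \<otimes>\<^bsub>I\<^esub> h), (?s, ?k \<otimes>\<^bsub>K\<^esub> ?l \<otimes>\<^bsub>K\<^esub> ?m))"
    unfolding u .
  moreover have "x \<otimes>\<^bsub>P\<^esub> (y \<otimes>\<^bsub>P\<^esub> z) = ((?s, i \<otimes>\<^bsub>I\<^esub> (j \<otimes>\<^bsub>I\<^esub> h)), (?s, ?k \<otimes>\<^bsub>K\<^esub> (if ?s = b \<otimes>\<^bsub>Y\<^esub> c then ?v else \<one>\<^bsub>K\<^esub>)))"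
    unfolding x(4) y(4) z(4) mult_P[OF y(1) z(1) y(3) z(3)] mult_P[OF x(1) c(7) x(3) c(5)] s ..
  then have "x \<otimes>\<^bsub>P\<^esub> (y \<otimes>\<^bsub>P\<^esub> z) = ((?s, i \<otimes>\<^bsub>I\<^esub> j \<otimes>\<^bsub>I\<^esub> h), (?s, ?k \<otimes>\<^bsub>K\<^esub> ?l \<otimes>\<^bsub>K\<^esub> ?m))"
    unfolding v K.m_assoc[OF c(1,2,3)] I.m_assoc[OF x(2) y(2) z(2)] .
  ultimately show "(x \<otimes>\<^bsub>P\<^esub> y) \<otimes>\<^bsub>P\<^esub> z = x \<otimes>\<^bsub>P\<^esub> (y \<otimes>\<^bsub>P\<^esub> z)" by simp
qed

lemma mult_P_same:
  assumes "a \<in> carrier Y" "k \<in> carrier K" "l \<in> carrier K"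
  shows "((a, i), (a, k)) \<otimes>\<^bsub>P\<^esub> ((a, j), (a, l)) = ((a, i \<otimes>\<^bsub>I\<^esub> j), (a, k \<otimes>\<^bsub>K\<^esub> l))"
  using assms by (simp add: mult_P Y.mult_idem)

lemma is_sinv_P:
  assumes "a \<in> carrier Y" "i \<in> carrier I" "k \<in> carrier K"
  shows "is_sinv P ((a, i), (a, k)) y \<longleftrightarrow> y = ((a, inv\<^bsub>I\<^esub> i), (a, inv\<^bsub>K\<^esub> k))"
proof
  assume y: "is_sinv P ((a, i), (a, k)) y"
  then obtain b j l where b: "b \<in> carrier Y" "j \<in> carrier I" "l \<in> carrier K" "y = ((b, j), (b, l))"
    by (auto simp: is_sinv_def carrier_P)
  have "a \<otimes>\<^bsub>Y\<^esub> b \<otimes>\<^bsub>Y\<^esub> a = a" "b \<otimes>\<^bsub>Y\<^esub> a \<otimes>\<^bsub>Y\<^esub> b = b"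
    using y assms b by (auto simp: is_sinv_def mult_P Y.mult_closed)
  then have ab: "b = a"
    using absorb(1)[OF assms(1) b(1) assms(1)] absorb(1)[OF b(1) assms(1) b(1)]
      Y.mult_comm[OF assms(1) b(1)] by simp
  have "i \<otimes>\<^bsub>I\<^esub> j \<otimes>\<^bsub>I\<^esub> i = i" "k \<otimes>\<^bsub>K\<^esub> l \<otimes>\<^bsub>K\<^esub> k = k"
    using y assms b by (auto simp: is_sinv_def mult_P_same ab)
  then have "i \<otimes>\<^bsub>I\<^esub> j = \<one>\<^bsub>I\<^esub>" "k \<otimes>\<^bsub>K\<^esub> l = \<one>\<^bsub>K\<^esub>"
    using assms b by (simp_all add: I.r_cancel_one' I.l_cancel_one K.l_cancel_one)
  then show "y = ((a, inv\<^bsub>I\<^esub> i), (a, inv\<^bsub>K\<^esub> k))"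
    using assms b ab I.inv_equality[of j i] K.inv_equality[of l k]
      I.inv_comm[of i j] K.inv_comm[of k l] by simp
qed (use assms in \<open>auto simp: is_sinv_def carrier_P mult_P_same\<close>)

lemma idempotents_P: "idempotents P = {((a, \<one>\<^bsub>I\<^esub>), (a, \<one>\<^bsub>K\<^esub>)) | a. a \<in> carrier Y}"
proof -
  have "((a, i), (a, k)) \<otimes>\<^bsub>P\<^esub> ((a, i), (a, k)) = ((a, i), (a, k)) \<longleftrightarrow> i = \<one>\<^bsub>I\<^esub> \<and> k = \<one>\<^bsub>K\<^esub>"
    if "a \<in> carrier Y" "i \<in> carrier I" "k \<in> carrier K" for a i k
    using that by (simp add: mult_P_same I.l_cancel_one K.l_cancel_one)
  then show ?thesis unfolding idempotents_def carrier_spined by fastforce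
qed

lemma clifford_semigroup_P: "clifford_semigroup P"
proof -
  interpret P: alg_semigroup P by (rule alg_semigroup_P)
  show ?thesis
  proof
    fix x assume "x \<in> carrier P"
    then obtain a i k where "a \<in> carrier Y" "i \<in> carrier I" "k \<in> carrier K" "x = ((a, i), (a, k))"
      unfolding carrier_P by blast
    then show "\<exists>!y. is_sinv P x y" by (simp add: is_sinv_P)
  next
    fix e x assume e: "e \<in> idempotents P" and "x \<in> carrier P"
    then obtain a i k where x: "a \<in> carrier Y" "i \<in> carrier I" "k \<in> carrier K" "x = ((a, i), (a, k))"
      unfolding carrier_P by blast
    obtain b where "b \<in> carrier Y" "e = ((b, \<one>\<^bsub>I\<^esub>), (b, \<one>\<^bsub>K\<^esub>))"
      using e idempotents_P by auto
    then show "e \<otimes>\<^bsub>P\<^esub> x = x \<otimes>\<^bsub>P\<^esub> e"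
      using x Y.mult_comm[of a b] by (simp add: mult_P)
  qed
qed

lemma sinv_P:
  "\<lbrakk>a \<in> carrier Y; i \<in> carrier I; k \<in> carrier K\<rbrakk>
    \<Longrightarrow> sinv P ((a, i), (a, k)) = ((a, inv\<^bsub>I\<^esub> i), (a, inv\<^bsub>K\<^esub> k))"
  by (simp add: sinv_def is_sinv_P)

end

section \<open>Homogeneous inverse semigroups are spined products\<close>

context finite_HIS begin

section \<open>Homogeneity of the three factors\<close>

lemma inv_generate_restrict:
  assumes "A \<subseteq> idempotents S"
  shows "sl_generate (S\<lparr>carrier := B\<rparr>) A = inv_generate S A" "inv_generate S A \<subseteq> idempotents S"
proof -
  have 1: "x \<in> inv_generate S A" if "x \<in> sl_generate (S\<lparr>carrier := B\<rparr>) A" for x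
    using that by induct (auto intro: inv_generate.intros)
  have 2: "x \<in> idempotents S \<and> x \<in> sl_generate (S\<lparr>carrier := B\<rparr>) A" if "x \<in> inv_generate S A" for x
    using that
  proof induct
    case (incl a)
    then show ?case using assms by (auto intro: sl_generate.intros)
  next
    case (mult a b)
    then show ?case using sl_generate.mult[of a "S\<lparr>carrier := B\<rparr>" A b] idempotents_mult_closed by simp
  next
    case (inv a)
    then show ?case by (simp add: sinv_idempotent)
  qed
  show "sl_generate (S\<lparr>carrier := B\<rparr>) A = inv_generate S A" "inv_generate S A \<subseteq> idempotents S"
    using 1 2 by blast+
qed

lemma aut_idempotents_iso:
  assumes "\<theta> \<in> iso S S"
  shows "\<theta> \<in> iso (S\<lparr>carrier := idempotents S\<rparr>) (S\<lparr>carrier := idempotents S\<rparr>)"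
proof (rule iso_carrierI)
  show "idempotents S \<subseteq> \<theta> ` idempotents S"
  proof
    fix e assume e: "e \<in> idempotents S"
    then have "e \<in> \<theta> ` carrier S" using isoD(4)[OF assms] idempotents_closed by simp
    then obtain x where x: "x \<in> carrier S" "e = \<theta> x" by blast
    have "\<theta> (x \<otimes> x) = \<theta> x" using isoD(2)[OF assms x(1) x(1)] x(2) idempotents_idem[OF e] by simp
    then have "x \<otimes> x = x" using isoD(3)[OF assms] x(1) by (simp add: inj_on_eq_iff)
    then show "e \<in> \<theta> ` idempotents S" using x by (simp add: idempotents_def)
  qed
  show "inj_on \<theta> (idempotents S)"
    using isoD(3)[OF assms] by (rule inj_on_subset) (auto simp: idempotents_closed)
qed (simp_all add: aut_idempotent[OF assms] isoD(2)[OF assms] idempotents_closed)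

lemma homogeneous_idempotents: "homogeneous_semilattice (S\<lparr>carrier := idempotents S\<rparr>)"
  unfolding homogeneous_semilattice_def
proof (intro conjI allI impI)
  show "alg_semilattice (S\<lparr>carrier := idempotents S\<rparr>)" by (rule idempotents_alg_semilattice)
  fix A B
  assume AB: "finite A \<and> A \<subseteq> carrier (S\<lparr>carrier := idempotents S\<rparr>) \<and>
    finite B \<and> B \<subseteq> carrier (S\<lparr>carrier := idempotents S\<rparr>)"
  then have A: "A \<subseteq> idempotents S" and B: "B \<subseteq> idempotents S" by simp_all
  show "isos_extend (S\<lparr>carrier := idempotents S\<rparr>) (sl_generate (S\<lparr>carrier := idempotents S\<rparr>) A)
     (sl_generate (S\<lparr>carrier := idempotents S\<rparr>) B)"
    unfolding isos_extend_def inv_generate_restrict(1)[OF A] inv_generate_restrict(1)[OF B]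
  proof
    fix \<phi> assume \<phi>: "\<phi> \<in> iso (S\<lparr>carrier := idempotents S, carrier := inv_generate S A\<rparr>)
      (S\<lparr>carrier := idempotents S, carrier := inv_generate S B\<rparr>)"
    obtain \<theta> where \<theta>: "\<theta> \<in> iso S S" "\<And>x. x \<in> inv_generate S A \<Longrightarrow> \<theta> x = \<phi> x"
      by (rule extend_iso[of A B "inv_generate S A" "inv_generate S B" \<phi>])
        (use A B AB \<phi> idempotents_closed in auto)
    show "\<exists>\<theta> \<in> iso (S\<lparr>carrier := idempotents S\<rparr>) (S\<lparr>carrier := idempotents S\<rparr>).
      \<forall>x \<in> inv_generate S A. \<theta> x = \<phi> x"
      using aut_idempotents_iso[OF \<theta>(1)] \<theta>(2) by (intro bexI[of _ \<theta>]) simp_all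
  qed
qed

text \<open>Once \<open>e\<close> is adjoined to the generators, subgroups of \<open>Q\<close> are
  inverse subsemigroups, so isomorphisms extend to \<open>S\<close>. The extension maps
  \<open>e\<close> to an idempotent of its own group, hence fixes it; it then preserves
  \<open>Q\<close> by assumption and is onto \<open>Q\<close> by finiteness.\<close>

lemma homogeneous_local_subgroup:
  assumes Q: "local_subgroup e Q"
    and inv: "\<And>\<theta> x. \<lbrakk>\<theta> \<in> iso S S; \<theta> e = e; x \<in> Q\<rbrakk> \<Longrightarrow> \<theta> x \<in> Q"
  shows "homogeneous_group (group_on e Q)"
  unfolding homogeneous_group_def
proof (intro conjI allI impI)
  interpret G: group "group_on e Q" using Q by (rule group_group_on)
  show "group (group_on e Q)" by (rule G.group_axioms)
  note D = local_subgroupD[OF Q]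
  have Qc: "Q \<subseteq> carrier S" using D(4) by blast
  have "Q \<subseteq> H_class S e" using D(3) by blast
  then have fin: "finite Q" using finite_H_class[OF D(1)] finite_subset by blast
  fix A B
  assume AB: "finite A \<and> A \<subseteq> carrier (group_on e Q) \<and> finite B \<and> B \<subseteq> carrier (group_on e Q)"
  then have A: "A \<subseteq> Q" and B: "B \<subseteq> Q" by simp_all
  note genA = generate_group_on[OF Q A] and genB = generate_group_on[OF Q B]
  show "isos_extend (group_on e Q) (generate (group_on e Q) A) (generate (group_on e Q) B)"
    unfolding isos_extend_def genA(1) genB(1)
  proof
    let ?T = "inv_generate S (insert e A)" and ?U = "inv_generate S (insert e B)"
    fix \<phi> assume \<phi>: "\<phi> \<in> iso (group_on e Q\<lparr>carrier := ?T\<rparr>) (group_on e Q\<lparr>carrier := ?U\<rparr>)"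
    then have "\<phi> \<in> iso (S\<lparr>carrier := ?T\<rparr>) (S\<lparr>carrier := ?U\<rparr>)"
      by (simp add: iso_def hom_def)
    moreover have "finite (insert e A)" "insert e A \<subseteq> carrier S" "finite (insert e B)" "insert e B \<subseteq> carrier S"
      using AB A B Qc D(2) by auto
    ultimately obtain \<theta> where \<theta>: "\<theta> \<in> iso S S" "\<And>x. x \<in> ?T \<Longrightarrow> \<theta> x = \<phi> x"
      using extend_iso[of "insert e A" "insert e B" ?T ?U \<phi>] by metis
    have eT: "e \<in> ?T" by (rule inv_generate.incl) simp
    then have "\<theta> e \<in> ?U" using \<theta>(2)[OF eT] isoD(1)[OF \<phi>, of e] by simp
    then have "\<theta> e \<in> H_class S e" using genB(2) D(3) by blast
    then have \<theta>e: "\<theta> e = e" using H_class_idempotent[OF D(1)] aut_idempotent[OF \<theta>(1) D(1)] by simp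
    have "\<theta> \<in> iso (group_on e Q) (group_on e Q)"
    proof (rule isoI)
      have inj: "inj_on \<theta> Q" using isoD(3)[OF \<theta>(1)] Qc by (rule inj_on_subset)
      then show "inj_on \<theta> (carrier (group_on e Q))" by simp
      have "\<theta> ` Q \<subseteq> Q" using inv[OF \<theta>(1) \<theta>e] by blast
      then have "\<theta> ` Q = Q" using inj fin by (simp add: endo_inj_surj)
      then show "carrier (group_on e Q) \<subseteq> \<theta> ` carrier (group_on e Q)" by simp
    qed (use inv[OF \<theta>(1) \<theta>e] D(4) isoD(2)[OF \<theta>(1)] in auto)
    then show "\<exists>\<theta> \<in> iso (group_on e Q) (group_on e Q). \<forall>x \<in> ?T. \<theta> x = \<phi> x"
      using \<theta>(2) by (intro bexI[of _ \<theta>]) simp_all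
  qed
qed

lemma homogeneous_parts:
  assumes "e \<in> idempotents S"
  shows "homogeneous_group (group_on e (image_part e))" "homogeneous_group (group_on e (kernel_part e))"
proof -
  show "homogeneous_group (group_on e (image_part e))"
    by (rule homogeneous_local_subgroup[OF image_part_local_subgroup[OF assms]])
      (use aut_image_part[OF _ assms] in metis)
  show "homogeneous_group (group_on e (kernel_part e))"
    by (rule homogeneous_local_subgroup[OF kernel_part_local_subgroup[OF assms]])
      (use aut_kernel_part[OF _ assms] in metis)
qed

text \<open>An element of the image part with the order of a kernel element lies in the kernel part
  as well, hence is trivial.\<close>

lemma coprime_parts:
  assumes e: "e \<in> idempotents S"
  shows "coprime_orders (group_on e (image_part e)) (group_on e (kernel_part e))"
  unfolding coprime_orders_def
proof (intro ballI impI)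
  let ?J = "group_on e (image_part e)" and ?K = "group_on e (kernel_part e)"
  interpret J: group ?J by (rule group_group_on[OF image_part_local_subgroup[OF e]])
  interpret K: group ?K by (rule group_group_on[OF kernel_part_local_subgroup[OF e]])
  fix x y assume x: "x \<in> carrier ?J" and y: "y \<in> carrier ?K" and eq: "J.ord x = K.ord y"
  have "same_order S x y"
    by (rule same_order_of_ord[OF J.group_axioms K.group_axioms x y eq]) (simp_all add: spow_group_on)
  then have "x \<in> kernel_part e"
    using kernel_part_same_order[OF e _ _ same_order_sym, of y x] x y image_part_subset by auto
  then have "x = e" using image_kernel_trivial[OF e] x by simp
  then show "J.ord x = 1" using J.ord_id by simp
qed

text \<open>The element \<open>j\<close> of the image part of \<open>e\<close> with \<open>j \<otimes> c = i \<otimes> e\<close> corresponds to the element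
  \<open>i\<close> of the image part of \<open>c\<close>: both have the same restriction to \<open>e \<otimes> c\<close>.\<close>

definition transport :: "'a \<Rightarrow> 'a \<Rightarrow> 'a \<Rightarrow> 'a" where
  "transport c e i = (THE j. j \<in> image_part e \<and> j \<otimes> c = i \<otimes> e)"

lemma mult_idempotent_absorb:
  assumes "e \<in> idempotents S" "f \<in> idempotents S"
  shows "(e \<otimes> f) \<otimes> e = e \<otimes> f" "(e \<otimes> f) \<otimes> f = e \<otimes> f"
proof -
  note c = idempotents_closed[OF assms(1)] idempotents_closed[OF assms(2)]
  show "(e \<otimes> f) \<otimes> f = e \<otimes> f" using c by (simp add: mult_assoc idempotents_idem[OF assms(2)])
  have "(e \<otimes> f) \<otimes> e = (e \<otimes> e) \<otimes> f"
    using c by (simp add: mult_assoc idempotents_commute[OF assms(2,1)])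
  then show "(e \<otimes> f) \<otimes> e = e \<otimes> f" by (simp add: idempotents_idem[OF assms(1)])
qed

text \<open>The image parts of \<open>c\<close> and of \<open>e\<close> both restrict bijectively to
  that of \<open>c \<otimes> e\<close>, and multiplying by \<open>e\<close>, respectively by
  \<open>c\<close>, is this restriction.\<close>

lemma transport_unique:
  assumes c: "c \<in> idempotents S" and e: "e \<in> idempotents S" and i: "i \<in> image_part c"
  shows "\<exists>!j. j \<in> image_part e \<and> j \<otimes> c = i \<otimes> e"
proof -
  note cl = idempotents_closed[OF c] idempotents_closed[OF e]
  have ce: "c \<otimes> e \<in> idempotents S" using c e by (rule idempotents_mult_closed)
  note ab = mult_idempotent_absorb[OF c e]
  have ic: "i \<otimes> (c \<otimes> e) = i \<otimes> e"
    using cl local_subgroupD(4,8)[OF image_part_local_subgroup[OF c] i] by (simp flip: mult_assoc)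
  have jc: "j \<otimes> (c \<otimes> e) = j \<otimes> c" if j: "j \<in> image_part e" for j
    using cl local_subgroupD(4,8)[OF image_part_local_subgroup[OF e] j]
    by (simp add: idempotents_commute[OF c e] flip: mult_assoc)
  have "i \<otimes> e \<in> image_part (c \<otimes> e)"
    using image_part_restrict_surj[OF c ce ab(1)] i ic by (metis image_eqI)
  then have "i \<otimes> e \<in> (\<lambda>x. x \<otimes> (c \<otimes> e)) ` image_part e"
    using image_part_restrict_surj[OF e ce ab(2)] by simp
  then obtain j where j: "j \<in> image_part e" "j \<otimes> c = i \<otimes> e" using jc by auto
  moreover have "j' = j" if j': "j' \<in> image_part e \<and> j' \<otimes> c = i \<otimes> e" for j'
    using image_part_restrict_inj[OF e ce ab(2)] j j' jc by (simp add: inj_on_def)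
  ultimately show ?thesis by blast
qed

lemma transportD:
  assumes "c \<in> idempotents S" "e \<in> idempotents S" "i \<in> image_part c"
  shows "transport c e i \<in> image_part e" "transport c e i \<otimes> c = i \<otimes> e"
    and "\<lbrakk>j \<in> image_part e; j \<otimes> c = i \<otimes> e\<rbrakk> \<Longrightarrow> transport c e i = j"
  using theI'[OF transport_unique[OF assms]] transport_unique[OF assms]
  unfolding transport_def by (blast, blast, blast)

text \<open>This makes \<open>(e, i) \<mapsto> transport c e i\<close> multiplicative on the direct
  product of the semilattice and the image part of \<open>c\<close>. The right side lies in the
  image part of \<open>e \<otimes> f\<close> and satisfies the equation that determines the left
  side.\<close>

lemma transport_mult:
  assumes c: "c \<in> idempotents S" and e: "e \<in> idempotents S" and f: "f \<in> idempotents S"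
    and i: "i \<in> image_part c" and i': "i' \<in> image_part c"
  shows "transport c (e \<otimes> f) (i \<otimes> i') = transport c e i \<otimes> transport c f i'"
proof (rule transportD(3)[OF c])
  note J = local_subgroupD[OF image_part_local_subgroup]
  have ef: "e \<otimes> f \<in> idempotents S" using e f by (rule idempotents_mult_closed)
  then show "e \<otimes> f \<in> idempotents S" .
  show "i \<otimes> i' \<in> image_part c" using J(5)[OF c i i'] .
  let ?L = "transport c e i" and ?M = "transport c f i'"
  have L: "?L \<in> image_part e" "?L \<otimes> c = i \<otimes> e" and M: "?M \<in> image_part f" "?M \<otimes> c = i' \<otimes> f"
    using transportD(1,2)[OF c e i] transportD(1,2)[OF c f i'] by simp_all
  note cl = J(4)[OF e L(1)] J(4)[OF f M(1)] J(4)[OF c i] J(4)[OF c i'] idempotents_closed[OF c]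
    idempotents_closed[OF e] idempotents_closed[OF f]
  have "?L \<otimes> (e \<otimes> f) \<in> image_part (e \<otimes> f)"
    using image_part_restrict_surj[OF e ef mult_idempotent_absorb(1)[OF e f]] L(1) by blast
  moreover have "?M \<otimes> (e \<otimes> f) \<in> image_part (e \<otimes> f)"
    using image_part_restrict_surj[OF f ef mult_idempotent_absorb(2)[OF e f]] M(1) by blast
  ultimately have "(?L \<otimes> (e \<otimes> f)) \<otimes> (?M \<otimes> (e \<otimes> f)) \<in> image_part (e \<otimes> f)"
    using J(5)[OF ef] by simp
  then have LM: "(?L \<otimes> ?M) \<otimes> (e \<otimes> f) \<in> image_part (e \<otimes> f)"
    using restrict_mult[OF ef cl(1,2)] by simp
  have "(?L \<otimes> ?M) \<otimes> (e \<otimes> f) = ?L \<otimes> (?M \<otimes> e) \<otimes> f" using cl by (simp add: mult_assoc)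
  also have "\<dots> = (?L \<otimes> e) \<otimes> (?M \<otimes> f)" using cl by (simp add: central[OF cl(2) e] mult_assoc)
  also have "\<dots> = ?L \<otimes> ?M" using J(8)[OF e L(1)] J(8)[OF f M(1)] by simp
  finally show "?L \<otimes> ?M \<in> image_part (e \<otimes> f)" using LM by simp
  have "(?L \<otimes> ?M) \<otimes> c = (?L \<otimes> c) \<otimes> (?M \<otimes> c)" using restrict_mult[OF c cl(1,2)] by simp
  also have "\<dots> = i \<otimes> (e \<otimes> i') \<otimes> f" unfolding L(2) M(2) using cl by (simp add: mult_assoc)
  also have "\<dots> = (i \<otimes> i') \<otimes> (e \<otimes> f)" using cl by (simp add: mult_assoc flip: central[OF cl(4) e])
  finally show "(?L \<otimes> ?M) \<otimes> c = (i \<otimes> i') \<otimes> (e \<otimes> f)" .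
qed

lemma transport_inj:
  assumes c: "c \<in> idempotents S" and e: "e \<in> idempotents S"
    and i: "i \<in> image_part c" and i': "i' \<in> image_part c" and eq: "transport c e i = transport c e i'"
  shows "i = i'"
proof -
  note J = local_subgroupD[OF image_part_local_subgroup[OF c]]
  have ce: "c \<otimes> e \<in> idempotents S" using c e by (rule idempotents_mult_closed)
  have "i \<otimes> e = i' \<otimes> e" using transportD(2)[OF c e i] transportD(2)[OF c e i'] eq by simp
  moreover have "x \<otimes> (c \<otimes> e) = x \<otimes> e" if "x \<in> image_part c" for x
    using J(4,8)[OF that] idempotents_closed[OF c] idempotents_closed[OF e] by (simp flip: mult_assoc)
  ultimately show ?thesis
    using image_part_restrict_inj[OF c ce mult_idempotent_absorb(1)[OF c e]] i i' by (simp add: inj_on_def)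
qed

text \<open>The defining equation \<open>j \<otimes> c = i \<otimes> e\<close> is symmetric, so
  \<open>transport e c\<close> is the inverse map.\<close>

lemma transport_surj:
  assumes c: "c \<in> idempotents S" and e: "e \<in> idempotents S" and j: "j \<in> image_part e"
  obtains i where "i \<in> image_part c" "transport c e i = j"
proof -
  let ?i = "transport e c j"
  have i: "?i \<in> image_part c" "?i \<otimes> e = j \<otimes> c" using transportD(1,2)[OF e c j] by simp_all
  have "transport c e ?i = j" using transportD(3)[OF c e i(1) j] i(2) by simp
  then show thesis using that i(1) by simp
qed

text \<open>Over each idempotent \<open>e\<close> the map \<open>\<Psi>\<close> is the factorisation
  of the group of \<open>e\<close> into its two parts, read through \<open>transport\<close> and
  \<open>\<tau>\<close> from the parts at the base idempotent \<open>c\<close>.\<close>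

lemma spined_product_iso:
  assumes c: "c \<in> idempotents S"
  shows "S \<cong> spined_product (S\<lparr>carrier := idempotents S\<rparr> \<times>\<times> group_on c (image_part c))
    (sl_group (S\<lparr>carrier := idempotents S\<rparr>) (group_on c (kernel_part c)))"
proof -
  let ?Y = "S\<lparr>carrier := idempotents S\<rparr>"
  let ?I = "group_on c (image_part c)" and ?K = "group_on c (kernel_part c)"
  interpret F: spined_factors ?Y ?I ?K
    unfolding spined_factors_def
    using idempotents_alg_semilattice group_group_on[OF image_part_local_subgroup[OF c]]
      group_group_on[OF kernel_part_local_subgroup[OF c]] by simp
  note J = local_subgroupD[OF image_part_local_subgroup]
  note K = local_subgroupD[OF kernel_part_local_subgroup]
  \<comment> \<open>Any automorphism taking \<open>c\<close> to \<open>e\<close> will do: kernel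
    elements become trivial below their own idempotent, so the choices for different
    \<open>e\<close> need not fit together.\<close>
  define \<tau> where "\<tau> e = (SOME \<theta>. \<theta> \<in> iso S S \<and> \<theta> c = e)" for e
  have \<tau>: "\<tau> e \<in> iso S S" "\<tau> e c = e" if e: "e \<in> idempotents S" for e
  proof -
    obtain \<theta> where "\<theta> \<in> iso S S" "\<theta> c = e" using extend_idempotent c e by metis
    then have "\<exists>\<theta>. \<theta> \<in> iso S S \<and> \<theta> c = e" by blast
    from someI_ex[OF this] show "\<tau> e \<in> iso S S" "\<tau> e c = e" by (simp_all add: \<tau>_def)
  qed
  have \<tau>_kernel: "\<tau> e k \<in> kernel_part e" if e: "e \<in> idempotents S" "k \<in> kernel_part c" for e k
    using aut_kernel_part[OF \<tau>(1)[OF e(1)] c e(2)] \<tau>(2)[OF e(1)] by simp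
  have \<tau>_mult: "\<tau> e (k \<otimes> l) = \<tau> e k \<otimes> \<tau> e l"
    if e: "e \<in> idempotents S" "k \<in> kernel_part c" "l \<in> kernel_part c" for e k l
    using isoD(2)[OF \<tau>(1)[OF e(1)] K(4)[OF c e(2)] K(4)[OF c e(3)]] .
  have \<tau>_inj: "inj_on (\<tau> e) (kernel_part c)" if e: "e \<in> idempotents S" for e
    using isoD(3)[OF \<tau>(1)[OF e]] parts_closed(2)[OF c] by (rule inj_on_subset)
  have \<tau>_surj: "\<tau> e ` kernel_part c = kernel_part e" if e: "e \<in> idempotents S" for e
  proof (rule card_seteq)
    show "finite (kernel_part e)" using finite_parts e by simp
    show "\<tau> e ` kernel_part c \<subseteq> kernel_part e" using \<tau>_kernel[OF e] by blast
    show "card (kernel_part e) \<le> card (\<tau> e ` kernel_part c)"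
      using card_image[OF \<tau>_inj[OF e]] card_image_part_le(2)[OF e c] by simp
  qed
  define \<Psi> :: "('a \<times> 'a) \<times> ('a \<times> 'a) \<Rightarrow> 'a"
    where "\<Psi> = (\<lambda>((e, i), (f, k)). transport c e i \<otimes> \<tau> e k)"
  have \<Psi>: "\<Psi> ((e, i), (f, k)) = transport c e i \<otimes> \<tau> e k" for e i f k
    by (simp add: \<Psi>_def)
  have carrier_P: "x \<in> carrier F.P \<longleftrightarrow> (\<exists>e \<in> idempotents S. \<exists>i \<in> image_part c. \<exists>k \<in> kernel_part c. x = ((e, i), (e, k)))"
    for x by (simp add: F.carrier_P)
  have \<Psi>_H: "\<Psi> ((e, i), (e, k)) \<in> H_class S e"
    if "e \<in> idempotents S" "i \<in> image_part c" "k \<in> kernel_part c" for e i k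
    using H_classD(3)[OF that(1) J(3)[OF that(1) transportD(1)[OF c that(1,2)]]
        K(3)[OF that(1) \<tau>_kernel[OF that(1,3)]]] by (simp add: \<Psi>)
  have "\<Psi> \<in> iso F.P S"
  proof (rule isoI)
    fix x assume "x \<in> carrier F.P"
    then obtain e i k where x: "e \<in> idempotents S" "i \<in> image_part c" "k \<in> kernel_part c"
      "x = ((e, i), (e, k))" unfolding carrier_P by blast
    show "\<Psi> x \<in> carrier S" using H_classD(2)[OF x(1) \<Psi>_H[OF x(1-3)]] x(4) by simp
    fix y assume "y \<in> carrier F.P"
    then obtain f j l where y: "f \<in> idempotents S" "j \<in> image_part c" "l \<in> kernel_part c"
      "y = ((f, j), (f, l))" unfolding carrier_P by blast
    let ?g = "e \<otimes> f"
    have g: "?g \<in> idempotents S" using idempotents_mult_closed[OF x(1) y(1)] .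
    note ab = mult_idempotent_absorb[OF x(1) y(1)]
    define L where "L = transport c e i"
    define M where "M = transport c f j"
    have LM: "L \<in> image_part e" "M \<in> image_part f"
      using transportD(1)[OF c x(1,2)] transportD(1)[OF c y(1,2)] by (simp_all add: L_def M_def)
    note cl = J(4)[OF x(1) LM(1)] J(4)[OF y(1) LM(2)] K(4)[OF x(1) \<tau>_kernel[OF x(1,3)]]
      K(4)[OF y(1) \<tau>_kernel[OF y(1,3)]] idempotents_closed[OF g]
    have Mg: "M \<otimes> ?g \<in> image_part ?g"
      using image_part_restrict_surj[OF y(1) g ab(2)] LM(2) by blast
    \<comment> \<open>Restricted to \<open>?g\<close>, a kernel element either stays unchanged or
      becomes trivial, just as \<open>K\<close>-components do in the spined product. The default
      \<open>c\<close> is the identity of the kernel part at \<open>c\<close>.\<close>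
    have restr: "\<tau> h m \<otimes> ?g = \<tau> ?g (if ?g = h then m else c)"
      if h: "h \<in> idempotents S" "?g \<otimes> h = ?g" "m \<in> kernel_part c" for h m
    proof (cases "?g = h")
      case True
      then show ?thesis using K(8)[OF h(1) \<tau>_kernel[OF h(1,3)]] by simp
    next
      case False
      then have "sl_less S ?g h" using h(2) by (simp add: sl_less_def)
      then show ?thesis
        using kernel_part_restrict[OF h(1) g _ \<tau>_kernel[OF h(1,3)]] False \<tau>(2)[OF g] by simp
    qed
    let ?k = "if ?g = e then k else c" and ?l = "if ?g = f then l else c"
    have kl: "?k \<in> kernel_part c" "?l \<in> kernel_part c"
      using x(3) y(3) K(2)[OF c] by simp_all
    have kg: "\<tau> ?g ?k \<in> carrier S" "\<tau> ?g ?l \<in> carrier S"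
      using K(4)[OF g \<tau>_kernel[OF g kl(1)]] K(4)[OF g \<tau>_kernel[OF g kl(2)]] .
    have xg: "x \<in> H_class S ?g \<Longrightarrow> x \<otimes> ?g = x" for x using H_classD(6)[OF g] .
    \<comment> \<open>Both factors are pushed into the group of \<open>?g\<close>, where image and
      kernel elements commute and can be collected.\<close>
    have "\<Psi> x \<otimes> \<Psi> y = (L \<otimes> \<tau> e k) \<otimes> (M \<otimes> \<tau> f l)"
      unfolding x(4) y(4) \<Psi> L_def M_def ..
    also have "\<dots> = ((L \<otimes> \<tau> e k) \<otimes> (M \<otimes> \<tau> f l)) \<otimes> ?g"
    proof -
      have "(L \<otimes> \<tau> e k) \<otimes> (M \<otimes> \<tau> f l) \<in> H_class S ?g"
      proof -
        have "\<Psi> x \<in> H_class S e" "\<Psi> y \<in> H_class S f" using \<Psi>_H x y by simp_all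
        then have "unit_of (\<Psi> x \<otimes> \<Psi> y) = ?g" "\<Psi> x \<otimes> \<Psi> y \<in> carrier S"
          using x(1) y(1) by (simp_all add: H_class_iff unit_of_mult)
        then have "\<Psi> x \<otimes> \<Psi> y \<in> H_class S ?g" using g by (simp add: H_class_iff)
        then show ?thesis unfolding x(4) y(4) \<Psi> L_def M_def .
      qed
      from H_classD(6)[OF g this] show ?thesis by (rule sym)
    qed
    also have "\<dots> = (((L \<otimes> ?g) \<otimes> (\<tau> e k \<otimes> ?g)) \<otimes> ((M \<otimes> ?g) \<otimes> (\<tau> f l \<otimes> ?g)))"
      using cl by (simp add: restrict_mult[OF g])
    also have "\<dots> = ((L \<otimes> ?g) \<otimes> \<tau> ?g ?k) \<otimes> ((M \<otimes> ?g) \<otimes> \<tau> ?g ?l)"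
      using restr[OF x(1) ab(1) x(3)] restr[OF y(1) ab(2) y(3)] by simp
    also have "\<dots> = (L \<otimes> ?g) \<otimes> (\<tau> ?g ?k \<otimes> (M \<otimes> ?g)) \<otimes> \<tau> ?g ?l"
      using cl kg by (simp add: mult_assoc)
    also have "\<dots> = (L \<otimes> ?g) \<otimes> ((M \<otimes> ?g) \<otimes> \<tau> ?g ?k) \<otimes> \<tau> ?g ?l"
      using image_kernel_commute[OF g Mg \<tau>_kernel[OF g kl(1)]] by simp
    also have "\<dots> = ((L \<otimes> ?g) \<otimes> (M \<otimes> ?g)) \<otimes> (\<tau> ?g ?k \<otimes> \<tau> ?g ?l)"
      using cl kg by (simp add: mult_assoc)
    also have "(L \<otimes> ?g) \<otimes> (M \<otimes> ?g) = transport c ?g (i \<otimes> j)"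
    proof -
      have *: "transport c ?g (i \<otimes> j) = L \<otimes> M"
        using transport_mult[OF c x(1) y(1) x(2) y(2)] by (simp add: L_def M_def)
      have "transport c ?g (i \<otimes> j) \<in> image_part ?g"
        using transportD(1)[OF c g J(5)[OF c x(2) y(2)]] .
      from J(8)[OF g this] show ?thesis
        using restrict_mult[OF g cl(1,2)] * by simp
    qed
    also have "\<tau> ?g ?k \<otimes> \<tau> ?g ?l = \<tau> ?g (?k \<otimes> ?l)"
      using \<tau>_mult[OF g kl] by simp
    also have "transport c ?g (i \<otimes> j) \<otimes> \<tau> ?g (?k \<otimes> ?l) = \<Psi> (x \<otimes>\<^bsub>F.P\<^esub> y)"
      using F.mult_P[of e f k l i j] x y by (simp add: \<Psi>)
    finally show "\<Psi> (x \<otimes>\<^bsub>F.P\<^esub> y) = \<Psi> x \<otimes> \<Psi> y" by (rule sym)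
  next
    show "inj_on \<Psi> (carrier F.P)"
    proof (rule inj_onI)
      fix x y assume "x \<in> carrier F.P" "y \<in> carrier F.P" and eq: "\<Psi> x = \<Psi> y"
      then obtain e i k f j l where x: "e \<in> idempotents S" "i \<in> image_part c" "k \<in> kernel_part c"
        "x = ((e, i), (e, k))" and y: "f \<in> idempotents S" "j \<in> image_part c" "l \<in> kernel_part c"
        "y = ((f, j), (f, l))" unfolding carrier_P by blast
      have ef: "f = e"
        using \<Psi>_H[OF x(1-3)] \<Psi>_H[OF y(1-3)] eq x(1,4) y(1,4) H_class_unique[of "\<Psi> x" e f] by simp
      have "transport c e i \<otimes> \<tau> e k = transport c e j \<otimes> \<tau> e l"
        using eq x(4) y(4) ef by (simp add: \<Psi>)
      note * = image_kernel_unique[OF x(1) transportD(1)[OF c x(1,2)] transportD(1)[OF c x(1) y(2)]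
          \<tau>_kernel[OF x(1,3)] \<tau>_kernel[OF x(1) y(3)] this]
      have "i = j" using transport_inj[OF c x(1,2) y(2) *(1)] .
      moreover have "k = l" using inj_onD[OF \<tau>_inj[OF x(1)] *(2) x(3) y(3)] .
      ultimately show "x = y" using x(4) y(4) ef by simp
    qed
    show "carrier S \<subseteq> \<Psi> ` carrier F.P"
    proof
      fix s assume s: "s \<in> carrier S"
      let ?e = "unit_of s"
      have e: "?e \<in> idempotents S" using unit_of_idempotent[OF s] .
      then have "s \<in> H_class S ?e" using s by (simp add: H_class_iff)
      then obtain j k where jk: "j \<in> image_part ?e" "k \<in> kernel_part ?e" "s = j \<otimes> k"
        using image_kernel_factor[OF e] by metis
      obtain i where i: "i \<in> image_part c" "transport c ?e i = j"
        using transport_surj[OF c e jk(1)] by metis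
      obtain l where l: "l \<in> kernel_part c" "\<tau> ?e l = k"
        using \<tau>_surj[OF e] jk(2) by (metis imageE)
      have "s = \<Psi> ((?e, i), (?e, l))" unfolding \<Psi> i(2) l(2) by (rule jk(3))
      moreover have "((?e, i), (?e, l)) \<in> carrier F.P" unfolding carrier_P using e i(1) l(1) by simp
      ultimately show "s \<in> \<Psi> ` carrier F.P" by (rule image_eqI)
    qed
  qed
  then have "inv_into (carrier F.P) \<Psi> \<in> iso S F.P"
    by (rule alg_semigroup.iso_set_inv[OF F.alg_semigroup_P])
  then show ?thesis unfolding is_iso_def by blast
qed

end

text \<open>Any idempotent serves as the base point for the two groups.\<close>

lemma HIS_structure:
  fixes S :: "'s monoid"
  assumes "HIS S" "countable (carrier S)" "finite_maximal_subgroups S"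
  obtains Y I K :: "'s monoid" where "homogeneous_semilattice Y" "countable (carrier Y)"
    "homogeneous_group I" "finite (carrier I)" "homogeneous_group K" "finite (carrier K)"
    "coprime_orders I K" "S \<cong> spined_product (Y \<times>\<times> I) (sl_group Y K)"
proof -
  interpret inverse_semigroup S using assms(1) by (simp add: HIS_def)
  interpret finite_HIS S
    by unfold_locales (use assms in \<open>simp_all add: finite_maximal_subgroups_def\<close>)
  obtain x where "x \<in> carrier S" using carrier_nonempty by blast
  then have c: "unit_of x \<in> idempotents S" by (rule unit_of_idempotent)
  show thesis
    by (rule that[OF homogeneous_idempotents _ homogeneous_parts(1)[OF c] _ homogeneous_parts(2)[OF c] _
          coprime_parts[OF c] spined_product_iso[OF c]])
      (use assms(2) finite_parts[OF c] idempotents_closed in \<open>auto intro: countable_subset\<close>)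
qed

section \<open>Spined products are homogeneous inverse semigroups\<close>

lemma coprime_orders_sym: "coprime_orders G H \<Longrightarrow> coprime_orders H G"
  unfolding coprime_orders_def by metis

text \<open>Every divisor of the order of an element is the order of one of its powers, so the gcd
  of two orders occurs as an order in both groups.\<close>

lemma coprime_ord:
  assumes "group G" "finite (carrier G)" "group H" "finite (carrier H)" "coprime_orders G H"
    and x: "x \<in> carrier G" and y: "y \<in> carrier H"
  shows "coprime (group.ord G x) (group.ord H y)"
proof -
  interpret G: group G by fact
  interpret H: group H by fact
  let ?d = "gcd (G.ord x) (H.ord y)"
  have pos: "G.ord x > 0" "H.ord y > 0"
    using G.ord_ge_1[OF assms(2) x] H.ord_ge_1[OF assms(4) y] by simp_all
  have div: "m div (m div d) = d" if "m > 0" "d dvd m" for m d :: nat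
    using that by (auto elim!: dvdE)
  have dvd: "(m div d) dvd m" "m div d \<noteq> 0" if "m > 0" "d dvd m" for m d :: nat
    using that by (auto elim!: dvdE)
  have 1: "G.ord (x [^]\<^bsub>G\<^esub> (G.ord x div ?d)) = ?d"
    using G.ord_pow[OF x dvd[OF pos(1) gcd_dvd1]] div[OF pos(1) gcd_dvd1] by simp
  have 2: "H.ord (y [^]\<^bsub>H\<^esub> (H.ord y div ?d)) = ?d"
    using H.ord_pow[OF y dvd[OF pos(2) gcd_dvd2]] div[OF pos(2) gcd_dvd2] by simp
  have "?d = 1"
    using assms(5) x y 1 2 unfolding coprime_orders_def
    by (metis G.nat_pow_closed H.nat_pow_closed)
  then show ?thesis by (simp add: coprime_iff_gcd_eq_1)
qed

lemma separating_exponent: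
  assumes "group G" "finite (carrier G)" "group H" "finite (carrier H)" "coprime_orders G H"
  obtains n where "\<And>x. x \<in> carrier G \<Longrightarrow> spow G x n = x" "\<And>y. y \<in> carrier H \<Longrightarrow> spow H y n = \<one>\<^bsub>H\<^esub>"
proof -
  interpret G: group G by fact
  interpret H: group H by fact
  define g where "g = (\<Prod>x \<in> carrier G. G.ord x)"
  define h where "h = (\<Prod>y \<in> carrier H. H.ord y)"
  have "coprime g h"
    unfolding g_def h_def by (intro prod_coprime_left prod_coprime_right coprime_ord[OF assms])
  moreover have "h > 0"
    unfolding h_def using H.ord_ge_1[OF assms(4)] by (auto intro!: prod_pos simp: Suc_le_eq)
  \<comment> \<open>\<open>g\<close> and \<open>h\<close> are multiples of all orders in
    \<open>G\<close> and in \<open>H\<close>. The exponent \<open>g * n + 1 = h * x\<close> is 1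
    modulo the former and 0 modulo the latter; its \<open>spow\<close> index is
    \<open>g * n\<close>.\<close>
  ultimately obtain x n where n: "h * x = g * n + 1"
    using bezout_add_strong_nat[of h g] by (metis coprime_common_divisor_nat neq0_conv)
  show thesis
  proof (rule that)
    fix z assume z: "z \<in> carrier H"
    have "H.ord z dvd h" unfolding h_def using assms(4) z by (rule dvd_prodI)
    then have "H.ord z dvd Suc (g * n)" using n by (metis Suc_eq_plus1 dvd_mult2)
    then show "spow H z (g * n) = \<one>\<^bsub>H\<^esub>" using z H.pow_eq_id H.spow_eq_pow by metis
  next
    fix z assume z: "z \<in> carrier G"
    have "G.ord z dvd g" unfolding g_def using assms(2) z by (rule dvd_prodI)
    then have "z [^]\<^bsub>G\<^esub> (g * n) = \<one>\<^bsub>G\<^esub>" using z by (simp add: G.pow_eq_id)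
    then show "spow G z (g * n) = z" using z by (simp add: G.spow_eq_pow)
  qed
qed

lemma extend_subgroup_iso:
  assumes G: "homogeneous_group G" and "finite (carrier G)" and "subgroup H G" "subgroup L G"
    and "\<psi> \<in> iso (G\<lparr>carrier := H\<rparr>) (G\<lparr>carrier := L\<rparr>)"
  obtains \<theta> where "\<theta> \<in> iso G G" "\<And>x. x \<in> H \<Longrightarrow> \<theta> x = \<psi> x"
proof -
  interpret group G using G by (simp add: homogeneous_group_def)
  have gen: "generate G M = M" if "subgroup M G" for M
    using generateI[OF that, of M] by simp
  have "finite H" "H \<subseteq> carrier G" "finite L" "L \<subseteq> carrier G"
    using assms(2-4) subgroup.subset finite_subset by blast+
  then have "isos_extend G (generate G H) (generate G L)"
    using G unfolding homogeneous_group_def by simp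
  then have "\<exists>\<theta> \<in> iso G G. \<forall>x \<in> H. \<theta> x = \<psi> x"
    using assms(5) unfolding isos_extend_def gen[OF assms(3)] gen[OF assms(4)] by simp
  then show thesis using that by (elim bexE) simp
qed

lemma inj_on_imageI_eq:
  "(\<And>x y. \<lbrakk>x \<in> T; y \<in> T; f (g x) = f (g y)\<rbrakk> \<Longrightarrow> g x = g y) \<Longrightarrow> inj_on f (g ` T)"
  unfolding inj_on_def by blast

abbreviation Y_of :: "('y \<times> 'i) \<times> ('y \<times> 'k) \<Rightarrow> 'y" where "Y_of x \<equiv> fst (fst x)"
abbreviation I_of :: "('y \<times> 'i) \<times> ('y \<times> 'k) \<Rightarrow> 'i" where "I_of x \<equiv> snd (fst x)"
abbreviation K_of :: "('y \<times> 'i) \<times> ('y \<times> 'k) \<Rightarrow> 'k" where "K_of x \<equiv> snd (snd x)"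

locale HIS_factors = spined_factors +
  assumes homogeneous_Y: "homogeneous_semilattice Y"
    and homogeneous_I: "homogeneous_group I" and finite_I: "finite (carrier I)"
    and homogeneous_K: "homogeneous_group K" and finite_K: "finite (carrier K)"
    and coprime: "coprime_orders I K"
begin

sublocale P: clifford_semigroup P
  by (rule clifford_semigroup_P)

lemma carrier_P_decomp:
  assumes "x \<in> carrier P"
  shows "x = ((Y_of x, I_of x), (Y_of x, K_of x))" "Y_of x \<in> carrier Y" "I_of x \<in> carrier I"
    "K_of x \<in> carrier K"
  using assms unfolding carrier_P by auto

lemma P_eqI:
  "\<lbrakk>x \<in> carrier P; y \<in> carrier P; Y_of x = Y_of y; I_of x = I_of y; K_of x = K_of y\<rbrakk> \<Longrightarrow> x = y"
  using carrier_P_decomp(1)[of x] carrier_P_decomp(1)[of y] by simp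

lemma components_mult:
  assumes "x \<in> carrier P" "y \<in> carrier P"
  shows "Y_of (x \<otimes>\<^bsub>P\<^esub> y) = Y_of x \<otimes>\<^bsub>Y\<^esub> Y_of y" "I_of (x \<otimes>\<^bsub>P\<^esub> y) = I_of x \<otimes>\<^bsub>I\<^esub> I_of y"
    and "K_of (x \<otimes>\<^bsub>P\<^esub> y) = (if Y_of x \<otimes>\<^bsub>Y\<^esub> Y_of y = Y_of x then K_of x else \<one>\<^bsub>K\<^esub>)
      \<otimes>\<^bsub>K\<^esub> (if Y_of x \<otimes>\<^bsub>Y\<^esub> Y_of y = Y_of y then K_of y else \<one>\<^bsub>K\<^esub>)"
  using assms unfolding carrier_P by (auto simp: mult_P)

lemma components_sinv:
  assumes "x \<in> carrier P"
  shows "Y_of (sinv P x) = Y_of x" "I_of (sinv P x) = inv\<^bsub>I\<^esub> (I_of x)" "K_of (sinv P x) = inv\<^bsub>K\<^esub> (K_of x)"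
  using assms unfolding carrier_P by (auto simp: sinv_P)

lemma spow_P:
  assumes "a \<in> carrier Y" "i \<in> carrier I" "k \<in> carrier K"
  shows "spow P ((a, i), (a, k)) n = ((a, spow I i n), (a, spow K k n))"
proof (induct n)
  case (Suc n)
  have "spow I i n \<in> carrier I" "spow K k n \<in> carrier K"
    using assms by (auto intro!: spow_mem)
  then show ?case using Suc assms by (simp add: mult_P_same)
qed simp

definition I_proj where "I_proj x = ((Y_of x, I_of x), (Y_of x, \<one>\<^bsub>K\<^esub>))"
definition K_proj where "K_proj x = ((Y_of x, \<one>\<^bsub>I\<^esub>), (Y_of x, K_of x))"
definition Y_proj where "Y_proj x = ((Y_of x, \<one>\<^bsub>I\<^esub>), (Y_of x, \<one>\<^bsub>K\<^esub>))"

text \<open>Since the orders are coprime, the projections are given by taking powers. Hence every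
  isomorphism between subsemigroups commutes with them.\<close>

lemma proj_spow:
  obtains p q where "\<And>x. x \<in> carrier P \<Longrightarrow> I_proj x = spow P x p"
    "\<And>x. x \<in> carrier P \<Longrightarrow> K_proj x = spow P x q"
proof -
  obtain p where p: "\<And>x. x \<in> carrier I \<Longrightarrow> spow I x p = x" "\<And>y. y \<in> carrier K \<Longrightarrow> spow K y p = \<one>\<^bsub>K\<^esub>"
    using separating_exponent[OF I.group_axioms finite_I K.group_axioms finite_K coprime] by metis
  obtain q where q: "\<And>x. x \<in> carrier K \<Longrightarrow> spow K x q = x" "\<And>y. y \<in> carrier I \<Longrightarrow> spow I y q = \<one>\<^bsub>I\<^esub>"
    using separating_exponent[OF K.group_axioms finite_K I.group_axioms finite_I coprime_orders_sym[OF coprime]]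
    by metis
  show thesis
  proof (rule that[of p q])
    fix x assume x: "x \<in> carrier P"
    then obtain a i k where x: "a \<in> carrier Y" "i \<in> carrier I" "k \<in> carrier K" "x = ((a, i), (a, k))"
      unfolding carrier_P by blast
    show "I_proj x = spow P x p"
      unfolding x(4) spow_P[OF x(1-3)] p(1)[OF x(2)] p(2)[OF x(3)] by (simp add: I_proj_def)
    show "K_proj x = spow P x q"
      unfolding x(4) spow_P[OF x(1-3)] q(2)[OF x(2)] q(1)[OF x(3)] by (simp add: K_proj_def)
  qed
qed

text \<open>Nonemptiness is included so that the \<open>I\<close>-components form a
  subgroup.\<close>

definition subsystem :: "(('a \<times> 'c) \<times> ('a \<times> 'e)) set \<Rightarrow> bool" where
  "subsystem T \<longleftrightarrow> T \<subseteq> carrier P \<and> T \<noteq> {} \<and> (\<forall>x \<in> T. \<forall>y \<in> T. x \<otimes>\<^bsub>P\<^esub> y \<in> T) \<and> (\<forall>x \<in> T. sinv P x \<in> T)"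

lemma subsystemD:
  assumes "subsystem T"
  shows "x \<in> T \<Longrightarrow> x \<in> carrier P" "\<lbrakk>x \<in> T; y \<in> T\<rbrakk> \<Longrightarrow> x \<otimes>\<^bsub>P\<^esub> y \<in> T" "x \<in> T \<Longrightarrow> sinv P x \<in> T" "T \<noteq> {}"
  using assms by (auto simp: subsystem_def)

lemma Y_proj_eq: "Y_proj x = K_proj (I_proj x)"
  by (simp add: Y_proj_def K_proj_def I_proj_def)

lemma proj_mem:
  assumes T: "subsystem T" and x: "x \<in> T"
  shows "I_proj x \<in> T" "K_proj x \<in> T" "Y_proj x \<in> T"
proof -
  obtain p q where pq: "\<And>x. x \<in> carrier P \<Longrightarrow> I_proj x = spow P x p" "\<And>x. x \<in> carrier P \<Longrightarrow> K_proj x = spow P x q"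
    using proj_spow by metis
  have 1: "I_proj y \<in> T" if y: "y \<in> T" for y
    using pq(1)[OF subsystemD(1)[OF T y]] spow_mem[of y T P p, OF y subsystemD(2)[OF T]] by simp
  have 2: "K_proj y \<in> T" if y: "y \<in> T" for y
    using pq(2)[OF subsystemD(1)[OF T y]] spow_mem[of y T P q, OF y subsystemD(2)[OF T]] by simp
  show "I_proj x \<in> T" "K_proj x \<in> T" using 1 2 x by simp_all
  then show "Y_proj x \<in> T" using 2 unfolding Y_proj_eq by simp
qed

lemma proj_iso:
  assumes T: "subsystem T" and U: "subsystem U"
    and \<phi>: "\<phi> \<in> iso (P\<lparr>carrier := T\<rparr>) (P\<lparr>carrier := U\<rparr>)" and x: "x \<in> T"
  shows "\<phi> (I_proj x) = I_proj (\<phi> x)" "\<phi> (K_proj x) = K_proj (\<phi> x)" "\<phi> (Y_proj x) = Y_proj (\<phi> x)"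
proof -
  obtain p q where pq: "\<And>x. x \<in> carrier P \<Longrightarrow> I_proj x = spow P x p" "\<And>x. x \<in> carrier P \<Longrightarrow> K_proj x = spow P x q"
    using proj_spow by metis
  have \<phi>U: "\<phi> y \<in> carrier P" if y: "y \<in> T" for y
    using isoD(1)[OF \<phi>, of y] y subsystemD(1)[OF U, of "\<phi> y"] by simp
  have 1: "\<phi> (I_proj y) = I_proj (\<phi> y)" if y: "y \<in> T" for y
    using pq(1)[OF subsystemD(1)[OF T y]] pq(1)[OF \<phi>U[OF y]] spow_hom[OF \<phi> y subsystemD(2)[OF T], of p] by simp
  have 2: "\<phi> (K_proj y) = K_proj (\<phi> y)" if y: "y \<in> T" for y
    using pq(2)[OF subsystemD(1)[OF T y]] pq(2)[OF \<phi>U[OF y]] spow_hom[OF \<phi> y subsystemD(2)[OF T], of q] by simp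
  show "\<phi> (I_proj x) = I_proj (\<phi> x)" "\<phi> (K_proj x) = K_proj (\<phi> x)" using 1 2 x by simp_all
  show "\<phi> (Y_proj x) = Y_proj (\<phi> x)"
    unfolding Y_proj_eq using 1[OF x] 2[OF proj_mem(1)[OF T x]] by simp
qed

text \<open>The extension is assembled from \<open>Y\<close>, from \<open>I\<close>, and from one
  copy of \<open>K\<close> for each point of \<open>Y\<close>. The part over \<open>Y\<close> enters
  as a hypothesis because it rests on finite generation, which is automatic for subgroups of the
  finite groups.\<close>

lemma subsystem_extend:
  assumes T: "subsystem T" and U: "subsystem U"
    and \<phi>: "\<phi> \<in> iso (P\<lparr>carrier := T\<rparr>) (P\<lparr>carrier := U\<rparr>)"
    and ext_Y: "isos_extend Y (Y_of ` T) (Y_of ` U)"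
  shows "\<exists>\<theta> \<in> iso P P. \<forall>x \<in> T. \<theta> x = \<phi> x"
proof -
  have TP: "x \<in> carrier P" if "x \<in> T" for x using subsystemD(1)[OF T that] .
  have UP: "x \<in> carrier P" if "x \<in> U" for x using subsystemD(1)[OF U that] .
  have \<phi>_mem: "\<phi> x \<in> U" if "x \<in> T" for x using isoD(1)[OF \<phi>, of x] that by simp
  have \<phi>_mult: "\<phi> (x \<otimes>\<^bsub>P\<^esub> y) = \<phi> x \<otimes>\<^bsub>P\<^esub> \<phi> y" if "x \<in> T" "y \<in> T" for x y
    using isoD(2)[OF \<phi>, of x y] that by simp
  have \<phi>_eq: "\<phi> x = \<phi> y \<longleftrightarrow> x = y" if "x \<in> T" "y \<in> T" for x y
    using isoD(3)[OF \<phi>] that by (simp add: inj_on_eq_iff)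
  have \<phi>_surj: "\<phi> ` T = U" using isoD(4)[OF \<phi>] by simp
  note proj = proj_iso[OF T U \<phi>]

  \<comment> \<open>Equality of components is expressed by an equation in the semigroup, which
    \<open>\<phi>\<close> preserves and reflects; this makes the component maps well defined and
    injective.\<close>
  have Y_iff: "Y_of (\<phi> x) = Y_of (\<phi> y) \<longleftrightarrow> Y_of x = Y_of y" if xy: "x \<in> T" "y \<in> T" for x y
  proof -
    have "Y_of (\<phi> x) = Y_of (\<phi> y) \<longleftrightarrow> \<phi> (Y_proj x) = \<phi> (Y_proj y)"
      unfolding proj(3)[OF xy(1)] proj(3)[OF xy(2)] by (simp add: Y_proj_def)
    also have "\<dots> \<longleftrightarrow> Y_proj x = Y_proj y" using \<phi>_eq proj_mem(3)[OF T] xy by simp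
    finally show ?thesis by (simp add: Y_proj_def)
  qed
  have I_iff: "I_of (\<phi> x) = I_of (\<phi> y) \<longleftrightarrow> I_of x = I_of y" if xy: "x \<in> T" "y \<in> T" for x y
  proof -
    \<comment> \<open>Each element is multiplied by the idempotent of the other, so that both
      products lie over the same point of \<open>Y\<close> and differ at most in the
      \<open>I\<close>-component.\<close>
    let ?z = "I_proj x \<otimes>\<^bsub>P\<^esub> Y_proj y" and ?w = "Y_proj x \<otimes>\<^bsub>P\<^esub> I_proj y"
    have mem: "I_proj x \<in> T" "Y_proj y \<in> T" "Y_proj x \<in> T" "I_proj y \<in> T"
      using proj_mem[OF T] xy by simp_all
    have *: "I_proj u \<otimes>\<^bsub>P\<^esub> Y_proj v = Y_proj u \<otimes>\<^bsub>P\<^esub> I_proj v \<longleftrightarrow> I_of u = I_of v"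
      if "u \<in> carrier P" "v \<in> carrier P" for u v
      using that unfolding carrier_P by (auto simp: I_proj_def Y_proj_def mult_P)
    have "I_of (\<phi> x) = I_of (\<phi> y) \<longleftrightarrow> \<phi> ?z = \<phi> ?w"
      using *[OF UP[OF \<phi>_mem[OF xy(1)]] UP[OF \<phi>_mem[OF xy(2)]]] proj[OF xy(1)] proj[OF xy(2)] mem
      by (simp add: \<phi>_mult)
    also have "\<dots> \<longleftrightarrow> ?z = ?w" using \<phi>_eq subsystemD(2)[OF T] mem by simp
    finally show ?thesis using *[OF TP[OF xy(1)] TP[OF xy(2)]] by simp
  qed
  \<comment> \<open>The points must agree here: \<open>K\<close>-components over different points
    are unrelated, and \<open>\<phi>\<close> induces a separate map for each.\<close>
  have K_iff: "K_of (\<phi> x) = K_of (\<phi> y) \<longleftrightarrow> K_of x = K_of y" if xy: "x \<in> T" "y \<in> T" "Y_of x = Y_of y" for x y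
  proof -
    have "K_of (\<phi> x) = K_of (\<phi> y) \<longleftrightarrow> \<phi> (K_proj x) = \<phi> (K_proj y)"
      unfolding proj(2)[OF xy(1)] proj(2)[OF xy(2)] using Y_iff[OF xy(1,2)] xy(3) by (simp add: K_proj_def)
    also have "\<dots> \<longleftrightarrow> K_proj x = K_proj y" using \<phi>_eq proj_mem(2)[OF T] xy by simp
    finally show ?thesis using xy(3) by (simp add: K_proj_def)
  qed

  \<comment> \<open>By \<open>Y_iff\<close> the chosen preimage does not matter; the same device
    gives \<open>\<phi>I\<close> and \<open>\<phi>K\<close>.\<close>
  define \<phi>Y where "\<phi>Y a = Y_of (\<phi> (SOME x. x \<in> T \<and> Y_of x = a))" for a
  have \<phi>Y: "\<phi>Y (Y_of x) = Y_of (\<phi> x)" if x: "x \<in> T" for x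
  proof -
    have "(SOME y. y \<in> T \<and> Y_of y = Y_of x) \<in> T \<and> Y_of (SOME y. y \<in> T \<and> Y_of y = Y_of x) = Y_of x"
      by (rule someI[of "\<lambda>y. y \<in> T \<and> Y_of y = Y_of x" x]) (simp add: x)
    then show ?thesis unfolding \<phi>Y_def using Y_iff x by blast
  qed
  have "\<phi>Y \<in> iso (Y\<lparr>carrier := Y_of ` T\<rparr>) (Y\<lparr>carrier := Y_of ` U\<rparr>)"
  proof (rule iso_carrierI)
    fix a b assume "a \<in> Y_of ` T" "b \<in> Y_of ` T"
    then obtain x y where xy: "x \<in> T" "y \<in> T" "a = Y_of x" "b = Y_of y" by blast
    show "\<phi>Y a \<in> Y_of ` U" using xy(1,3) \<phi>Y \<phi>_mem by simp
    have "\<phi>Y (Y_of (x \<otimes>\<^bsub>P\<^esub> y)) = Y_of (\<phi> x \<otimes>\<^bsub>P\<^esub> \<phi> y)"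
      using \<phi>Y[OF subsystemD(2)[OF T xy(1,2)]] \<phi>_mult[OF xy(1,2)] by simp
    then show "\<phi>Y (a \<otimes>\<^bsub>Y\<^esub> b) = \<phi>Y a \<otimes>\<^bsub>Y\<^esub> \<phi>Y b"
      unfolding components_mult(1)[OF TP[OF xy(1)] TP[OF xy(2)]]
        components_mult(1)[OF UP[OF \<phi>_mem[OF xy(1)]] UP[OF \<phi>_mem[OF xy(2)]]]
      using xy \<phi>Y by simp
  next
    show "inj_on \<phi>Y (Y_of ` T)" by (rule inj_on_imageI_eq) (simp add: \<phi>Y Y_iff)
    have "Y_of ` U = \<phi>Y ` Y_of ` T"
      unfolding \<phi>_surj[symmetric] image_image by (rule image_cong) (simp_all add: \<phi>Y)
    then show "Y_of ` U \<subseteq> \<phi>Y ` Y_of ` T" by simp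
  qed
  then obtain \<theta>Y where \<theta>Y: "\<theta>Y \<in> iso Y Y" "\<And>x. x \<in> T \<Longrightarrow> \<theta>Y (Y_of x) = Y_of (\<phi> x)"
    using ext_Y \<phi>Y unfolding isos_extend_def by (metis imageI)

  define \<phi>I where "\<phi>I i = I_of (\<phi> (SOME x. x \<in> T \<and> I_of x = i))" for i
  have \<phi>I: "\<phi>I (I_of x) = I_of (\<phi> x)" if x: "x \<in> T" for x
  proof -
    have "(SOME y. y \<in> T \<and> I_of y = I_of x) \<in> T \<and> I_of (SOME y. y \<in> T \<and> I_of y = I_of x) = I_of x"
      by (rule someI[of "\<lambda>y. y \<in> T \<and> I_of y = I_of x" x]) (simp add: x)
    then show ?thesis unfolding \<phi>I_def using I_iff x by blast
  qed
  have I_sub: "subgroup (I_of ` V) I" if V: "subsystem V" for V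
  proof (rule I.subgroupI)
    show "I_of ` V \<subseteq> carrier I" using carrier_P_decomp(3) subsystemD(1)[OF V] by blast
    show "I_of ` V \<noteq> {}" using subsystemD(4)[OF V] by simp
    fix i j assume "i \<in> I_of ` V" "j \<in> I_of ` V"
    then obtain x y where xy: "x \<in> V" "y \<in> V" "i = I_of x" "j = I_of y" by blast
    show "inv\<^bsub>I\<^esub> i \<in> I_of ` V"
      using components_sinv(2)[OF subsystemD(1)[OF V xy(1)]] subsystemD(3)[OF V xy(1)] xy(3) by (metis imageI)
    show "i \<otimes>\<^bsub>I\<^esub> j \<in> I_of ` V"
      using components_mult(2)[OF subsystemD(1)[OF V xy(1)] subsystemD(1)[OF V xy(2)]]
        subsystemD(2)[OF V xy(1,2)] xy(3,4) by (metis imageI)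
  qed
  have "\<phi>I \<in> iso (I\<lparr>carrier := I_of ` T\<rparr>) (I\<lparr>carrier := I_of ` U\<rparr>)"
  proof (rule iso_carrierI)
    fix a b assume "a \<in> I_of ` T" "b \<in> I_of ` T"
    then obtain x y where xy: "x \<in> T" "y \<in> T" "a = I_of x" "b = I_of y" by blast
    show "\<phi>I a \<in> I_of ` U" using xy(1,3) \<phi>I \<phi>_mem by simp
    have "\<phi>I (I_of (x \<otimes>\<^bsub>P\<^esub> y)) = I_of (\<phi> x \<otimes>\<^bsub>P\<^esub> \<phi> y)"
      using \<phi>I[OF subsystemD(2)[OF T xy(1,2)]] \<phi>_mult[OF xy(1,2)] by simp
    then show "\<phi>I (a \<otimes>\<^bsub>I\<^esub> b) = \<phi>I a \<otimes>\<^bsub>I\<^esub> \<phi>I b"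
      unfolding components_mult(2)[OF TP[OF xy(1)] TP[OF xy(2)]]
        components_mult(2)[OF UP[OF \<phi>_mem[OF xy(1)]] UP[OF \<phi>_mem[OF xy(2)]]]
      using xy \<phi>I by simp
  next
    show "inj_on \<phi>I (I_of ` T)" by (rule inj_on_imageI_eq) (simp add: \<phi>I I_iff)
    have "I_of ` U = \<phi>I ` I_of ` T"
      unfolding \<phi>_surj[symmetric] image_image by (rule image_cong) (simp_all add: \<phi>I)
    then show "I_of ` U \<subseteq> \<phi>I ` I_of ` T" by simp
  qed
  then obtain \<theta>I where \<theta>I: "\<theta>I \<in> iso I I" "\<And>i. i \<in> I_of ` T \<Longrightarrow> \<theta>I i = \<phi>I i"
    using extend_subgroup_iso[OF homogeneous_I finite_I I_sub[OF T] I_sub[OF U]] by metis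

  \<comment> \<open>\<open>K_of\<close> is known to be multiplicative only among elements over one
    point, so subgroups of \<open>K\<close> arise fibrewise.\<close>
  define fiber where "fiber V a = K_of ` {x \<in> V. Y_of x = a}" for V :: "(('a \<times> 'c) \<times> 'a \<times> 'e) set" and a
  have K_sub: "subgroup (fiber V a) K" if V: "subsystem V" and a: "a \<in> Y_of ` V" for V a
  proof (rule K.subgroupI)
    show "fiber V a \<subseteq> carrier K" using carrier_P_decomp(4) subsystemD(1)[OF V] unfolding fiber_def by blast
    show "fiber V a \<noteq> {}" using a unfolding fiber_def by blast
    fix i j assume "i \<in> fiber V a" "j \<in> fiber V a"
    then obtain x y where xy: "x \<in> V" "y \<in> V" "i = K_of x" "j = K_of y" "Y_of x = a" "Y_of y = a"
      unfolding fiber_def by blast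
    have xyP: "x \<in> carrier P" "y \<in> carrier P" using xy subsystemD(1)[OF V] by simp_all
    show "inv\<^bsub>K\<^esub> i \<in> fiber V a"
      using components_sinv[OF xyP(1)] subsystemD(3)[OF V xy(1)] xy(3,5) unfolding fiber_def by force
    have "K_of (x \<otimes>\<^bsub>P\<^esub> y) = i \<otimes>\<^bsub>K\<^esub> j" "Y_of (x \<otimes>\<^bsub>P\<^esub> y) = a"
      using components_mult(1,3)[OF xyP] xy Y.mult_idem[OF carrier_P_decomp(2)[OF xyP(1)]] by simp_all
    then show "i \<otimes>\<^bsub>K\<^esub> j \<in> fiber V a"
      using subsystemD(2)[OF V xy(1,2)] unfolding fiber_def by (intro image_eqI[of _ _ "x \<otimes>\<^bsub>P\<^esub> y"]) simp_all
  qed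
  \<comment> \<open>Over points that \<open>T\<close> does not meet the identity is taken. The
    automorphisms need not be compatible, as \<open>[Y;K]\<close> never combines nontrivial
    \<open>K\<close>-components of different points.\<close>
  have "\<exists>\<theta>. \<theta> \<in> iso K K \<and> (\<forall>x \<in> T. Y_of x = a \<longrightarrow> \<theta> (K_of x) = K_of (\<phi> x))" for a
  proof (cases "a \<in> Y_of ` T")
    case False
    have "(\<lambda>k. k) \<in> iso K K" by (rule iso_set_refl)
    then show ?thesis using False by blast
  next
    case True
    define \<phi>K where "\<phi>K k = K_of (\<phi> (SOME x. x \<in> T \<and> Y_of x = a \<and> K_of x = k))" for k
    have \<phi>K: "\<phi>K (K_of x) = K_of (\<phi> x)" if x: "x \<in> T" "Y_of x = a" for x
    proof -
      let ?y = "SOME y. y \<in> T \<and> Y_of y = a \<and> K_of y = K_of x"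
      have "?y \<in> T \<and> Y_of ?y = a \<and> K_of ?y = K_of x"
        by (rule someI[of "\<lambda>y. y \<in> T \<and> Y_of y = a \<and> K_of y = K_of x" x]) (simp add: x)
      then show ?thesis unfolding \<phi>K_def using K_iff[of ?y x] x by simp
    qed
    obtain t where t: "t \<in> T" "Y_of t = a" using True by blast
    let ?b = "Y_of (\<phi> t)"
    have b_iff: "Y_of (\<phi> x) = ?b \<longleftrightarrow> Y_of x = a" if "x \<in> T" for x using Y_iff[OF that t(1)] t(2) by simp
    have "\<phi>K \<in> iso (K\<lparr>carrier := fiber T a\<rparr>) (K\<lparr>carrier := fiber U ?b\<rparr>)"
    proof (rule iso_carrierI)
      fix i j assume "i \<in> fiber T a" "j \<in> fiber T a"
      then obtain x y where xy: "x \<in> T" "y \<in> T" "i = K_of x" "j = K_of y" "Y_of x = a" "Y_of y = a"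
        unfolding fiber_def by blast
      show "\<phi>K i \<in> fiber U ?b"
        unfolding fiber_def xy(3) \<phi>K[OF xy(1,5)] using \<phi>_mem[OF xy(1)] b_iff[OF xy(1)] xy(5) by blast
      note xyP = TP[OF xy(1)] TP[OF xy(2)]
      note \<phi>P = UP[OF \<phi>_mem[OF xy(1)]] UP[OF \<phi>_mem[OF xy(2)]]
      have 1: "K_of (x \<otimes>\<^bsub>P\<^esub> y) = i \<otimes>\<^bsub>K\<^esub> j" "Y_of (x \<otimes>\<^bsub>P\<^esub> y) = a"
        using components_mult(1,3)[OF xyP] xy Y.mult_idem[OF carrier_P_decomp(2)[OF xyP(1)]] by simp_all
      have "Y_of (\<phi> x) = ?b" "Y_of (\<phi> y) = ?b" using b_iff xy by simp_all
      then have 2: "K_of (\<phi> x \<otimes>\<^bsub>P\<^esub> \<phi> y) = K_of (\<phi> x) \<otimes>\<^bsub>K\<^esub> K_of (\<phi> y)"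
        using components_mult(3)[OF \<phi>P] Y.mult_idem[OF carrier_P_decomp(2)[OF \<phi>P(1)]] by simp
      have "\<phi>K (K_of (x \<otimes>\<^bsub>P\<^esub> y)) = K_of (\<phi> x \<otimes>\<^bsub>P\<^esub> \<phi> y)"
        using \<phi>K[OF subsystemD(2)[OF T xy(1,2)] 1(2)] \<phi>_mult[OF xy(1,2)] by simp
      then show "\<phi>K (i \<otimes>\<^bsub>K\<^esub> j) = \<phi>K i \<otimes>\<^bsub>K\<^esub> \<phi>K j"
        unfolding 1 2 using \<phi>K[OF xy(1,5)] \<phi>K[OF xy(2,6)] xy(3,4) by simp
    next
      show "inj_on \<phi>K (fiber T a)"
        unfolding fiber_def by (rule inj_on_imageI_eq) (simp add: \<phi>K K_iff)
      show "fiber U ?b \<subseteq> \<phi>K ` fiber T a"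
      proof
        fix k assume "k \<in> fiber U ?b"
        then obtain u where u: "u \<in> U" "Y_of u = ?b" "k = K_of u" unfolding fiber_def by blast
        then obtain x where x: "x \<in> T" "u = \<phi> x" using \<phi>_surj by blast
        then have "Y_of x = a" using b_iff u(2) by simp
        then have "k = \<phi>K (K_of x)" "K_of x \<in> fiber T a"
          using u(3) x \<phi>K unfolding fiber_def by auto
        then show "k \<in> \<phi>K ` fiber T a" by (rule image_eqI)
      qed
    qed
    moreover have "?b \<in> Y_of ` U" using \<phi>_mem[OF t(1)] by simp
    ultimately obtain \<theta> where \<theta>: "\<theta> \<in> iso K K" "\<And>k. k \<in> fiber T a \<Longrightarrow> \<theta> k = \<phi>K k"
      using extend_subgroup_iso[OF homogeneous_K finite_K K_sub[OF T True] K_sub[OF U]] by metis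
    have "\<theta> (K_of x) = K_of (\<phi> x)" if x: "x \<in> T" "Y_of x = a" for x
      using \<theta>(2)[of "K_of x"] \<phi>K[OF x] x unfolding fiber_def by auto
    then show ?thesis using \<theta>(1) by blast
  qed
  then obtain \<theta>K where \<theta>K: "\<And>a. \<theta>K a \<in> iso K K"
    "\<And>a x. \<lbrakk>x \<in> T; Y_of x = a\<rbrakk> \<Longrightarrow> \<theta>K a (K_of x) = K_of (\<phi> x)"
    by metis

  note isoY = isoD[OF \<theta>Y(1)] and isoI' = isoD[OF \<theta>I(1)] and isoK = isoD[OF \<theta>K(1)]
  have \<theta>K_one: "\<theta>K a \<one>\<^bsub>K\<^esub> = \<one>\<^bsub>K\<^esub>" for a
    using hom_one[of "\<theta>K a" K K] \<theta>K(1)[of a] K.group_axioms by (simp add: iso_def)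
  define \<theta> where "\<theta> x = ((\<theta>Y (Y_of x), \<theta>I (I_of x)), (\<theta>Y (Y_of x), \<theta>K (Y_of x) (K_of x)))" for x
  have \<theta>_eq: "\<theta> ((a, i), (a, k)) = ((\<theta>Y a, \<theta>I i), (\<theta>Y a, \<theta>K a k))" for a i k
    by (simp add: \<theta>_def)
  have "\<theta> \<in> iso P P"
  proof (rule isoI)
    fix x assume "x \<in> carrier P"
    then obtain a i k where x: "a \<in> carrier Y" "i \<in> carrier I" "k \<in> carrier K" "x = ((a, i), (a, k))"
      unfolding carrier_P by blast
    show "\<theta> x \<in> carrier P"
      unfolding x(4) \<theta>_eq carrier_P using isoY(1)[OF x(1)] isoI'(1)[OF x(2)] isoK(1)[OF x(3)] by blast
    fix y assume "y \<in> carrier P"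
    then obtain b j l where y: "b \<in> carrier Y" "j \<in> carrier I" "l \<in> carrier K" "y = ((b, j), (b, l))"
      unfolding carrier_P by blast
    let ?g = "a \<otimes>\<^bsub>Y\<^esub> b"
    have g: "?g \<in> carrier Y" using Y.mult_closed[OF x(1) y(1)] .
    have iff: "\<theta>Y a \<otimes>\<^bsub>Y\<^esub> \<theta>Y b = \<theta>Y a \<longleftrightarrow> ?g = a" "\<theta>Y a \<otimes>\<^bsub>Y\<^esub> \<theta>Y b = \<theta>Y b \<longleftrightarrow> ?g = b"
      using isoY(2)[OF x(1) y(1)] isoY(3) g x(1) y(1) by (simp_all add: inj_on_eq_iff flip: isoY(2))
    let ?k = "if ?g = a then k else \<one>\<^bsub>K\<^esub>" and ?l = "if ?g = b then l else \<one>\<^bsub>K\<^esub>"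
    have "\<theta>K ?g (?k \<otimes>\<^bsub>K\<^esub> ?l) = \<theta>K ?g ?k \<otimes>\<^bsub>K\<^esub> \<theta>K ?g ?l"
      using x(3) y(3) by (intro isoK(2)) simp_all
    \<comment> \<open>A surviving component has index \<open>?g\<close>, so that
      \<open>\<theta>K ?g\<close> is \<open>\<theta>K a\<close>; a lost one is the identity, which
      every \<open>\<theta>K\<close> fixes.\<close>
    also have "\<theta>K ?g ?k = (if ?g = a then \<theta>K a k else \<one>\<^bsub>K\<^esub>)" using \<theta>K_one by simp
    also have "\<theta>K ?g ?l = (if ?g = b then \<theta>K b l else \<one>\<^bsub>K\<^esub>)" using \<theta>K_one by simp
    finally have K_eq: "\<theta>K ?g (?k \<otimes>\<^bsub>K\<^esub> ?l)
      = (if ?g = a then \<theta>K a k else \<one>\<^bsub>K\<^esub>) \<otimes>\<^bsub>K\<^esub> (if ?g = b then \<theta>K b l else \<one>\<^bsub>K\<^esub>)" .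
    show "\<theta> (x \<otimes>\<^bsub>P\<^esub> y) = \<theta> x \<otimes>\<^bsub>P\<^esub> \<theta> y"
      unfolding x(4) y(4) mult_P[OF x(1) y(1) x(3) y(3)] \<theta>_eq K_eq
        mult_P[OF isoY(1)[OF x(1)] isoY(1)[OF y(1)] isoK(1)[OF x(3)] isoK(1)[OF y(3)]] iff
        isoY(2)[OF x(1) y(1)] isoI'(2)[OF x(2) y(2)] ..
  next
    show "inj_on \<theta> (carrier P)"
    proof (rule inj_onI)
      fix x y assume x: "x \<in> carrier P" and y: "y \<in> carrier P" and eq: "\<theta> x = \<theta> y"
      note dx = carrier_P_decomp(2-)[OF x] and dy = carrier_P_decomp(2-)[OF y]
      have "\<theta>Y (Y_of x) = \<theta>Y (Y_of y)" "\<theta>I (I_of x) = \<theta>I (I_of y)"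
        "\<theta>K (Y_of x) (K_of x) = \<theta>K (Y_of y) (K_of y)"
        using eq by (simp_all add: \<theta>_def)
      moreover from this(1) have "Y_of x = Y_of y" using inj_onD[OF isoY(3)] dx(1) dy(1) by blast
      ultimately show "x = y"
        using P_eqI[OF x y] inj_onD[OF isoI'(3) _ dx(2) dy(2)] inj_onD[OF isoK(3) _ dx(3) dy(3), of "Y_of y"]
        by simp
    qed
    show "carrier P \<subseteq> \<theta> ` carrier P"
    proof
      fix y assume "y \<in> carrier P"
      then obtain b j l where y: "b \<in> carrier Y" "j \<in> carrier I" "l \<in> carrier K" "y = ((b, j), (b, l))"
        unfolding carrier_P by blast
      obtain a where a: "a \<in> carrier Y" "b = \<theta>Y a" using y(1) isoY(4) by blast
      obtain i where i: "i \<in> carrier I" "j = \<theta>I i" using y(2) isoI'(4) by blast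
      obtain k where k: "k \<in> carrier K" "l = \<theta>K a k" using y(3) isoK(4)[of a] by blast
      have "y = \<theta> ((a, i), (a, k))" unfolding \<theta>_eq y(4) a(2) i(2) k(2) ..
      moreover have "((a, i), (a, k)) \<in> carrier P" unfolding carrier_P using a(1) i(1) k(1) by blast
      ultimately show "y \<in> \<theta> ` carrier P" by (rule image_eqI)
    qed
  qed
  moreover have "\<theta> x = \<phi> x" if x: "x \<in> T" for x
    using carrier_P_decomp(1)[OF UP[OF \<phi>_mem[OF x]]] \<theta>Y(2)[OF x] \<theta>I(2)[of "I_of x"] \<phi>I[OF x]
      \<theta>K(2)[OF x refl] x by (simp add: \<theta>_def)
  ultimately show ?thesis by blast
qed

text \<open>\<open>Y_of\<close> is multiplicative and unchanged by inverses, so finite generation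
  passes to the projection, where homogeneity of \<open>Y\<close> applies.\<close>

lemma inv_generate_subsystem:
  assumes "A \<subseteq> carrier P" "A \<noteq> {}"
  shows "subsystem (inv_generate P A)" "Y_of ` inv_generate P A = sl_generate Y (Y_of ` A)"
proof -
  have sub: "x \<in> carrier P" if "x \<in> inv_generate P A" for x
    using P.inv_generate_incl_carrier[OF assms(1) that] .
  show "subsystem (inv_generate P A)"
    unfolding subsystem_def using sub assms(2) by (auto intro: inv_generate.intros)
  have 1: "Y_of x \<in> sl_generate Y (Y_of ` A)" if "x \<in> inv_generate P A" for x
    using that
  proof induct
    case (mult a b)
    then show ?case
      unfolding components_mult(1)[OF sub[OF mult(1)] sub[OF mult(3)]] by (intro sl_generate.mult)
  next
    case (inv a)
    then show ?case using components_sinv(1)[OF sub] by simp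
  qed (auto intro: sl_generate.incl)
  have 2: "a \<in> Y_of ` inv_generate P A" if "a \<in> sl_generate Y (Y_of ` A)" for a
    using that
  proof induct
    case (mult a b)
    then obtain x y where xy: "x \<in> inv_generate P A" "y \<in> inv_generate P A" "a = Y_of x" "b = Y_of y"
      by blast
    show ?case
      using components_mult(1)[OF sub[OF xy(1)] sub[OF xy(2)]] inv_generate.mult[OF xy(1,2)] xy(3,4)
      by (metis imageI)
  qed (auto intro: inv_generate.incl)
  from 1 2 show "Y_of ` inv_generate P A = sl_generate Y (Y_of ` A)" by blast
qed

lemma inv_generate_empty: "inv_generate P {} = {}"
proof -
  have False if "x \<in> inv_generate P {}" for x using that by induct auto
  then show ?thesis by blast
qed

lemma HIS_P: "HIS P"
  unfolding HIS_def
proof (intro conjI allI impI)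
  show "inverse_semigroup P" by (rule P.inverse_semigroup_axioms)
  fix A B assume AB: "finite A \<and> A \<subseteq> carrier P \<and> finite B \<and> B \<subseteq> carrier P"
  show "isos_extend P (inv_generate P A) (inv_generate P B)"
    unfolding isos_extend_def
  proof
    fix \<phi> assume \<phi>: "\<phi> \<in> iso (P\<lparr>carrier := inv_generate P A\<rparr>) (P\<lparr>carrier := inv_generate P B\<rparr>)"
    have surj: "\<phi> ` inv_generate P A = inv_generate P B" using isoD(4)[OF \<phi>] by simp
    show "\<exists>\<theta> \<in> iso P P. \<forall>x \<in> inv_generate P A. \<theta> x = \<phi> x"
    \<comment> \<open>The empty set generates the empty set, which is no \<open>subsystem\<close>;
      in that case the identity extends \<open>\<phi>\<close>.\<close>
    proof (cases "A = {}")
      case True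
      have "(\<lambda>x. x) \<in> iso P P" by (rule iso_set_refl)
      then show ?thesis using True inv_generate_empty by auto
    next
      case False
      then obtain a where "a \<in> A" by blast
      then have "\<phi> a \<in> \<phi> ` inv_generate P A" by (intro imageI inv_generate.incl)
      then have "\<phi> a \<in> inv_generate P B" unfolding surj .
      then have B: "B \<noteq> {}" using inv_generate_empty by auto
      have sub: "A \<subseteq> carrier P" "B \<subseteq> carrier P" using AB by simp_all
      note gA = inv_generate_subsystem[OF sub(1) False] and gB = inv_generate_subsystem[OF sub(2) B]
      have "Y_of ` A \<subseteq> carrier Y" "Y_of ` B \<subseteq> carrier Y"
        using carrier_P_decomp(2) sub by blast+
      then have "isos_extend Y (sl_generate Y (Y_of ` A)) (sl_generate Y (Y_of ` B))"
        using homogeneous_Y AB unfolding homogeneous_semilattice_def by simp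
      then show ?thesis
        using subsystem_extend[OF gA(1) gB(1) \<phi>] unfolding gA(2) gB(2) by simp
    qed
  qed
qed

end

theorem theorem4p39:
  shows
    "(\<forall>(Y :: 'y monoid) (I :: 'i monoid) (K :: 'k monoid).
        homogeneous_semilattice Y \<and> countable (carrier Y) \<and>
        homogeneous_group I \<and> finite (carrier I) \<and>
        homogeneous_group K \<and> finite (carrier K) \<and>
        coprime_orders I K
        \<longrightarrow> clifford_semigroup (spined_product (Y \<times>\<times> I) (sl_group Y K)) \<and>
            HIS (spined_product (Y \<times>\<times> I) (sl_group Y K)))
     \<and>
     (\<forall>S :: 's monoid.
        HIS S \<and> countable (carrier S) \<and> finite_maximal_subgroups S
        \<longrightarrow> (\<exists>(Y :: 's monoid) (I :: 's monoid) (K :: 's monoid).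
              homogeneous_semilattice Y \<and> countable (carrier Y) \<and>
              homogeneous_group I \<and> finite (carrier I) \<and>
              homogeneous_group K \<and> finite (carrier K) \<and>
              coprime_orders I K \<and>
              S \<cong> spined_product (Y \<times>\<times> I) (sl_group Y K)))"
proof (intro conjI allI impI)
  fix Y :: "'y monoid" and I :: "'i monoid" and K :: "'k monoid"
  assume *: "homogeneous_semilattice Y \<and> countable (carrier Y) \<and>
    homogeneous_group I \<and> finite (carrier I) \<and>
    homogeneous_group K \<and> finite (carrier K) \<and> coprime_orders I K"
  interpret HIS_factors Y I K
    using * unfolding HIS_factors_def HIS_factors_axioms_def spined_factors_def
    by (simp add: homogeneous_semilattice_def homogeneous_group_def)
  show "clifford_semigroup (spined_product (Y \<times>\<times> I) (sl_group Y K))"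
    by (rule clifford_semigroup_P)
  show "HIS (spined_product (Y \<times>\<times> I) (sl_group Y K))"
    by (rule HIS_P)
next
  fix S :: "'s monoid"
  assume "HIS S \<and> countable (carrier S) \<and> finite_maximal_subgroups S"
  then have "HIS S" "countable (carrier S)" "finite_maximal_subgroups S" by simp_all
  then obtain Y I K :: "'s monoid" where "homogeneous_semilattice Y" "countable (carrier Y)"
    "homogeneous_group I" "finite (carrier I)" "homogeneous_group K" "finite (carrier K)"
    "coprime_orders I K" "S \<cong> spined_product (Y \<times>\<times> I) (sl_group Y K)"
    by (rule HIS_structure)
  then show "\<exists>(Y :: 's monoid) (I :: 's monoid) (K :: 's monoid).
      homogeneous_semilattice Y \<and> countable (carrier Y) \<and>
      homogeneous_group I \<and> finite (carrier I) \<and>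
      homogeneous_group K \<and> finite (carrier K) \<and>
      coprime_orders I K \<and> S \<cong> spined_product (Y \<times>\<times> I) (sl_group Y K)"
    by blast
qed

end
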